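(* Let $G$ be a locally compact second countable group and let $E$ be a coefficient $G$-module in the sense of Monod, with action $\pi$. Let $S$ be a standard Borel amenable $G$-space. Endow $E$ with the measurable coefficient $(G\ltimes S)$-module structure $L(g,x)=\pi(g)$. Then $\mathrm{H}^k_{mb}(G\ltimes S,E)=0$ for every $k\ge1$.
   Context: **Amenable $G$-space.** $(S,\mu)$ is a standard Borel space with a Borel $G$-action and a quasi-invariant measure $\mu$. It is amenable (in the sense of Zimmer) if, equivalently, there is a $G$-equivariant conditional expectation $L^\infty(G\times S,\mathbb{R})\to L^\infty(S,\mathbb{R})$, i.e. a positive, norm-one, unital, $L^\infty(S)$-linear map, equivariant for the diagonal $G$-action on $G\times S$ ($G$ acting on itself by left translation). **Coefficients.** A coefficient $G$-module in the sense of Monod is the dual $E$ of a separable Banach space $E^\flat$ with the contragredient of a continuous isometric $G$-representation on $E^\flat$. **Semidirect groupoid.** $\mathcal{G}=G\ltimes S$ is the groupoid with underlying set $G\times S$, unit space $S$, source $s(g,x)=x$, target $t(g,x)=gx$, $(h,gx)(g,x)=(hg,x)$, $(g,x)^{-1}=(g^{-1},gx)$, and measure class of (Haar)$\times\mu$. **Measurable bounded cohomology.** Let $\nu$ be a symmetric probability measure in the class of $\mathcal{G}$ with disintegration $\nu=\int\nu^x\,d\mu'(x)$ along $t$ ($\mu'=t_*\nu$, $\nu^x$ supported on $t^{-1}(x)$). $\mathcal{G}^{(n)}$ is the set of $n$-tuples in $\mathcal{G}$ with common target, with measure $\nu^{(n)}=\int(\nu^x)^{\otimes n}d\mu'(x)$.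 $L^\infty_{w^*}(\mathcal{G}^{(n)},E)$: weak$^*$ measurable essentially bounded functions modulo a.e. equality; $\lambda$ is $\mathcal{G}$-invariant if $L(g)\lambda(g^{-1}g_1,\dots,g^{-1}g_n)=\lambda(g_1,\dots,g_n)$ for $\nu^{(n+1)}$-a.e. $(g,g_1,\dots,g_n)\in\mathcal{G}^{(n+1)}$. $\mathrm{H}^k_{mb}(\mathcal{G},E)$ is the $k$-th cohomology of $\big(L^\infty_{w^*}(\mathcal{G}^{(k+1)},E)^{\mathcal{G}}\big)_{k\ge0}$ with the homogeneous coboundary $\delta\lambda(g_1,\dots,g_{k+2})=\sum_i(-1)^{i-1}\lambda(\dots,\widehat{g_i},\dots)$. *)

theory Defs
  imports "HOL-Probability.Probability" "HOL-Algebra.Elementary_Groups"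
begin

text \<open>
  Topological groups are types of class \<open>topological_group_add\<close>. This class does not assume
  commutativity: \<open>g + h\<close>, \<open>0\<close> and \<open>- g\<close> stand for the product, the unit and the inverse of an
  arbitrary group.
\<close>

definition left_haar_measure :: "'g::topological_group_add measure \<Rightarrow> bool" where
  "left_haar_measure m \<longleftrightarrow>
     sets m = sets borel \<and>
     (\<forall>g. distr m borel (\<lambda>h. g + h) = m) \<and>
     (\<forall>K. compact K \<longrightarrow> emeasure m K < \<infinity>) \<and>
     (\<forall>U. open U \<and> U \<noteq> {} \<longrightarrow> emeasure m U > 0)"

definition standard_borel_space :: "'s measure \<Rightarrow> bool" where
  "standard_borel_space M \<longleftrightarrow>
     (\<exists>T. topspace T = space M \<and> completely_metrizable_space T \<and> second_countable T \<and>
          sets M = sigma_sets (space M) {U. openin T U})"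


section \<open>Amenable actions\<close>

definition G_space :: "'s measure \<Rightarrow> ('g::topological_group_add \<Rightarrow> 's \<Rightarrow> 's) \<Rightarrow> bool" where
  "G_space \<mu> act \<longleftrightarrow>
     standard_borel_space \<mu> \<and> sigma_finite_measure \<mu> \<and>
     (\<lambda>(g, x). act g x) \<in> borel \<Otimes>\<^sub>M \<mu> \<rightarrow>\<^sub>M \<mu> \<and>
     (\<forall>x\<in>space \<mu>. act 0 x = x) \<and>
     (\<forall>g h. \<forall>x\<in>space \<mu>. act (g + h) x = act g (act h x)) \<and>
     (\<forall>g. null_sets (distr \<mu> \<mu> (act g)) = null_sets \<mu>)"

text \<open>Representatives of the elements of \<open>L\<^sup>\<infinity>(M, \<real>)\<close>.\<close>

definition Linf :: "'a measure \<Rightarrow> ('a \<Rightarrow> real) set" where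
  "Linf M = {f \<in> borel_measurable M. \<exists>C. AE x in M. \<bar>f x\<bar> \<le> C}"

text \<open>
  A map \<open>P\<close> on representatives that respects almost everywhere equality, i.e. a map
  \<open>L\<^sup>\<infinity>(G \<times> S) \<rightarrow> L\<^sup>\<infinity>(S)\<close>. Norm one means that \<open>P\<close> does not increase the essential supremum norm,
  the value 1 being attained because \<open>P\<close> is unital.
  The action on functions is \<open>(g f)(h, x) = f (g\<^sup>-\<^sup>1 h, g\<^sup>-\<^sup>1 x)\<close> and \<open>(g f)(x) = f (g\<^sup>-\<^sup>1 x)\<close>.
\<close>

definition equivariant_conditional_expectation ::
  "'g::topological_group_add measure \<Rightarrow> 's measure \<Rightarrow> ('g \<Rightarrow> 's \<Rightarrow> 's) \<Rightarrow>
   (('g \<times> 's \<Rightarrow> real) \<Rightarrow> 's \<Rightarrow> real) \<Rightarrow> bool" where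
  "equivariant_conditional_expectation m \<mu> act P \<longleftrightarrow>
     (\<forall>f \<in> Linf (m \<Otimes>\<^sub>M \<mu>). P f \<in> Linf \<mu>) \<and>
     (\<forall>f \<in> Linf (m \<Otimes>\<^sub>M \<mu>). \<forall>f' \<in> Linf (m \<Otimes>\<^sub>M \<mu>).
        (AE z in m \<Otimes>\<^sub>M \<mu>. f z = f' z) \<longrightarrow> (AE x in \<mu>. P f x = P f' x)) \<and>
     (\<forall>f \<in> Linf (m \<Otimes>\<^sub>M \<mu>). \<forall>f' \<in> Linf (m \<Otimes>\<^sub>M \<mu>).
        AE x in \<mu>. P (\<lambda>z. f z + f' z) x = P f x + P f' x) \<and>
     (\<forall>\<phi> \<in> Linf \<mu>. \<forall>f \<in> Linf (m \<Otimes>\<^sub>M \<mu>).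
        AE x in \<mu>. P (\<lambda>(h, y). \<phi> y * f (h, y)) x = \<phi> x * P f x) \<and>
     (\<forall>f \<in> Linf (m \<Otimes>\<^sub>M \<mu>). (AE z in m \<Otimes>\<^sub>M \<mu>. 0 \<le> f z) \<longrightarrow> (AE x in \<mu>. 0 \<le> P f x)) \<and>
     (AE x in \<mu>. P (\<lambda>_. 1) x = 1) \<and>
     (\<forall>f \<in> Linf (m \<Otimes>\<^sub>M \<mu>).
        esssup \<mu> (\<lambda>x. ereal \<bar>P f x\<bar>) \<le> esssup (m \<Otimes>\<^sub>M \<mu>) (\<lambda>z. ereal \<bar>f z\<bar>)) \<and>
     (\<forall>g. \<forall>f \<in> Linf (m \<Otimes>\<^sub>M \<mu>).
        AE x in \<mu>. P (\<lambda>(h, y). f (- g + h, act (- g) y)) x = P f (act (- g) x))"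

definition amenable_G_space ::
  "'g::topological_group_add measure \<Rightarrow> 's measure \<Rightarrow> ('g \<Rightarrow> 's \<Rightarrow> 's) \<Rightarrow> bool" where
  "amenable_G_space m \<mu> act \<longleftrightarrow>
     G_space \<mu> act \<and> (\<exists>P. equivariant_conditional_expectation m \<mu> act P)"


section \<open>Coefficient modules\<close>

text \<open>
  The separable Banach space is a type \<open>'v\<close> of class \<open>{banach, second_countable_topology}\<close>
  and the coefficient module is its dual \<open>'v \<Rightarrow>\<^sub>L real\<close>.
\<close>

definition continuous_isometric_rep ::
  "('g::topological_group_add \<Rightarrow> 'v::real_normed_vector \<Rightarrow>\<^sub>L 'v) \<Rightarrow> bool" where
  "continuous_isometric_rep \<rho> \<longleftrightarrow>
     \<rho> 0 = id_blinfun \<and>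
     (\<forall>g h. \<rho> (g + h) = \<rho> g o\<^sub>L \<rho> h) \<and>
     (\<forall>g v. norm (blinfun_apply (\<rho> g) v) = norm v) \<and>
     (\<forall>v. continuous_on UNIV (\<lambda>g. blinfun_apply (\<rho> g) v))"

definition contragredient ::
  "('g::topological_group_add \<Rightarrow> 'v::real_normed_vector \<Rightarrow>\<^sub>L 'v) \<Rightarrow>
   'g \<Rightarrow> ('v \<Rightarrow>\<^sub>L real) \<Rightarrow> ('v \<Rightarrow>\<^sub>L real)" where
  "contragredient \<rho> g \<xi> = \<xi> o\<^sub>L \<rho> (- g)"


section \<open>Measured groupoids\<close>

text \<open>
  Of the measure \<open>arrows\<close> only the measurable space and the null sets matter, of the
  measure \<open>units\<close> only the measurable space.
\<close>

record ('a, 'x) measured_groupoid =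
  arrows :: "'a measure"
  units :: "'x measure"
  src :: "'a \<Rightarrow> 'x"
  tgt :: "'a \<Rightarrow> 'x"
  gmult :: "'a \<Rightarrow> 'a \<Rightarrow> 'a"
  ginv :: "'a \<Rightarrow> 'a"

definition semidirect_groupoid ::
  "'g::topological_group_add measure \<Rightarrow> 's measure \<Rightarrow> ('g \<Rightarrow> 's \<Rightarrow> 's) \<Rightarrow>
   ('g \<times> 's, 's) measured_groupoid" where
  "semidirect_groupoid m \<mu> act =
     \<lparr>arrows = m \<Otimes>\<^sub>M \<mu>, units = \<mu>,
      src = (\<lambda>(g, x). x), tgt = (\<lambda>(g, x). act g x),
      gmult = (\<lambda>(h, y) (g, x). (h + g, x)),
      ginv = (\<lambda>(g, x). (- g, act g x))\<rparr>"

definition symmetric_probability :: "('a, 'x) measured_groupoid \<Rightarrow> 'a measure \<Rightarrow> bool" where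
  "symmetric_probability \<G> \<nu> \<longleftrightarrow>
     prob_space \<nu> \<and> sets \<nu> = sets (arrows \<G>) \<and>
     null_sets \<nu> = null_sets (arrows \<G>) \<and>
     distr \<nu> (arrows \<G>) (ginv \<G>) = \<nu>"

definition target_measure :: "('a, 'x) measured_groupoid \<Rightarrow> 'a measure \<Rightarrow> 'x measure" where
  "target_measure \<G> \<nu> = distr \<nu> (units \<G>) (tgt \<G>)"

definition target_disintegration ::
  "('a, 'x) measured_groupoid \<Rightarrow> 'a measure \<Rightarrow> ('x \<Rightarrow> 'a measure) \<Rightarrow> bool" where
  "target_disintegration \<G> \<nu> \<kappa> \<longleftrightarrow>
     \<kappa> \<in> units \<G> \<rightarrow>\<^sub>M prob_algebra (arrows \<G>) \<and>
     Giry_Monad.bind (target_measure \<G> \<nu>) \<kappa> = \<nu> \<and>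
     (AE x in target_measure \<G> \<nu>. AE g in \<kappa> x. tgt \<G> g = x)"

text \<open>
  An \<open>n\<close>-tuple \<open>(g\<^sub>1, \<dots>, g\<^sub>n)\<close> is a function \<open>g\<close> on \<open>{..<n}\<close>, extended by \<open>undefined\<close>, with
  \<open>g i\<close> in the place of \<open>g\<^sub>i\<^sub>+\<^sub>1\<close>.
\<close>

definition fibre_power :: "('a, 'x) measured_groupoid \<Rightarrow> nat \<Rightarrow> (nat \<Rightarrow> 'a) set" where
  "fibre_power \<G> n =
     {g \<in> {..<n} \<rightarrow>\<^sub>E space (arrows \<G>). \<forall>i<n. \<forall>j<n. tgt \<G> (g i) = tgt \<G> (g j)}"

definition fibre_measure ::
  "('a, 'x) measured_groupoid \<Rightarrow> 'a measure \<Rightarrow> ('x \<Rightarrow> 'a measure) \<Rightarrow> nat \<Rightarrow> (nat \<Rightarrow> 'a) measure" where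
  "fibre_measure \<G> \<nu> \<kappa> n =
     restrict_space
       (Giry_Monad.bind (target_measure \<G> \<nu>) (\<lambda>x. \<Pi>\<^sub>M i\<in>{..<n}. \<kappa> x))
       (fibre_power \<G> n)"


section \<open>Measurable bounded cohomology\<close>

text \<open>Representatives of the elements of \<open>L\<^sup>\<infinity>\<^sub>w\<^sub>*(M, E)\<close>, where \<open>E\<close> is the dual of \<open>'v\<close>.\<close>

definition Linf_weak_star :: "'t measure \<Rightarrow> ('t \<Rightarrow> ('v::real_normed_vector \<Rightarrow>\<^sub>L real)) set" where
  "Linf_weak_star M =
     {f. (\<forall>v. (\<lambda>t. blinfun_apply (f t) v) \<in> borel_measurable M) \<and>
         (\<exists>C. AE t in M. norm (f t) \<le> C)}"

text \<open>\<open>L\<^sup>\<infinity>\<^sub>w\<^sub>*(M, E)\<close> itself, as the additive group of classes modulo almost everywhere equality.\<close>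

definition Linf_weak_star_group ::
  "'t measure \<Rightarrow> ('t \<Rightarrow> ('v::real_normed_vector \<Rightarrow>\<^sub>L real)) set monoid" where
  "Linf_weak_star_group M =
     \<lparr>carrier = Linf_weak_star M, monoid.mult = (\<lambda>f f' t. f t + f' t), one = (\<lambda>_. 0)\<rparr>
       Mod {f \<in> Linf_weak_star M. AE t in M. f t = 0}"

context
  fixes \<G> :: "('a, 'x) measured_groupoid" and \<nu> :: "'a measure" and \<kappa> :: "'x \<Rightarrow> 'a measure"
    and L :: "'a \<Rightarrow> ('v::real_normed_vector \<Rightarrow>\<^sub>L real) \<Rightarrow> ('v \<Rightarrow>\<^sub>L real)"
begin

definition groupoid_invariant :: "nat \<Rightarrow> ((nat \<Rightarrow> 'a) \<Rightarrow> ('v \<Rightarrow>\<^sub>L real)) \<Rightarrow> bool" where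
  "groupoid_invariant n u \<longleftrightarrow>
     (AE h in fibre_measure \<G> \<nu> \<kappa> (Suc n).
        L (h 0) (u (\<lambda>i\<in>{..<n}. gmult \<G> (ginv \<G> (h 0)) (h (Suc i)))) =
        u (\<lambda>i\<in>{..<n}. h (Suc i)))"

text \<open>The cochains of degree \<open>k\<close>, i.e. the group \<open>L\<^sup>\<infinity>\<^sub>w\<^sub>*(\<G>\<^sup>(\<^sup>k\<^sup>+\<^sup>1\<^sup>), E)\<^sup>\<G>\<close>.\<close>

definition mb_cochains :: "nat \<Rightarrow> ((nat \<Rightarrow> 'a) \<Rightarrow> ('v \<Rightarrow>\<^sub>L real)) set monoid" where
  "mb_cochains k =
     (let A = Linf_weak_star_group (fibre_measure \<G> \<nu> \<kappa> (Suc k))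
      in A\<lparr>carrier := {c \<in> carrier A. \<exists>u\<in>c. groupoid_invariant (Suc k) u}\<rparr>)"

definition homogeneous_coboundary ::
  "nat \<Rightarrow> ((nat \<Rightarrow> 'a) \<Rightarrow> ('v \<Rightarrow>\<^sub>L real)) \<Rightarrow> (nat \<Rightarrow> 'a) \<Rightarrow> ('v \<Rightarrow>\<^sub>L real)" where
  "homogeneous_coboundary k u g =
     (\<Sum>i\<le>Suc k. (-1) ^ i *\<^sub>R u (\<lambda>j\<in>{..<Suc k}. if j < i then g j else g (Suc j)))"

text \<open>The map induced on classes.\<close>

definition mb_coboundary ::
  "nat \<Rightarrow> ((nat \<Rightarrow> 'a) \<Rightarrow> ('v \<Rightarrow>\<^sub>L real)) set \<Rightarrow> ((nat \<Rightarrow> 'a) \<Rightarrow> ('v \<Rightarrow>\<^sub>L real)) set" where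
  "mb_coboundary k c =
     (let M = fibre_measure \<G> \<nu> \<kappa> (Suc (Suc k))
      in {f \<in> Linf_weak_star M. \<exists>u\<in>c. AE g in M. f g = homogeneous_coboundary k u g})"

definition mb_cocycles :: "nat \<Rightarrow> ((nat \<Rightarrow> 'a) \<Rightarrow> ('v \<Rightarrow>\<^sub>L real)) set set" where
  "mb_cocycles k = {c \<in> carrier (mb_cochains k). mb_coboundary k c = \<one>\<^bsub>mb_cochains (Suc k)\<^esub>}"

definition mb_coboundaries :: "nat \<Rightarrow> ((nat \<Rightarrow> 'a) \<Rightarrow> ('v \<Rightarrow>\<^sub>L real)) set set" where
  "mb_coboundaries k =
     (case k of 0 \<Rightarrow> {\<one>\<^bsub>mb_cochains 0\<^esub>}
      | Suc j \<Rightarrow> mb_coboundary j ` carrier (mb_cochains j))"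

definition mb_cohomology :: "nat \<Rightarrow> ((nat \<Rightarrow> 'a) \<Rightarrow> ('v \<Rightarrow>\<^sub>L real)) set set monoid" where
  "mb_cohomology k = (mb_cochains k)\<lparr>carrier := mb_cocycles k\<rparr> Mod mb_coboundaries k"

end

end

theory Submission
  imports Defs
begin

text \<open>
  The arrows with target \<open>x\<close> are the pairs \<open>(g, g\<^sup>-\<^sup>1 x)\<close>. In these coordinates the fibre power of order
  \<open>n\<close> is \<open>G\<^sup>n \<times> S\<close> with the product measure class, and groupoid invariance becomes invariance under
  the diagonal action of \<open>G\<close>.

  The conditional expectation \<open>P : L\<^sup>\<infinity>(G \<times> S) \<rightarrow> L\<^sup>\<infinity>(S)\<close> is not normal, so it cannot be applied
  pointwise in additional parameters. It nevertheless extends to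
  \<open>L\<^sup>\<infinity>\<^sub>w\<^sub>*(G \<times> H \<times> S, E) \<rightarrow> L\<^sup>\<infinity>\<^sub>w\<^sub>*(H \<times> S, E)\<close> for every \<open>\<sigma>\<close>-finite \<open>H\<close>: the image \<open>F\<close> of \<open>f\<close> is
  characterized by \<open>P (\<integral> \<phi>(h) f(\<cdot>, h, \<cdot>) dh) = \<integral> \<phi>(h) F(h, \<cdot>) dh\<close> for all \<open>\<phi> \<in> L\<^sup>1(H)\<close>. For \<open>f\<close> real and
  nonnegative and \<open>H\<close> finite, \<open>B \<mapsto> \<integral> P (\<integral> 1\<^sub>B f dh)\<close> is a finitely additive set function dominated by
  a multiple of the product measure, hence a measure, and \<open>F\<close> is its Radon--Nikodym derivative. The
  general case follows by changing the measure on \<open>H\<close>, and by testing against a countable dense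
  subset of the predual.

  Applying this extension to the last variable of a cochain, with \<open>H = G\<^sup>n\<close> and Haar measure, yields a
  contracting homotopy. It preserves invariance because \<open>P\<close> is equivariant and the measure on
  \<open>H\<close> is left invariant.
\<close>

section \<open>Conditional expectations\<close>

text \<open>Since P is neither normal nor defined pointwise, its extension with parameters is never
  computed. It is pinned down by its pairings with L^1 weights, and uniqueness then does the work of
  a formula: the norm bound, linearity in the predual, the homotopy identity and equivariance are
  all obtained by exhibiting two functions with the same pairings. The exceptional null set may
  depend on the weight, which is why separability and countable families of conditions recur. The
  cochains are known to be invariant only under almost every g. No strictly invariant representative
  is constructed: the homotopy preserves invariance under each single g, so the conull set of good g
  is carried along, and Fubini returns to groupoid invariance. The base measure is the target
  measure of \<nu> rather than \<mu>: it is a probability measure in the same class, so bounded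
  functions on S are integrable. Degree at least 1 enters because the primitive then has at least
  one argument, from which the base point x can be read off.\<close>

lemma AE_eq_if_integral_indicator_eq:
  fixes f g :: "'a \<Rightarrow> real"
  assumes f: "integrable M f" and g: "integrable M g"
    and eq: "\<And>A. A \<in> sets M \<Longrightarrow> (\<integral>x. indicator A x * f x \<partial>M) = (\<integral>x. indicator A x * g x \<partial>M)"
  shows "AE x in M. f x = g x"
proof -
  have le: "AE x in M. u x \<le> w x" if u: "integrable M u" and w: "integrable M w"
    and e: "\<And>A. A \<in> sets M \<Longrightarrow> (\<integral>x. indicator A x * u x \<partial>M) = (\<integral>x. indicator A x * w x \<partial>M)"
    for u w :: "'a \<Rightarrow> real"
  proof -
    have [measurable]: "u \<in> borel_measurable M" "w \<in> borel_measurable M"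
      using u w by auto
    define A where "A = {x \<in> space M. w x < u x}"
    have A: "A \<in> sets M" by (simp add: A_def)
    have i: "integrable M (\<lambda>x. indicator A x * u x)" "integrable M (\<lambda>x. indicator A x * w x)"
      using integrable_real_mult_indicator[OF A u] integrable_real_mult_indicator[OF A w]
      by (simp_all add: mult.commute)
    have "(\<integral>x. indicator A x * u x - indicator A x * w x \<partial>M) = 0"
      using i e[OF A] by simp
    then have "AE x in M. x \<in> space M \<and> indicator A x * u x - indicator A x * w x = 0"
      by (subst (asm) integral_nonneg_eq_0_iff_AE)
         (use i in \<open>auto simp: A_def indicator_def\<close>)
    then show ?thesis
      by eventually_elim (auto simp: A_def indicator_def split: if_splits)
  qed
  have "AE x in M. f x \<le> g x" "AE x in M. g x \<le> f x"
    using le[OF f g eq] le[OF g f eq[symmetric]] by auto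
  then show ?thesis by eventually_elim simp
qed

text \<open>Since \<open>Q\<close> is an arbitrary predicate, its exceptional set is covered by a
  null set \<open>N\<close>, and only the rectangle over \<open>N\<close> is measured.\<close>

lemma (in pair_sigma_finite) AE_pair_snd:
  assumes "AE y in M2. Q y" shows "AE z in M1 \<Otimes>\<^sub>M M2. Q (snd z)"
proof -
  obtain N where N: "N \<in> null_sets M2" "{y \<in> space M2. \<not> Q y} \<subseteq> N"
    using assms by (auto elim!: AE_E simp: null_sets_def)
  have "space M1 \<times> N \<in> null_sets (M1 \<Otimes>\<^sub>M M2)"
    using N by (auto simp: null_sets_def M2.emeasure_pair_measure_Times)
  then show ?thesis
    by (rule AE_I') (use N in \<open>auto simp: space_pair_measure\<close>)
qed

lemma (in pair_sigma_finite) AE_pair_fst: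
  assumes "AE x in M1. Q x" shows "AE z in M1 \<Otimes>\<^sub>M M2. Q (fst z)"
proof -
  obtain N where N: "N \<in> null_sets M1" "{y \<in> space M1. \<not> Q y} \<subseteq> N"
    using assms by (auto elim!: AE_E simp: null_sets_def)
  have "N \<times> space M2 \<in> null_sets (M1 \<Otimes>\<^sub>M M2)"
    using N by (auto simp: null_sets_def M2.emeasure_pair_measure_Times)
  then show ?thesis
    by (rule AE_I') (use N in \<open>auto simp: space_pair_measure\<close>)
qed

section \<open>The algebra of essentially bounded functions\<close>

lemma LinfI: "f \<in> borel_measurable M \<Longrightarrow> (\<And>z. z \<in> space M \<Longrightarrow> \<bar>f z\<bar> \<le> C) \<Longrightarrow> f \<in> Linf M"
  by (auto simp: Linf_def intro!: exI[of _ C])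

lemma Linf_measurable: "f \<in> Linf M \<Longrightarrow> f \<in> borel_measurable M"
  by (auto simp: Linf_def)

lemma Linf_const: "(\<lambda>_. c) \<in> Linf M"
  by (rule LinfI[of _ _ "\<bar>c\<bar>"]) auto

lemma Linf_add:
  assumes "f \<in> Linf M" "g \<in> Linf M" shows "(\<lambda>z. f z + g z) \<in> Linf M"
proof -
  obtain C D where "AE x in M. \<bar>f x\<bar> \<le> C" "AE x in M. \<bar>g x\<bar> \<le> D"
    using assms by (auto simp: Linf_def)
  then have "AE x in M. \<bar>f x + g x\<bar> \<le> C + D" by eventually_elim auto
  then show ?thesis using assms by (auto simp: Linf_def)
qed

lemma Linf_mult:
  assumes "f \<in> Linf M" "g \<in> Linf M" shows "(\<lambda>z. f z * g z) \<in> Linf M"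
proof -
  obtain C D where "AE x in M. \<bar>f x\<bar> \<le> C" "AE x in M. \<bar>g x\<bar> \<le> D"
    using assms by (auto simp: Linf_def)
  then have "AE x in M. \<bar>f x * g x\<bar> \<le> C * D"
    by eventually_elim (auto simp: abs_mult intro!: mult_mono)
  then show ?thesis using assms by (auto simp: Linf_def)
qed

lemma Linf_cmult: "f \<in> Linf M \<Longrightarrow> (\<lambda>z. c * f z) \<in> Linf M" for c :: real
  using Linf_mult[OF Linf_const] .

lemma Linf_diff: "f \<in> Linf M \<Longrightarrow> g \<in> Linf M \<Longrightarrow> (\<lambda>z. f z - g z) \<in> Linf M"
  using Linf_add[OF _ Linf_cmult[of g M "-1"], of f] by simp

lemma (in finite_measure) Linf_integrable: "f \<in> Linf M \<Longrightarrow> integrable M f"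
  by (auto simp: Linf_def intro!: integrable_const_bound)

text \<open>Everything is stated on representatives, and each instance of linearity has its own null
  set. \<open>S\<close> is a probability space so that essentially bounded functions on it are
  integrable.\<close>

locale conditional_expectation = G: sigma_finite_measure G + S: prob_space S
  for G :: "'g measure" and S :: "'s measure" +
  fixes P :: "('g \<times> 's \<Rightarrow> real) \<Rightarrow> 's \<Rightarrow> real"
  assumes P_Linf: "f \<in> Linf (G \<Otimes>\<^sub>M S) \<Longrightarrow> P f \<in> Linf S"
    and P_cong: "f \<in> Linf (G \<Otimes>\<^sub>M S) \<Longrightarrow> f' \<in> Linf (G \<Otimes>\<^sub>M S) \<Longrightarrow>
        AE z in G \<Otimes>\<^sub>M S. f z = f' z \<Longrightarrow> AE x in S. P f x = P f' x"
    and P_add: "f \<in> Linf (G \<Otimes>\<^sub>M S) \<Longrightarrow> f' \<in> Linf (G \<Otimes>\<^sub>M S) \<Longrightarrow>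
        AE x in S. P (\<lambda>z. f z + f' z) x = P f x + P f' x"
    and P_module: "\<phi> \<in> Linf S \<Longrightarrow> f \<in> Linf (G \<Otimes>\<^sub>M S) \<Longrightarrow>
        AE x in S. P (\<lambda>(h, y). \<phi> y * f (h, y)) x = \<phi> x * P f x"
    and P_nonneg: "f \<in> Linf (G \<Otimes>\<^sub>M S) \<Longrightarrow> AE z in G \<Otimes>\<^sub>M S. 0 \<le> f z \<Longrightarrow> AE x in S. 0 \<le> P f x"
    and P_one: "AE x in S. P (\<lambda>_. 1) x = 1"

section \<open>Consequences of positivity and of the module property\<close>

context conditional_expectation
begin

sublocale GS: pair_sigma_finite G S ..

lemma Linf_snd: assumes "\<phi> \<in> Linf S" shows "(\<lambda>(h, y). \<phi> y) \<in> Linf (G \<Otimes>\<^sub>M S)"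
proof -
  have m[measurable]: "\<phi> \<in> borel_measurable S" using assms by (auto simp: Linf_def)
  obtain C where C: "AE x in S. \<bar>\<phi> x\<bar> \<le> C" using assms by (auto simp: Linf_def)
  have "AE z in G \<Otimes>\<^sub>M S. \<bar>\<phi> (snd z)\<bar> \<le> C"
    using C by (rule GS.AE_pair_snd)
  then show ?thesis by (auto simp: Linf_def split_beta')
qed

text \<open>The constant 1 is averaged to 1, and a function of the base point alone comes out as a
  factor: \<open>P\<close> is a projection.\<close>

lemma P_snd: assumes "\<phi> \<in> Linf S" shows "AE x in S. P (\<lambda>(h, y). \<phi> y) x = \<phi> x"
  using P_module[OF assms Linf_const[of 1]] P_one by eventually_elim simp

lemma P_cmult: assumes "f \<in> Linf (G \<Otimes>\<^sub>M S)" shows "AE x in S. P (\<lambda>z. c * f z) x = c * P f x"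
  using P_module[OF Linf_const[of c] assms] by (simp add: case_prod_unfold)

lemma P_diff:
  assumes f: "f \<in> Linf (G \<Otimes>\<^sub>M S)" and g: "g \<in> Linf (G \<Otimes>\<^sub>M S)"
  shows "AE x in S. P (\<lambda>z. f z - g z) x = P f x - P g x"
  using P_add[OF f Linf_cmult[OF g, of "-1"]] P_cmult[OF g, of "-1"] by eventually_elim simp

lemma P_mono:
  assumes f: "f \<in> Linf (G \<Otimes>\<^sub>M S)" and g: "g \<in> Linf (G \<Otimes>\<^sub>M S)" and le: "AE z in G \<Otimes>\<^sub>M S. f z \<le> g z"
  shows "AE x in S. P f x \<le> P g x"
proof -
  have "AE x in S. 0 \<le> P (\<lambda>z. g z - f z) x"
    using le by (intro P_nonneg Linf_diff f g) auto
  then show ?thesis using P_diff[OF g f] by eventually_elim simp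
qed

lemma P_le:
  assumes f: "f \<in> Linf (G \<Otimes>\<^sub>M S)" and \<phi>: "\<phi> \<in> Linf S" and le: "AE z in G \<Otimes>\<^sub>M S. f z \<le> \<phi> (snd z)"
  shows "AE x in S. P f x \<le> \<phi> x"
  using P_mono[OF f Linf_snd[OF \<phi>]] le P_snd[OF \<phi>] by (auto simp: split_beta')

text \<open>Both \<open>f\<close> and \<open>-f\<close> lie below the constant \<open>c\<close>,
  which \<open>P\<close> fixes.\<close>

lemma P_abs_le:
  assumes f: "f \<in> Linf (G \<Otimes>\<^sub>M S)" and le: "AE z in G \<Otimes>\<^sub>M S. \<bar>f z\<bar> \<le> c"
  shows "AE x in S. \<bar>P f x\<bar> \<le> c"
proof -
  have 1: "AE x in S. P f x \<le> c"
    by (rule P_le[OF f Linf_const]) (use le in auto)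
  have "AE x in S. P (\<lambda>z. -1 * f z) x \<le> c"
    by (rule P_le[OF Linf_cmult[OF f] Linf_const]) (use le in auto)
  then show ?thesis using 1 P_cmult[OF f, of "-1"] by eventually_elim auto
qed

text \<open>Integrals over parameters can be rewritten only at points of the underlying space. Off
  the space \<open>g\<close> is arbitrary, so its membership in \<open>Linf\<close> is derived from
  that of \<open>f\<close>.\<close>

lemma P_eqI:
  assumes f: "f \<in> Linf (G \<Otimes>\<^sub>M S)" and g: "\<And>z. z \<in> space (G \<Otimes>\<^sub>M S) \<Longrightarrow> f z = g z"
  shows "AE x in S. P f x = P g x"
proof -
  have "AE z in G \<Otimes>\<^sub>M S. f z = g z" by (rule AE_I2) (use g in auto)
  moreover have "g \<in> borel_measurable (G \<Otimes>\<^sub>M S)"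
    using Linf_measurable[OF f] g measurable_cong by blast
  moreover obtain C where "AE z in G \<Otimes>\<^sub>M S. \<bar>f z\<bar> \<le> C" using f by (auto simp: Linf_def)
  then have "AE z in G \<Otimes>\<^sub>M S. \<bar>g z\<bar> \<le> C" using g by (auto elim!: AE_mp)
  ultimately show ?thesis using f by (intro P_cong) (auto simp: Linf_def)
qed

end

text \<open>Multiplying a \<sigma>-finite measure by such a weight gives a finite measure with the
  same null sets; strict positivity allows division by the weight on the way back.\<close>

lemma (in sigma_finite_measure) exists_positive_integrable:
  "\<exists>w :: 'a \<Rightarrow> real. integrable M w \<and> (\<forall>x\<in>space M. 0 < w x) \<and> (\<forall>x. 0 \<le> w x)"
proof -
  obtain w0 where w0: "w0 \<in> borel_measurable M" "integral\<^sup>N M w0 \<noteq> \<infinity>" "\<forall>x\<in>space M. 0 < w0 x \<and> w0 x < \<infinity>"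
    using Ex_finite_integrable_function by auto
  define w where "w h = enn2real (w0 h)" for h
  have w[measurable]: "w \<in> borel_measurable M" using w0 by (simp add: w_def[abs_def])
  have "(\<integral>\<^sup>+h. ennreal (w h) \<partial>M) = integral\<^sup>N M w0"
    using w0 by (intro nn_integral_cong) (simp add: w_def)
  then have "integrable M w" using w0(2) by (intro integrableI_nonneg) (auto simp: w_def less_top)
  moreover have "0 \<le> w h" for h by (simp add: w_def)
  moreover have "0 < w h" if "h \<in> space M" for h using w0(3) that by (auto simp: w_def enn2real_positive_iff)
  ultimately show ?thesis by blast
qed

lemma finite_measure_density_integrable:
  fixes w :: "'a \<Rightarrow> real"
  assumes w: "integrable M w" and nn: "\<And>x. 0 \<le> w x"
  shows "finite_measure (density M w)"
proof (rule finite_measureI)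
  have "emeasure (density M w) (space (density M w)) = (\<integral>\<^sup>+x. ennreal (w x) \<partial>M)"
    using w by (auto simp: emeasure_density intro!: nn_integral_cong)
  also have "\<dots> = ennreal (\<integral>x. w x \<partial>M)" by (rule nn_integral_eq_integral[OF w]) (use nn in auto)
  finally show "emeasure (density M w) (space (density M w)) \<noteq> \<infinity>" by simp
qed

text \<open>The pairing of L^1 with L^\<infinity> and its Hoelder bound, in the form applied to
  single sections of a function.\<close>

lemma integrable_mult_bounded:
  fixes \<phi> g :: "'a \<Rightarrow> real"
  assumes \<phi>: "integrable M \<phi>" and g: "g \<in> borel_measurable M" and c: "\<And>z. z \<in> space M \<Longrightarrow> \<bar>g z\<bar> \<le> c"
  shows "integrable M (\<lambda>z. \<phi> z * g z)"
    and "\<bar>\<integral>z. \<phi> z * g z \<partial>M\<bar> \<le> c * (\<integral>z. \<bar>\<phi> z\<bar> \<partial>M)"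
proof -
  have [measurable]: "\<phi> \<in> borel_measurable M" "g \<in> borel_measurable M" using \<phi> g by auto
  have b: "\<bar>\<phi> z * g z\<bar> \<le> c * \<bar>\<phi> z\<bar>" if "z \<in> space M" for z
    using mult_right_mono[OF c[OF that], of "\<bar>\<phi> z\<bar>"] by (simp add: abs_mult mult.commute)
  show i: "integrable M (\<lambda>z. \<phi> z * g z)"
    by (rule Bochner_Integration.integrable_bound[where f="\<lambda>z. c * \<bar>\<phi> z\<bar>"])
       (use \<phi> b in \<open>auto intro!: AE_I2 order_trans[OF b]\<close>)
  have "\<bar>\<integral>z. \<phi> z * g z \<partial>M\<bar> \<le> (\<integral>z. \<bar>\<phi> z * g z\<bar> \<partial>M)"
    using integral_norm_bound[of M "\<lambda>z. \<phi> z * g z"] by simp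
  also have "\<dots> \<le> (\<integral>z. c * \<bar>\<phi> z\<bar> \<partial>M)"
    by (rule integral_mono) (use i \<phi> b in auto)
  finally show "\<bar>\<integral>z. \<phi> z * g z \<partial>M\<bar> \<le> c * (\<integral>z. \<bar>\<phi> z\<bar> \<partial>M)" by simp
qed

section \<open>Conditional expectations with parameters\<close>

locale parametrized_expectation = conditional_expectation G S P + H: sigma_finite_measure H
  for G :: "'g measure" and S :: "'s measure" and P and H :: "'h measure"
begin

sublocale HS: pair_sigma_finite H S ..
sublocale G_HS: pair_sigma_finite G "H \<Otimes>\<^sub>M S" by unfold_locales
sublocale SH: pair_sigma_finite S H ..

text \<open>The bound is imposed everywhere rather than almost everywhere: every section in the
  parameter is then bounded, and \<open>slice\<close> is a convergent integral at each
  point.\<close>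

definition bounded_fun :: "real \<Rightarrow> ('g \<times> 'h \<times> 's \<Rightarrow> real) \<Rightarrow> bool" where
  "bounded_fun c f \<longleftrightarrow> f \<in> borel_measurable (G \<Otimes>\<^sub>M H \<Otimes>\<^sub>M S) \<and>
     (\<forall>z\<in>space (G \<Otimes>\<^sub>M H \<Otimes>\<^sub>M S). \<bar>f z\<bar> \<le> c)"

text \<open>The pairing in the parameter only. The result is a function on G \<times> S, to which
  \<open>P\<close> applies.\<close>

definition slice :: "('h \<Rightarrow> real) \<Rightarrow> ('g \<times> 'h \<times> 's \<Rightarrow> real) \<Rightarrow> 'g \<times> 's \<Rightarrow> real" where
  "slice \<phi> f = (\<lambda>(a, x). \<integral>h. \<phi> h * f (a, h, x) \<partial>H)"

lemma slice_integrable: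
  assumes f: "bounded_fun c f" and \<phi>: "integrable H \<phi>" and z: "a \<in> space G" "x \<in> space S"
  shows "integrable H (\<lambda>h. \<phi> h * f (a, h, x))"
    and "\<bar>slice \<phi> f (a, x)\<bar> \<le> c * (\<integral>h. \<bar>\<phi> h\<bar> \<partial>H)"
proof -
  have [measurable]: "f \<in> borel_measurable (G \<Otimes>\<^sub>M H \<Otimes>\<^sub>M S)" and b: "\<And>z. z\<in>space (G \<Otimes>\<^sub>M H \<Otimes>\<^sub>M S) \<Longrightarrow> \<bar>f z\<bar> \<le> c"
    using f by (auto simp: bounded_fun_def)
  have 1: "(\<lambda>h. f (a, h, x)) \<in> borel_measurable H" using z by measurable
  have 2: "\<bar>f (a, h, x)\<bar> \<le> c" if "h \<in> space H" for h
    using b[of "(a,h,x)"] that z by (auto simp: space_pair_measure)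
  show "integrable H (\<lambda>h. \<phi> h * f (a, h, x))"
    and "\<bar>slice \<phi> f (a, x)\<bar> \<le> c * (\<integral>h. \<bar>\<phi> h\<bar> \<partial>H)"
    using integrable_mult_bounded[OF \<phi> 1 2] by (auto simp: slice_def)
qed

lemma slice_Linf:
  assumes f: "bounded_fun c f" and \<phi>: "integrable H \<phi>"
  shows "slice \<phi> f \<in> Linf (G \<Otimes>\<^sub>M S)"
proof (rule LinfI)
  have [measurable]: "f \<in> borel_measurable (G \<Otimes>\<^sub>M H \<Otimes>\<^sub>M S)" "\<phi> \<in> borel_measurable H"
    using f \<phi> by (auto simp: bounded_fun_def)
  show "slice \<phi> f \<in> borel_measurable (G \<Otimes>\<^sub>M S)"
    unfolding slice_def case_prod_beta by (rule H.borel_measurable_lebesgue_integral) measurable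
  show "z \<in> space (G \<Otimes>\<^sub>M S) \<Longrightarrow> \<bar>slice \<phi> f z\<bar> \<le> c * (\<integral>h. \<bar>\<phi> h\<bar> \<partial>H)" for z
    using slice_integrable(2)[OF f \<phi>] by (auto simp: space_pair_measure)
qed

text \<open>The weak-star form of applying \<open>P\<close> with the parameter held fixed. The null
  set of x may depend on \<phi>, since \<open>P\<close> chooses a representative for each slice
  separately.\<close>

definition extends :: "('g \<times> 'h \<times> 's \<Rightarrow> real) \<Rightarrow> ('h \<times> 's \<Rightarrow> real) \<Rightarrow> bool" where
  "extends f F \<longleftrightarrow> (\<forall>\<phi>. integrable H \<phi> \<longrightarrow>
     (AE x in S. P (slice \<phi> f) x = (\<integral>h. \<phi> h * F (h, x) \<partial>H)))"

text \<open>Nonnegativity of \<open>f\<close> and finiteness of \<open>H\<close> make the set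
  function below a finite measure. Only indicator weights are tested here; general weights follow by
  density in L^1, see \<open>extendsI_indicator\<close>.\<close>

lemma exists_extension_finite:
  assumes fin: "finite_measure H"
    and c0: "0 \<le> c" and m[measurable]: "f \<in> borel_measurable (G \<Otimes>\<^sub>M H \<Otimes>\<^sub>M S)"
    and nn: "\<And>z. z\<in>space (G \<Otimes>\<^sub>M H \<Otimes>\<^sub>M S) \<Longrightarrow> 0 \<le> f z" and b: "\<And>z. z\<in>space (G \<Otimes>\<^sub>M H \<Otimes>\<^sub>M S) \<Longrightarrow> f z \<le> c"
  obtains F where "F \<in> borel_measurable (H \<Otimes>\<^sub>M S)" "\<And>z. 0 \<le> F z" "\<And>z. F z \<le> c"
    "\<And>A. A \<in> sets H \<Longrightarrow> AE x in S. P (slice (indicator A) f) x = (\<integral>h. indicator A h * F (h, x) \<partial>H)"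
proof -
  interpret H: finite_measure H by fact
  interpret HS: finite_measure "H \<Otimes>\<^sub>M S"
    using finite_measure_pair_measure[OF S.finite_measure_axioms H.finite_measure_axioms] .
  \<comment> \<open>\<open>g B\<close> cuts \<open>f\<close> down to the parameters and base points
    in \<open>B\<close>, and \<open>p B\<close> integrates out the parameter.\<close>
  define g where "g B = (\<lambda>(a,h,x). indicator B (h, x) * f (a,h,x))" for B
  have gb: "bounded_fun c (g B)" if B[measurable]: "B \<in> sets (H \<Otimes>\<^sub>M S)" for B
    unfolding bounded_fun_def g_def
    using nn b order_trans[OF nn b] by (auto simp: indicator_def)
  have one: "integrable H (\<lambda>_. 1::real)" by simp
  define p where "p B = slice (\<lambda>_. 1) (g B)" for B
  have pL: "p B \<in> Linf (G \<Otimes>\<^sub>M S)" if "B \<in> sets (H \<Otimes>\<^sub>M S)" for B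
    unfolding p_def by (rule slice_Linf[OF gb[OF that] one])
  have pnn: "0 \<le> p B z" if "B \<in> sets (H \<Otimes>\<^sub>M S)" "z \<in> space (G \<Otimes>\<^sub>M S)" for B z
    unfolding p_def slice_def using that(2)
    by (auto simp: g_def space_pair_measure indicator_def intro!: Bochner_Integration.integral_nonneg_AE AE_I2 nn)
  have Pnn: "AE x in S. 0 \<le> P (p B) x" if "B \<in> sets (H \<Otimes>\<^sub>M S)" for B
    by (rule P_nonneg[OF pL[OF that]]) (use pnn[OF that] in auto)
  have Pint: "integrable S (P (p B))" if "B \<in> sets (H \<Otimes>\<^sub>M S)" for B
    by (rule S.Linf_integrable[OF P_Linf[OF pL[OF that]]])
  define N where "N B = ennreal (\<integral>x. P (p B) x \<partial>S)" for B
  have Nreal: "0 \<le> (\<integral>x. P (p B) x \<partial>S)" if "B \<in> sets (H \<Otimes>\<^sub>M S)" for B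
    by (rule integral_nonneg_AE[OF Pnn[OF that]])
  \<comment> \<open>Since f \<le> c, the slice \<open>p B\<close> is at most c times the measure of
    the section of \<open>B\<close> over x. This bound is free of the group variable, so
    \<open>P\<close> fixes it.\<close>
  have Ndom: "(\<integral>x. P (p B) x \<partial>S) \<le> c * measure (H \<Otimes>\<^sub>M S) B" if B[measurable]: "B \<in> sets (H \<Otimes>\<^sub>M S)" for B
  proof -
    have iB: "integrable (H \<Otimes>\<^sub>M S) (\<lambda>z. indicator B z :: real)"
      by (rule integrable_real_indicator[OF B]) (simp add: HS.emeasure_eq_measure)
    define \<psi> where "\<psi> x = c * (\<integral>h. indicator B (h, x) \<partial>H)" for x
    have \<psi>: "\<psi> \<in> Linf S"
    proof (rule LinfI)
      show "\<psi> \<in> borel_measurable S" unfolding \<psi>_def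
        by (intro borel_measurable_times borel_measurable_const H.borel_measurable_lebesgue_integral) measurable
      fix x assume x: "x \<in> space S"
      have "(\<lambda>h. indicator B (h, x) :: real) \<in> borel_measurable H" using x by measurable
      from integrable_mult_bounded(2)[OF one this, of 1]
      have "\<bar>\<integral>h. indicator B (h, x) \<partial>H\<bar> \<le> (\<integral>h. 1 \<partial>H :: real)" by simp
      then show "\<bar>\<psi> x\<bar> \<le> \<bar>c\<bar> * (\<integral>h. 1 \<partial>H)"
        by (auto simp: \<psi>_def abs_mult intro!: mult_left_mono)
    qed
    have "AE x in S. P (p B) x \<le> \<psi> x"
    proof (rule P_le[OF pL[OF B] \<psi>], rule AE_I2)
      fix z assume "z \<in> space (G \<Otimes>\<^sub>M S)"
      then obtain a x where z: "z = (a, x)" "a \<in> space G" "x \<in> space S" by (auto simp: space_pair_measure)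
      have "p B z = (\<integral>h. g B (a, h, x) \<partial>H)" by (simp add: p_def slice_def z)
      also have "\<dots> \<le> (\<integral>h. c * indicator B (h, x) \<partial>H)"
      proof (rule integral_mono)
        show "integrable H (\<lambda>h. g B (a, h, x))" using slice_integrable(1)[OF gb[OF B] one z(2,3)] by simp
        show "integrable H (\<lambda>h. c * indicator B (h, x))"
          using integrable_mult_bounded(1)[OF one, of "\<lambda>h. c * indicator B (h, x)" "\<bar>c\<bar>"] z by (auto simp: indicator_def)
        show "h \<in> space H \<Longrightarrow> g B (a, h, x) \<le> c * indicator B (h, x)" for h
          using b[of "(a,h,x)"] z by (auto simp: g_def indicator_def space_pair_measure)
      qed
      finally show "p B z \<le> \<psi> (snd z)" by (simp add: \<psi>_def z)
    qed
    then have "(\<integral>x. P (p B) x \<partial>S) \<le> (\<integral>x. \<psi> x \<partial>S)"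
      by (intro integral_mono_AE Pint B S.Linf_integrable \<psi>)
    also have "\<dots> = c * (\<integral>z. indicator B z \<partial>(H \<Otimes>\<^sub>M S))"
      unfolding \<psi>_def using HS.integral_snd[of "\<lambda>h x. indicator B (h, x) :: real"] iB by simp
    finally show ?thesis by (simp add: Int_absorb2 sets.sets_into_space[OF B])
  qed
  have padd: "AE x in S. P (p (A \<union> B)) x = P (p A) x + P (p B) x"
    if A: "A \<in> sets (H \<Otimes>\<^sub>M S)" and B: "B \<in> sets (H \<Otimes>\<^sub>M S)" and d: "A \<inter> B = {}" for A B
  proof -
    have "p (A \<union> B) z = p A z + p B z" if z: "z \<in> space (G \<Otimes>\<^sub>M S)" for z
    proof -
      obtain a x where z: "z = (a, x)" "a \<in> space G" "x \<in> space S" using z by (auto simp: space_pair_measure)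
      have *: "g (A \<union> B) y = g A y + g B y" for y using d by (auto simp: g_def indicator_def split: prod.splits)
      show ?thesis unfolding p_def slice_def z(1) using slice_integrable(1)[OF gb[OF A] one z(2,3)] slice_integrable(1)[OF gb[OF B] one z(2,3)]
        by (simp add: *)
    qed
    from P_eqI[OF pL this] P_add[OF pL[OF A] pL[OF B]] A B show ?thesis by (auto elim!: AE_mp)
  qed
  have p0: "AE x in S. P (p {}) x = 0"
    using P_cmult[OF Linf_const, of 0 0] by (simp add: p_def slice_def g_def case_prod_unfold)
  define M where "M = measure_of (space (H \<Otimes>\<^sub>M S)) (sets (H \<Otimes>\<^sub>M S)) N"
  have [simp]: "sets M = sets (H \<Otimes>\<^sub>M S)" "space M = space (H \<Otimes>\<^sub>M S)" by (simp_all add: M_def)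
  have pos: "positive (sets (H \<Otimes>\<^sub>M S)) N"
    using integral_cong_AE[OF _ _ p0] Pint[of "{}"] by (auto simp: positive_def N_def)
  have add: "additive (sets (H \<Otimes>\<^sub>M S)) N"
    unfolding additive_def
  proof (intro ballI impI)
    fix A B assume AB: "A \<in> sets (H \<Otimes>\<^sub>M S)" "B \<in> sets (H \<Otimes>\<^sub>M S)" "A \<inter> B = {}"
    have "(\<integral>x. P (p (A \<union> B)) x \<partial>S) = (\<integral>x. P (p A) x + P (p B) x \<partial>S)"
      using AB Pint by (intro integral_cong_AE padd) auto
    then show "N (A \<union> B) = N A + N B"
      using AB Pint Nreal by (simp add: N_def ennreal_plus)
  qed
  \<comment> \<open>\<open>P\<close> is only finitely additive; countable additivity comes from the domination \<open>Ndom\<close>.\<close>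
  have "countably_additive (sets (H \<Otimes>\<^sub>M S)) N"
  proof (rule sets.empty_continuous_imp_countably_additive[OF pos add])
    show "\<forall>A\<in>sets (H \<Otimes>\<^sub>M S). N A \<noteq> \<infinity>" by (simp add: N_def)
    fix A :: "nat \<Rightarrow> _" assume A: "range A \<subseteq> sets (H \<Otimes>\<^sub>M S)" "decseq A" "(\<Inter>i. A i) = {}"
    have "(\<lambda>i. measure (H \<Otimes>\<^sub>M S) (A i)) \<longlonglongrightarrow> measure (H \<Otimes>\<^sub>M S) (\<Inter>i. A i)"
      by (rule HS.finite_Lim_measure_decseq) (use A in auto)
    then have 1: "(\<lambda>i. c * measure (H \<Otimes>\<^sub>M S) (A i)) \<longlonglongrightarrow> 0" using A by (auto intro: tendsto_eq_intros)
    have "(\<lambda>i. \<integral>x. P (p (A i)) x \<partial>S) \<longlonglongrightarrow> 0"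
      by (rule tendsto_sandwich[OF _ _ tendsto_const 1]) (use A Nreal Ndom in auto)
    then show "(\<lambda>i. N (A i)) \<longlonglongrightarrow> 0" unfolding N_def using tendsto_ennrealI by fastforce
  qed
  then have em: "emeasure M B = N B" if "B \<in> sets (H \<Otimes>\<^sub>M S)" for B
    unfolding M_def by (intro emeasure_measure_of_sigma sets.sigma_algebra_axioms pos that)
  have "absolutely_continuous (H \<Otimes>\<^sub>M S) M"
    unfolding absolutely_continuous_def
  proof
    fix B assume B: "B \<in> null_sets (H \<Otimes>\<^sub>M S)"
    then have "measure (H \<Otimes>\<^sub>M S) B = 0" by (auto simp: measure_def)
    with Ndom[of B] B have "N B = 0" by (auto simp: N_def ennreal_neg)
    then show "B \<in> null_sets M" using B em[of B] by (auto simp: null_sets_def)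
  qed
  then obtain R where R[measurable]: "R \<in> borel_measurable (H \<Otimes>\<^sub>M S)" and RM: "density (H \<Otimes>\<^sub>M S) R = M"
    using HS.Radon_Nikodym[of M] by auto
  have NR: "N B = (\<integral>\<^sup>+z. R z * indicator B z \<partial>(H \<Otimes>\<^sub>M S))" if "B \<in> sets (H \<Otimes>\<^sub>M S)" for B
    using em[OF that] that RM[symmetric] by (simp add: emeasure_density)
  \<comment> \<open>On the set where the derivative exceeds c, domination leaves no room for a
    positive excess.\<close>
  have Rle: "AE z in H \<Otimes>\<^sub>M S. R z \<le> ennreal c"
  proof -
    define B where "B = {z \<in> space (H \<Otimes>\<^sub>M S). ennreal c < R z}"
    have B[measurable]: "B \<in> sets (H \<Otimes>\<^sub>M S)" by (simp add: B_def)
    have 1: "(\<integral>\<^sup>+z. R z * indicator B z \<partial>(H \<Otimes>\<^sub>M S)) \<le> (\<integral>\<^sup>+z. ennreal c * indicator B z \<partial>(H \<Otimes>\<^sub>M S))"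
    proof -
      have "(\<integral>\<^sup>+z. R z * indicator B z \<partial>(H \<Otimes>\<^sub>M S)) \<le> ennreal (c * measure (H \<Otimes>\<^sub>M S) B)"
        using Ndom[OF B] by (simp add: NR[OF B, symmetric] N_def ennreal_leI)
      also have "\<dots> = ennreal c * emeasure (H \<Otimes>\<^sub>M S) B" using c0 by (simp add: ennreal_mult HS.emeasure_eq_measure)
      finally show ?thesis by (simp add: nn_integral_cmult_indicator)
    qed
    have fin: "(\<integral>\<^sup>+z. ennreal c * indicator B z \<partial>(H \<Otimes>\<^sub>M S)) \<noteq> \<infinity>"
      by (simp add: nn_integral_cmult_indicator HS.emeasure_eq_measure ennreal_mult_eq_top_iff)
    have "(\<integral>\<^sup>+z. R z * indicator B z - ennreal c * indicator B z \<partial>(H \<Otimes>\<^sub>M S)) =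
        (\<integral>\<^sup>+z. R z * indicator B z \<partial>(H \<Otimes>\<^sub>M S)) - (\<integral>\<^sup>+z. ennreal c * indicator B z \<partial>(H \<Otimes>\<^sub>M S))"
      by (rule nn_integral_diff) (use fin in \<open>auto simp: B_def indicator_def\<close>)
    also have "\<dots> = 0" using 1 le_less_trans[OF 1] fin by (simp add: diff_eq_0_iff_ennreal less_top)
    finally have "AE z in H \<Otimes>\<^sub>M S. R z * indicator B z - ennreal c * indicator B z = 0"
      by (subst (asm) nn_integral_0_iff_AE) auto
    then have "AE z in H \<Otimes>\<^sub>M S. z \<in> space (H \<Otimes>\<^sub>M S) \<longrightarrow> R z \<le> ennreal c"
    proof eventually_elim
      case (elim z)
      then show ?case
        by (cases "ennreal c < R z") (auto simp: B_def indicator_def diff_eq_0_iff_ennreal)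
    qed
    then show ?thesis by auto
  qed
  \<comment> \<open>Truncation at c makes the bounds hold everywhere; by \<open>Rle\<close> it
    alters \<open>R\<close> only on a null set.\<close>
  define F where "F z = min c (enn2real (R z))" for z
  have F[measurable]: "F \<in> borel_measurable (H \<Otimes>\<^sub>M S)" by (simp add: F_def[abs_def])
  have F0: "0 \<le> F z" "F z \<le> c" for z using c0 by (auto simp: F_def)
  have FR: "AE z in H \<Otimes>\<^sub>M S. R z = ennreal (F z)"
    using Rle
  proof eventually_elim
    case (elim z)
    then have "enn2real (R z) \<le> c" by (rule enn2real_leI[OF c0])
    moreover have "R z \<noteq> \<top>" using elim by (auto simp: top_unique)
    ultimately show ?case by (simp add: F_def min_absorb2 less_top)
  qed
  have Fint: "integrable (H \<Otimes>\<^sub>M S) (\<lambda>z. indicator B z * F z)" if [measurable]: "B \<in> sets (H \<Otimes>\<^sub>M S)" for B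
    by (rule HS.integrable_const_bound[where B=c]) (use F0 c0 in \<open>auto simp: indicator_def\<close>)
  have NF: "(\<integral>x. P (p B) x \<partial>S) = (\<integral>z. indicator B z * F z \<partial>(H \<Otimes>\<^sub>M S))" if B[measurable]: "B \<in> sets (H \<Otimes>\<^sub>M S)" for B
  proof -
    have "ennreal (\<integral>x. P (p B) x \<partial>S) = (\<integral>\<^sup>+z. R z * indicator B z \<partial>(H \<Otimes>\<^sub>M S))"
      using NR[OF B] by (simp add: N_def)
    also have "\<dots> = (\<integral>\<^sup>+z. ennreal (indicator B z * F z) \<partial>(H \<Otimes>\<^sub>M S))"
      by (rule nn_integral_cong_AE) (use FR in \<open>eventually_elim, auto simp: indicator_def\<close>)
    also have "\<dots> = ennreal (\<integral>z. indicator B z * F z \<partial>(H \<Otimes>\<^sub>M S))"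
      by (rule nn_integral_eq_integral[OF Fint[OF B]]) (use F0 in auto)
    finally show ?thesis using Nreal[OF B] F0 by (simp add: ennreal_inj integral_nonneg)
  qed
  show ?thesis
  proof (rule that[OF F F0])
    fix A assume A[measurable]: "A \<in> sets H"
    have iA: "integrable H (indicator A :: _ \<Rightarrow> real)"
      by (rule integrable_real_indicator[OF A]) (simp add: H.emeasure_eq_measure)
    have fb: "bounded_fun c f" using nn b order_trans[OF nn b] by (auto simp: bounded_fun_def)
    note sL = slice_Linf[OF fb iA]
    have i1: "integrable S (P (slice (indicator A) f))" by (rule S.Linf_integrable[OF P_Linf[OF sL]])
    have i2: "integrable S (\<lambda>x. \<integral>h. indicator A h * F (h, x) \<partial>H)"
    proof -
      have e: "(\<lambda>z. indicator (A \<times> space S) z * F z) = (\<lambda>(h,x). indicator (A \<times> space S) (h,x) * F (h,x))" by auto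
      have "integrable S (\<lambda>x. \<integral>h. indicator (A \<times> space S) (h,x) * F (h, x) \<partial>H)"
        using HS.integrable_snd[of "\<lambda>h x. indicator (A \<times> space S) (h,x) * F (h,x)"] Fint[of "A \<times> space S"]
        unfolding e by simp
      then show ?thesis
        by (rule Bochner_Integration.integrable_cong[THEN iffD1, OF refl, rotated])
           (auto simp: indicator_def intro!: Bochner_Integration.integral_cong)
    qed
    show "AE x in S. P (slice (indicator A) f) x = (\<integral>h. indicator A h * F (h, x) \<partial>H)"
    proof (rule AE_eq_if_integral_indicator_eq[OF i1 i2])
      fix C assume C[measurable]: "C \<in> sets S"
      have AC[measurable]: "A \<times> C \<in> sets (H \<Otimes>\<^sub>M S)" by simp
      \<comment> \<open>The indicator of \<open>C\<close> depends on the base point only, so the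
        module property moves it out of \<open>P\<close>. Testing the averaged slice on
        \<open>C\<close> thus becomes the value of the measure on the rectangle.\<close>
      have "AE x in S. P (p (A \<times> C)) x = indicator C x * P (slice (indicator A) f) x"
      proof -
        have CL: "(indicator C :: _ \<Rightarrow> real) \<in> Linf S" by (rule LinfI[of _ _ 1]) (auto simp: indicator_def)
        have "p (A \<times> C) z = (\<lambda>(h, y). indicator C y * slice (indicator A) f (h, y)) z" for z
          by (auto simp: p_def slice_def g_def indicator_def split: prod.split)
        then have "p (A \<times> C) = (\<lambda>(h, y). indicator C y * slice (indicator A) f (h, y))" by auto
        then show ?thesis using P_module[OF CL sL] by simp
      qed
      then have "(\<integral>x. indicator C x * P (slice (indicator A) f) x \<partial>S) = (\<integral>x. P (p (A \<times> C)) x \<partial>S)"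
        using i1 Pint[OF AC] by (intro integral_cong_AE) (auto elim!: AE_mp)
      also have "\<dots> = (\<integral>(h,x). indicator (A \<times> C) (h,x) * F (h,x) \<partial>(H \<Otimes>\<^sub>M S))"
        using NF[OF AC] by (simp add: case_prod_unfold)
      also have "\<dots> = (\<integral>x. (\<integral>h. indicator (A \<times> C) (h,x) * F (h,x) \<partial>H) \<partial>S)"
        using Fint[OF AC] by (intro HS.integral_snd[symmetric]) (simp add: case_prod_unfold)
      also have "\<dots> = (\<integral>x. indicator C x * (\<integral>h. indicator A h * F (h,x) \<partial>H) \<partial>S)"
        by (intro Bochner_Integration.integral_cong) (auto simp: indicator_def)
      finally show "(\<integral>x. indicator C x * P (slice (indicator A) f) x \<partial>S) =
         (\<integral>x. indicator C x * (\<integral>h. indicator A h * F (h,x) \<partial>H) \<partial>S)" .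
    qed
  qed
qed

section \<open>Linearity and stability of the extension\<close>

definition bounded_par :: "real \<Rightarrow> ('h \<times> 's \<Rightarrow> real) \<Rightarrow> bool" where
  "bounded_par c F \<longleftrightarrow> F \<in> borel_measurable (H \<Otimes>\<^sub>M S) \<and> (\<forall>z\<in>space (H \<Otimes>\<^sub>M S). \<bar>F z\<bar> \<le> c)"

lemma bounded_par_integrable:
  assumes F: "bounded_par c F" and \<phi>: "integrable H \<phi>" and x: "x \<in> space S"
  shows "integrable H (\<lambda>h. \<phi> h * F (h, x))"
    and "\<bar>\<integral>h. \<phi> h * F (h, x) \<partial>H\<bar> \<le> c * (\<integral>h. \<bar>\<phi> h\<bar> \<partial>H)"
proof -
  have [measurable]: "F \<in> borel_measurable (H \<Otimes>\<^sub>M S)" and b: "\<And>z. z\<in>space (H \<Otimes>\<^sub>M S) \<Longrightarrow> \<bar>F z\<bar> \<le> c"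
    using F by (auto simp: bounded_par_def)
  have 1: "(\<lambda>h. F (h, x)) \<in> borel_measurable H" using x by measurable
  have 2: "\<bar>F (h, x)\<bar> \<le> c" if "h \<in> space H" for h
    using b[of "(h,x)"] that x by (auto simp: space_pair_measure)
  show "integrable H (\<lambda>h. \<phi> h * F (h, x))"
    and "\<bar>\<integral>h. \<phi> h * F (h, x) \<partial>H\<bar> \<le> c * (\<integral>h. \<bar>\<phi> h\<bar> \<partial>H)"
    using integrable_mult_bounded[OF \<phi> 1 2] by auto
qed

lemma bounded_par_Linf:
  assumes F: "bounded_par c F" and \<phi>: "integrable H \<phi>"
  shows "(\<lambda>x. \<integral>h. \<phi> h * F (h, x) \<partial>H) \<in> Linf S"
proof (rule LinfI)
  have [measurable]: "F \<in> borel_measurable (H \<Otimes>\<^sub>M S)" "\<phi> \<in> borel_measurable H"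
    using F \<phi> by (auto simp: bounded_par_def)
  show "(\<lambda>x. \<integral>h. \<phi> h * F (h, x) \<partial>H) \<in> borel_measurable S"
    by (rule H.borel_measurable_lebesgue_integral) measurable
qed (rule bounded_par_integrable(2)[OF assms])

lemma bounded_par_fun: "bounded_par c F \<Longrightarrow> bounded_fun c (\<lambda>(a, z). F z)"
  by (auto simp: bounded_par_def bounded_fun_def space_pair_measure)

lemma bounded_par_lincomb:
  assumes "bounded_par c f" "bounded_par d g"
  shows "bounded_par (\<bar>r\<bar> * c + \<bar>s\<bar> * d) (\<lambda>z. r * f z + s * g z)"
  using assms unfolding bounded_par_def
  by (auto intro!: order_trans[OF abs_triangle_ineq] add_mono mult_left_mono simp: abs_mult)

lemma bounded_fun_lincomb:
  assumes "bounded_fun c f" "bounded_fun d g"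
  shows "bounded_fun (\<bar>r\<bar> * c + \<bar>s\<bar> * d) (\<lambda>z. r * f z + s * g z)"
  using assms unfolding bounded_fun_def
  by (auto intro!: order_trans[OF abs_triangle_ineq] add_mono mult_left_mono simp: abs_mult)

lemma extends_lincomb:
  assumes f: "bounded_fun c f" and g: "bounded_fun d g" and F: "bounded_par c' F" and K: "bounded_par d' K"
    and fF: "extends f F" and gK: "extends g K"
  shows "extends (\<lambda>z. r * f z + s * g z) (\<lambda>z. r * F z + s * K z)"
  unfolding extends_def
proof (intro allI impI)
  fix \<phi> :: "'h \<Rightarrow> real" assume \<phi>: "integrable H \<phi>"
  have 1: "slice \<phi> (\<lambda>z. r * f z + s * g z) z = r * slice \<phi> f z + s * slice \<phi> g z"
    if z: "z \<in> space (G \<Otimes>\<^sub>M S)" for z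
  proof -
    obtain a x where z: "z = (a, x)" "a \<in> space G" "x \<in> space S" using z by (auto simp: space_pair_measure)
    have "slice \<phi> (\<lambda>z. r * f z + s * g z) z = (\<integral>h. r * (\<phi> h * f (a,h,x)) + s * (\<phi> h * g (a,h,x)) \<partial>H)"
      by (simp add: slice_def z algebra_simps)
    then show ?thesis using slice_integrable(1)[OF f \<phi> z(2,3)] slice_integrable(1)[OF g \<phi> z(2,3)]
      by (simp add: slice_def z)
  qed
  have 2: "(\<integral>h. \<phi> h * (r * F (h, x) + s * K (h, x)) \<partial>H) = r * (\<integral>h. \<phi> h * F (h, x) \<partial>H) + s * (\<integral>h. \<phi> h * K (h, x) \<partial>H)"
    if x: "x \<in> space S" for x
  proof -
    have "(\<integral>h. \<phi> h * (r * F (h, x) + s * K (h, x)) \<partial>H) = (\<integral>h. r * (\<phi> h * F (h, x)) + s * (\<phi> h * K (h, x)) \<partial>H)"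
      by (simp add: algebra_simps)
    then show ?thesis using bounded_par_integrable(1)[OF F \<phi> x] bounded_par_integrable(1)[OF K \<phi> x] by simp
  qed
  note L = slice_Linf[OF f \<phi>] slice_Linf[OF g \<phi>]
  have "AE x in S. P (slice \<phi> (\<lambda>z. r * f z + s * g z)) x = P (\<lambda>z. r * slice \<phi> f z + s * slice \<phi> g z) x"
    by (rule P_eqI[OF slice_Linf[OF bounded_fun_lincomb[OF f g] \<phi>] 1])
  moreover note P_add[OF Linf_cmult[OF L(1)] Linf_cmult[OF L(2)], of r s] P_cmult[OF L(1), of r] P_cmult[OF L(2), of s]
  moreover note fF[unfolded extends_def, rule_format, OF \<phi>] gK[unfolded extends_def, rule_format, OF \<phi>]
  moreover note AE_space[of S]
  ultimately show "AE x in S. P (slice \<phi> (\<lambda>z. r * f z + s * g z)) x = (\<integral>h. \<phi> h * (r * F (h, x) + s * K (h, x)) \<partial>H)"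
    by eventually_elim (simp add: 2)
qed

text \<open>A function without the averaged variable is its own extension, because each of its
  slices is a function of the base point alone.\<close>

lemma extends_snd:
  assumes F: "bounded_par c F" shows "extends (\<lambda>(a, z). F z) F"
  unfolding extends_def
proof (intro allI impI)
  fix \<phi> :: "'h \<Rightarrow> real" assume \<phi>: "integrable H \<phi>"
  show "AE x in S. P (slice \<phi> (\<lambda>(a, z). F z)) x = (\<integral>h. \<phi> h * F (h, x) \<partial>H)"
    using P_snd[OF bounded_par_Linf[OF F \<phi>]] by (simp add: slice_def)
qed

text \<open>Positivity turns a uniform bound on \<open>f - g\<close> into a bound on the averages.
  This allows a vector of the predual to be replaced by nearby vectors of a dense set.\<close>

lemma P_slice_diff_fun:
  assumes f: "bounded_fun c f" and g: "bounded_fun d g" and \<phi>: "integrable H \<phi>"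
    and le: "\<And>z. z \<in> space (G \<Otimes>\<^sub>M H \<Otimes>\<^sub>M S) \<Longrightarrow> \<bar>f z - g z\<bar> \<le> e"
  shows "AE x in S. \<bar>P (slice \<phi> f) x - P (slice \<phi> g) x\<bar> \<le> e * (\<integral>h. \<bar>\<phi> h\<bar> \<partial>H)"
proof -
  have fg: "bounded_fun e (\<lambda>z. f z - g z)" using f g le by (auto simp: bounded_fun_def)
  have "AE z in G \<Otimes>\<^sub>M S. \<bar>slice \<phi> f z - slice \<phi> g z\<bar> \<le> e * (\<integral>h. \<bar>\<phi> h\<bar> \<partial>H)"
  proof (rule AE_I2)
    fix z assume "z \<in> space (G \<Otimes>\<^sub>M S)"
    then obtain a x where z: "z = (a, x)" "a \<in> space G" "x \<in> space S" by (auto simp: space_pair_measure)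
    show "\<bar>slice \<phi> f z - slice \<phi> g z\<bar> \<le> e * (\<integral>h. \<bar>\<phi> h\<bar> \<partial>H)"
      using slice_integrable(2)[OF fg \<phi> z(2,3)] slice_integrable(1)[OF f \<phi> z(2,3)] slice_integrable(1)[OF g \<phi> z(2,3)]
      by (simp add: slice_def z right_diff_distrib)
  qed
  from P_abs_le[OF Linf_diff[OF slice_Linf[OF f \<phi>] slice_Linf[OF g \<phi>]] this]
    P_diff[OF slice_Linf[OF f \<phi>] slice_Linf[OF g \<phi>]]
  show ?thesis by eventually_elim simp
qed

text \<open>L^1 continuity in the weight, the estimate behind the passage from simple weights to
  integrable ones.\<close>

lemma P_slice_diff_weight:
  assumes f: "bounded_fun c f" and \<phi>: "integrable H \<phi>" and \<psi>: "integrable H \<psi>"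
  shows "AE x in S. \<bar>P (slice \<phi> f) x - P (slice \<psi> f) x\<bar> \<le> c * (\<integral>h. \<bar>\<phi> h - \<psi> h\<bar> \<partial>H)"
proof -
  have "AE z in G \<Otimes>\<^sub>M S. \<bar>slice \<phi> f z - slice \<psi> f z\<bar> \<le> c * (\<integral>h. \<bar>\<phi> h - \<psi> h\<bar> \<partial>H)"
  proof (rule AE_I2)
    fix z assume "z \<in> space (G \<Otimes>\<^sub>M S)"
    then obtain a x where z: "z = (a, x)" "a \<in> space G" "x \<in> space S" by (auto simp: space_pair_measure)
    show "\<bar>slice \<phi> f z - slice \<psi> f z\<bar> \<le> c * (\<integral>h. \<bar>\<phi> h - \<psi> h\<bar> \<partial>H)"
      using slice_integrable(2)[OF f Bochner_Integration.integrable_diff[OF \<phi> \<psi>] z(2,3)] slice_integrable(1)[OF f \<phi> z(2,3)] slice_integrable(1)[OF f \<psi> z(2,3)]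
      by (simp add: slice_def z left_diff_distrib)
  qed
  from P_abs_le[OF Linf_diff[OF slice_Linf[OF f \<phi>] slice_Linf[OF f \<psi>]] this]
    P_diff[OF slice_Linf[OF f \<phi>] slice_Linf[OF f \<psi>]]
  show ?thesis by eventually_elim simp
qed

text \<open>Both sides are linear and L^1 continuous in the weight, and combinations of indicators
  of sets of finite measure are dense in L^1.\<close>

lemma extendsI_indicator:
  assumes f: "bounded_fun c f" and F: "bounded_par d F"
    and ind: "\<And>A. A \<in> sets H \<Longrightarrow> emeasure H A < \<infinity> \<Longrightarrow>
        AE x in S. P (slice (indicator A) f) x = (\<integral>h. indicator A h * F (h, x) \<partial>H)"
  shows "extends f F"
  unfolding extends_def
proof (intro allI impI)
  fix \<phi> :: "'h \<Rightarrow> real" assume "integrable H \<phi>"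
  then show "AE x in S. P (slice \<phi> f) x = (\<integral>h. \<phi> h * F (h, x) \<partial>H)"
  proof (induction rule: integrable_induct)
    case (base A k)
    have iA: "integrable H (indicator A :: _ \<Rightarrow> real)" using base by simp
    have "slice (\<lambda>h. indicator A h *\<^sub>R k) f = (\<lambda>z. k * slice (indicator A) f z)"
      by (auto simp: slice_def fun_eq_iff mult_ac simp flip: integral_mult_right_zero)
    moreover have "(\<integral>h. indicator A h *\<^sub>R k * F (h, x) \<partial>H) = k * (\<integral>h. indicator A h * F (h, x) \<partial>H)" for x
      by (simp add: mult_ac flip: integral_mult_right_zero)
    ultimately show ?case using ind[OF base] P_cmult[OF slice_Linf[OF f iA], of k] by (auto elim!: AE_mp)
  next
    case (add \<phi> \<psi>)
    have 1: "slice (\<lambda>h. \<phi> h + \<psi> h) f z = slice \<phi> f z + slice \<psi> f z" if z: "z \<in> space (G \<Otimes>\<^sub>M S)" for z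
      using z slice_integrable(1)[OF f add(1)] slice_integrable(1)[OF f add(2)]
      by (auto simp: slice_def space_pair_measure distrib_right)
    have 2: "(\<integral>h. (\<phi> h + \<psi> h) * F (h, x) \<partial>H) = (\<integral>h. \<phi> h * F (h, x) \<partial>H) + (\<integral>h. \<psi> h * F (h, x) \<partial>H)" if "x \<in> space S" for x
      using bounded_par_integrable(1)[OF F add(1) that] bounded_par_integrable(1)[OF F add(2) that]
      by (simp add: distrib_right)
    have "AE x in S. P (slice (\<lambda>h. \<phi> h + \<psi> h) f) x = P (\<lambda>z. slice \<phi> f z + slice \<psi> f z) x"
      by (rule P_eqI[OF slice_Linf[OF f Bochner_Integration.integrable_add[OF add(1,2)]] 1])
    then show ?case using P_add[OF slice_Linf[OF f add(1)] slice_Linf[OF f add(2)]] add(3,4) AE_space[of S]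
      by eventually_elim (simp add: 2)
  next
    case (lim \<phi> s)
    note LIMi = lim.hyps(1) and LIMc = lim.hyps(2) and LIMn = lim.hyps(3) and LIMf = lim.hyps(4) and LIMp = lim.IH
    define e where "e i = (\<integral>h. \<bar>\<phi> h - s i h\<bar> \<partial>H)" for i
    \<comment> \<open>The approximants of \<open>integrable_induct\<close> satisfy |s i| \<le> 2
      |\<phi>|, hence the dominating function 3 |\<phi>|.\<close>
    have "e \<longlonglongrightarrow> (\<integral>h. 0 \<partial>H)" unfolding e_def
    proof (rule integral_dominated_convergence[where w="\<lambda>h. 3 * \<bar>\<phi> h\<bar>"])
      show "AE h in H. (\<lambda>i. \<bar>\<phi> h - s i h\<bar>) \<longlonglongrightarrow> 0"
      proof (rule AE_I2)
        fix h assume "h \<in> space H"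
        from tendsto_rabs[OF tendsto_diff[OF tendsto_const LIMc[OF this]], of "\<phi> h"]
        show "(\<lambda>i. \<bar>\<phi> h - s i h\<bar>) \<longlonglongrightarrow> 0" by simp
      qed
      show "AE h in H. norm \<bar>\<phi> h - s i h\<bar> \<le> 3 * \<bar>\<phi> h\<bar>" for i
      proof (rule AE_I2)
        fix h assume "h \<in> space H"
        from LIMn[OF this, of i] show "norm \<bar>\<phi> h - s i h\<bar> \<le> 3 * \<bar>\<phi> h\<bar>" by simp
      qed
    qed (use LIMi LIMf in auto)
    then have e: "(\<lambda>i. c * e i + d * e i) \<longlonglongrightarrow> 0" by (auto intro!: tendsto_eq_intros)
    \<comment> \<open>One null set serves all approximants at once. Outside it the errors under
      \<open>P\<close> and under the integral add up to \<open>c * e i + d * e i\<close>.\<close>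
    have "AE x in S. \<forall>i. \<bar>P (slice \<phi> f) x - P (slice (s i) f) x\<bar> \<le> c * e i"
      unfolding e_def AE_all_countable using P_slice_diff_weight[OF f LIMf LIMi] by auto
    moreover have "AE x in S. \<forall>i. P (slice (s i) f) x = (\<integral>h. s i h * F (h, x) \<partial>H)"
      unfolding AE_all_countable using LIMp by auto
    moreover note AE_space[of S]
    ultimately show ?case
    proof eventually_elim
      case (elim x)
      have "\<bar>P (slice \<phi> f) x - (\<integral>h. \<phi> h * F (h, x) \<partial>H)\<bar> \<le> c * e i + d * e i" for i
      proof -
        have "\<bar>(\<integral>h. \<phi> h * F (h, x) \<partial>H) - (\<integral>h. s i h * F (h, x) \<partial>H)\<bar> \<le> d * e i"
          using bounded_par_integrable(2)[OF F Bochner_Integration.integrable_diff[OF LIMf LIMi] elim(3), of i]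
            bounded_par_integrable(1)[OF F LIMf elim(3)] bounded_par_integrable(1)[OF F LIMi elim(3), of i]
          by (simp add: e_def left_diff_distrib)
        then show ?thesis using elim(1)[rule_format, of i] elim(2)[rule_format, of i] by linarith
      qed
      then have "\<bar>P (slice \<phi> f) x - (\<integral>h. \<phi> h * F (h, x) \<partial>H)\<bar> \<le> 0"
        by (intro LIMSEQ_le_const[OF e]) auto
      then show ?case by simp
    qed
  qed
qed

text \<open>Two reductions lead to the finite nonnegative case: an equivalent finite measure
  replaces \<open>H\<close>, and f + c, with values between 0 and 2c, replaces f. Subtracting c
  afterwards restores the sharp bound c.\<close>

lemma exists_extension:
  assumes f: "bounded_fun c f" and c: "0 \<le> c"
  obtains F where "bounded_par c F" "extends f F"
proof -
  obtain w :: "'h \<Rightarrow> real" where wi: "integrable H w" and wpos: "\<forall>h\<in>space H. 0 < w h" and wnn: "\<And>h. 0 \<le> w h"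
    using H.exists_positive_integrable by auto
  have w[measurable]: "w \<in> borel_measurable H" using wi by auto
  have wne: "w h \<noteq> 0" if "h \<in> space H" for h using wpos that by auto
  define H' where "H' = density H w"
  have sH'[measurable_cong, simp]: "sets H' = sets H" by (simp add: H'_def)
  have spH'[simp]: "space H' = space H" by (simp add: H'_def)
  have sets_eq[measurable_cong]: "sets (H' \<Otimes>\<^sub>M S) = sets (H \<Otimes>\<^sub>M S)" "sets (G \<Otimes>\<^sub>M H' \<Otimes>\<^sub>M S) = sets (G \<Otimes>\<^sub>M H \<Otimes>\<^sub>M S)"
    by (auto intro!: sets_pair_measure_cong)
  have fin: "finite_measure H'" unfolding H'_def by (rule finite_measure_density_integrable[OF wi wnn])
  interpret H': finite_measure H' by fact
  interpret Q: parametrized_expectation G S P H' by unfold_locales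
  have f': "Q.bounded_fun c f" using f by (simp add: bounded_fun_def Q.bounded_fun_def measurable_cong_sets[OF sets_eq(2) refl] space_pair_measure)
  obtain F0 where F0: "F0 \<in> borel_measurable (H' \<Otimes>\<^sub>M S)" "\<And>z. 0 \<le> F0 z" "\<And>z. F0 z \<le> 2 * c" and
    ex: "\<And>A. A \<in> sets H' \<Longrightarrow> AE x in S. P (Q.slice (indicator A) (\<lambda>z. f z + c)) x = (\<integral>h. indicator A h * F0 (h, x) \<partial>H')"
  proof (rule Q.exists_extension_finite[OF fin, of "2 * c" "\<lambda>z. f z + c"])
    fix z assume "z \<in> space (G \<Otimes>\<^sub>M H' \<Otimes>\<^sub>M S)"
    then have "\<bar>f z\<bar> \<le> c" using f' by (auto simp: Q.bounded_fun_def)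
    then show "0 \<le> f z + c" "f z + c \<le> 2 * c" by (auto simp: abs_le_iff)
  qed (use c f' in \<open>auto simp: Q.bounded_fun_def\<close>)
  have b1: "Q.bounded_fun (2 * c) (\<lambda>z. f z + c)" using f' by (fastforce simp: Q.bounded_fun_def abs_le_iff)
  have b2: "Q.bounded_par (2 * c) F0" using F0 by (auto simp: Q.bounded_par_def)
  have b3: "Q.bounded_par c (\<lambda>_. c)" using c by (auto simp: Q.bounded_par_def)
  \<comment> \<open>The constant c is its own extension, so it can be subtracted on both
    sides.\<close>
  have "Q.extends (\<lambda>z. 1 * (f z + c) + (-1) * (\<lambda>(a, z). c) z) (\<lambda>z. 1 * F0 z + (-1) * c)"
    by (rule Q.extends_lincomb[OF b1 Q.bounded_par_fun[OF b3] b2 b3 Q.extendsI_indicator[OF b1 b2 ex] Q.extends_snd[OF b3]])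
  then have ext: "Q.extends f (\<lambda>z. F0 z - c)" by (simp add: case_prod_unfold)
  show ?thesis
  proof (rule that)
    show "bounded_par c (\<lambda>z. F0 z - c)"
      unfolding bounded_par_def
    proof safe
      show "(\<lambda>z. F0 z - c) \<in> borel_measurable (H \<Otimes>\<^sub>M S)" using F0(1) by measurable
      show "\<bar>F0 (h, x) - c\<bar> \<le> c" for h x using F0(2,3)[of "(h, x)"] by (auto simp: abs_le_iff)
    qed
    show "extends f (\<lambda>z. F0 z - c)" unfolding extends_def
    proof (intro allI impI)
      fix \<phi> :: "'h \<Rightarrow> real" assume \<phi>: "integrable H \<phi>"
      have [measurable]: "\<phi> \<in> borel_measurable H" using \<phi> by auto
      \<comment> \<open>The weight that pairs over \<open>H'\<close> as \<phi> pairs over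
        \<open>H\<close>.\<close>
      define \<psi> where "\<psi> h = \<phi> h / w h" for h
      have [measurable]: "\<psi> \<in> borel_measurable H" by (simp add: \<psi>_def[abs_def])
      have tr: "(\<integral>h. \<psi> h * g h \<partial>H') = (\<integral>h. \<phi> h * g h \<partial>H)" if [measurable]: "g \<in> borel_measurable H" for g
        unfolding H'_def by (subst integral_density) (auto simp: wnn wne \<psi>_def intro!: Bochner_Integration.integral_cong)
      have "integrable H (\<lambda>h. w h *\<^sub>R \<psi> h)"
        using \<phi> by (subst Bochner_Integration.integrable_cong[OF refl, of _ _ \<phi>]) (auto simp: \<psi>_def wne)
      then have \<psi>: "integrable H' \<psi>" unfolding H'_def
        by (subst integrable_density) (auto simp: wnn)
      have "slice \<phi> f z = Q.slice \<psi> f z" if zs: "z \<in> space (G \<Otimes>\<^sub>M S)" for z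
      proof -
        obtain a x where z: "z = (a, x)" "a \<in> space G" "x \<in> space S" using zs by (auto simp: space_pair_measure)
        have "f \<in> borel_measurable (G \<Otimes>\<^sub>M H \<Otimes>\<^sub>M S)" using f by (simp add: bounded_fun_def)
        then have "(\<lambda>h. f (a, h, x)) \<in> borel_measurable H" using z by measurable
        from tr[OF this] show ?thesis by (simp add: slice_def Q.slice_def z)
      qed
      then have "AE x in S. P (slice \<phi> f) x = P (Q.slice \<psi> f) x" by (rule P_eqI[OF slice_Linf[OF f \<phi>]])
      with ext[unfolded Q.extends_def, rule_format, OF \<psi>] AE_space[of S]
      show "AE x in S. P (slice \<phi> f) x = (\<integral>h. \<phi> h * (F0 (h, x) - c) \<partial>H)"
      proof eventually_elim
        case (elim x)
        have "(\<lambda>h. F0 (h, x) - c) \<in> borel_measurable H" using elim(2) F0(1) by measurable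
        then show ?case using elim by (simp add: tr)
      qed
    qed
  qed
qed

end

text \<open>Adding c makes both functions densities of finite measures. These agree on rectangles,
  an intersection-stable generator, hence everywhere.\<close>

lemma AE_eq_if_integral_rectangle_eq:
  fixes F K :: "'a \<times> 'b \<Rightarrow> real"
  assumes M1: "finite_measure M1" and M2: "finite_measure M2"
    and F[measurable]: "F \<in> borel_measurable (M1 \<Otimes>\<^sub>M M2)" and K[measurable]: "K \<in> borel_measurable (M1 \<Otimes>\<^sub>M M2)"
    and bF: "\<And>z. z \<in> space (M1 \<Otimes>\<^sub>M M2) \<Longrightarrow> \<bar>F z\<bar> \<le> c" and bK: "\<And>z. z \<in> space (M1 \<Otimes>\<^sub>M M2) \<Longrightarrow> \<bar>K z\<bar> \<le> c"
    and eq: "\<And>A C. A \<in> sets M1 \<Longrightarrow> C \<in> sets M2 \<Longrightarrow>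
      (\<integral>z. indicator (A \<times> C) z * F z \<partial>(M1 \<Otimes>\<^sub>M M2)) = (\<integral>z. indicator (A \<times> C) z * K z \<partial>(M1 \<Otimes>\<^sub>M M2))"
  shows "AE z in M1 \<Otimes>\<^sub>M M2. F z = K z"
proof -
  let ?M = "M1 \<Otimes>\<^sub>M M2"
  interpret M: finite_measure ?M using finite_measure_pair_measure[OF M2 M1] .
  have i: "integrable ?M (\<lambda>z. indicator B z * u z)"
    if B: "B \<in> sets ?M" and u[measurable]: "u \<in> borel_measurable ?M" and b: "\<And>z. z \<in> space ?M \<Longrightarrow> \<bar>u z\<bar> \<le> c" for B u
    using B by (intro M.integrable_const_bound[where B=c] AE_I2) (use b order_trans[OF abs_ge_zero b] in \<open>auto simp: indicator_def\<close>)
  have em: "emeasure (density ?M (\<lambda>z. ennreal (u z + c))) B = ennreal ((\<integral>z. indicator B z * u z \<partial>?M) + c * measure ?M B)"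
    if B[measurable]: "B \<in> sets ?M" and u[measurable]: "u \<in> borel_measurable ?M" and b: "\<And>z. z \<in> space ?M \<Longrightarrow> \<bar>u z\<bar> \<le> c" for B u
  proof -
    have i2: "integrable ?M (\<lambda>z. indicator B z * c)"
      by (intro integrable_mult_left integrable_real_indicator[OF B]) (simp add: M.emeasure_eq_measure)
    have nn: "0 \<le> u z + c" if "z \<in> space ?M" for z using b[OF that] by linarith
    have "emeasure (density ?M (\<lambda>z. ennreal (u z + c))) B = (\<integral>\<^sup>+z. ennreal (indicator B z * u z + indicator B z * c) \<partial>?M)"
      by (subst emeasure_density) (auto intro!: nn_integral_cong simp: indicator_def)
    also have "\<dots> = ennreal (\<integral>z. indicator B z * u z + indicator B z * c \<partial>?M)"
      by (rule nn_integral_eq_integral) (use i[OF B u b] i2 nn in \<open>auto simp: indicator_def\<close>)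
    also have "(\<integral>z. indicator B z * u z + indicator B z * c \<partial>?M) = (\<integral>z. indicator B z * u z \<partial>?M) + c * measure ?M B"
      using i[OF B u b] i2 by (simp add: Int_absorb2 sets.sets_into_space[OF B] mult.commute)
    finally show ?thesis .
  qed
  have nn: "0 \<le> (\<integral>z. indicator B z * u z \<partial>?M) + c * measure ?M B"
    if B[measurable]: "B \<in> sets ?M" and u[measurable]: "u \<in> borel_measurable ?M" and b: "\<And>z. z \<in> space ?M \<Longrightarrow> \<bar>u z\<bar> \<le> c" for B u
  proof -
    have iB: "integrable ?M (indicator B :: _ \<Rightarrow> real)"
      by (intro integrable_real_indicator[OF B]) (simp add: M.emeasure_eq_measure)
    from integrable_mult_bounded(2)[OF this u b]
    show ?thesis using sets.sets_into_space[OF B] by (simp add: Int_absorb2)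
  qed
  have "density ?M (\<lambda>z. ennreal (F z + c)) = density ?M (\<lambda>z. ennreal (K z + c))"
  proof (rule measure_eqI_generator_eq[OF Int_stable_pair_measure_generator, where \<Omega>="space M1 \<times> space M2" and A="\<lambda>_. space M1 \<times> space M2"])
    show "{a \<times> b |a b. a \<in> sets M1 \<and> b \<in> sets M2} \<subseteq> Pow (space M1 \<times> space M2)"
      by (rule pair_measure_closed)
    fix X assume "X \<in> {a \<times> b |a b. a \<in> sets M1 \<and> b \<in> sets M2}"
    then obtain A C where X: "X = A \<times> C" "A \<in> sets M1" "C \<in> sets M2" by auto
    then show "emeasure (density ?M (\<lambda>z. ennreal (F z + c))) X = emeasure (density ?M (\<lambda>z. ennreal (K z + c))) X"
      using em[OF _ F bF, of X] em[OF _ K bK, of X] eq[OF X(2,3)] by simp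
  next
    show "emeasure (density ?M (\<lambda>z. ennreal (F z + c))) (space M1 \<times> space M2) \<noteq> \<infinity>"
      using em[OF _ F bF, of "space M1 \<times> space M2"] by simp
  qed (auto simp: sets_pair_measure)
  then have e: "(\<integral>z. indicator B z * F z \<partial>?M) = (\<integral>z. indicator B z * K z \<partial>?M)" if B: "B \<in> sets ?M" for B
    using em[OF B F bF] em[OF B K bK] nn[OF B F bF] nn[OF B K bK] by (simp add: ennreal_inj)
  have "integrable ?M F" "integrable ?M K"
    by (auto intro!: M.integrable_const_bound[where B=c] AE_I2 bF bK)
  then show ?thesis by (rule AE_eq_if_integral_indicator_eq[OF _ _ e])
qed

section \<open>Uniqueness of the extension and its dependence on classes only\<close>

context parametrized_expectation
begin

text \<open>Each pairing holds outside its own null set of x. Integration over a set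
  \<open>C\<close> of base points removes these null sets, and the weights \<open>w\<close> times an
  indicator already separate bounded functions on H \<times> S.\<close>

lemma extends_unique:
  assumes F: "bounded_par c F" and K: "bounded_par d K" and fF: "extends f F" and fK: "extends f K"
  shows "AE z in H \<Otimes>\<^sub>M S. F z = K z"
proof -
  have F'[measurable]: "F \<in> borel_measurable (H \<Otimes>\<^sub>M S)" and K'[measurable]: "K \<in> borel_measurable (H \<Otimes>\<^sub>M S)"
    using F K by (auto simp: bounded_par_def)
  obtain w :: "'h \<Rightarrow> real" where w: "integrable H w" "\<forall>x\<in>space H. 0 < w x" "\<And>x. 0 \<le> w x"
    using H.exists_positive_integrable by auto
  have [measurable]: "w \<in> borel_measurable H" using w by auto
  define H' where "H' = density H w"
  have sH'[measurable_cong, simp]: "sets H' = sets H" by (simp add: H'_def)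
  have spH'[simp]: "space H' = space H" by (simp add: H'_def)
  have sets_eq[measurable_cong]: "sets (H' \<Otimes>\<^sub>M S) = sets (H \<Otimes>\<^sub>M S)"
    by (auto intro!: sets_pair_measure_cong)
  have fin: "finite_measure H'" unfolding H'_def by (rule finite_measure_density_integrable[OF w(1,3)])
  interpret H': finite_measure H' by fact
  interpret H'S: pair_sigma_finite H' S ..
  interpret H'SF: finite_measure "H' \<Otimes>\<^sub>M S" using finite_measure_pair_measure[OF S.finite_measure_axioms fin] .
  have "AE z in H' \<Otimes>\<^sub>M S. F z = K z"
  proof (rule AE_eq_if_integral_rectangle_eq[OF fin S.finite_measure_axioms])
    show "F \<in> borel_measurable (H' \<Otimes>\<^sub>M S)" "K \<in> borel_measurable (H' \<Otimes>\<^sub>M S)"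
      by measurable
    show "\<bar>F z\<bar> \<le> max c d" "\<bar>K z\<bar> \<le> max c d" if "z \<in> space (H' \<Otimes>\<^sub>M S)" for z
      using F K that by (auto simp: bounded_par_def space_pair_measure le_max_iff_disj)
    fix A C assume A[measurable]: "A \<in> sets H'" and C[measurable]: "C \<in> sets S"
    have A': "A \<in> sets H" using A by simp
    \<comment> \<open>The factor \<open>w\<close> keeps the weight integrable even when
      \<open>A\<close> has infinite measure.\<close>
    define \<phi> where "\<phi> h = w h * indicator A h" for h
    have \<phi>: "integrable H \<phi>" using integrable_real_mult_indicator[OF A' w(1)] by (simp add: \<phi>_def[abs_def])
    have tr: "(\<integral>z. indicator (A \<times> C) z * u z \<partial>(H' \<Otimes>\<^sub>M S)) = (\<integral>x. indicator C x * (\<integral>h. \<phi> h * u (h, x) \<partial>H) \<partial>S)"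
      if u: "bounded_par e u" for e u
    proof -
      have um[measurable]: "u \<in> borel_measurable (H \<Otimes>\<^sub>M S)" and ub: "\<And>z. z\<in>space (H \<Otimes>\<^sub>M S) \<Longrightarrow> \<bar>u z\<bar> \<le> e"
        using u by (auto simp: bounded_par_def)
      have i: "integrable (H' \<Otimes>\<^sub>M S) (\<lambda>z. indicator (A \<times> C) z * u z)"
        by (intro H'SF.integrable_const_bound[where B=e] AE_I2)
           (use ub order_trans[OF abs_ge_zero ub] in \<open>auto simp: indicator_def space_pair_measure\<close>)
      have "(\<integral>z. indicator (A \<times> C) z * u z \<partial>(H' \<Otimes>\<^sub>M S)) = (\<integral>(h,x). indicator (A \<times> C) (h,x) * u (h,x) \<partial>(H' \<Otimes>\<^sub>M S))"
        by (simp add: case_prod_unfold)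
      also have "\<dots> = (\<integral>x. (\<integral>h. indicator (A \<times> C) (h,x) * u (h,x) \<partial>H') \<partial>S)"
        using i by (intro H'S.integral_snd[symmetric]) (simp add: case_prod_unfold)
      also have "\<dots> = (\<integral>x. indicator C x * (\<integral>h. \<phi> h * u (h, x) \<partial>H) \<partial>S)"
      proof (rule Bochner_Integration.integral_cong[OF refl])
        fix x assume x: "x \<in> space S"
        have "(\<integral>h. indicator (A \<times> C) (h,x) * u (h,x) \<partial>H') = (\<integral>h. indicator C x * (indicator A h * u (h,x)) \<partial>H')"
          by (intro Bochner_Integration.integral_cong) (auto simp: indicator_def)
        also have "\<dots> = indicator C x * (\<integral>h. indicator A h * u (h,x) \<partial>H')" by simp
        also have "(\<integral>h. indicator A h * u (h,x) \<partial>H') = (\<integral>h. \<phi> h * u (h, x) \<partial>H)"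
        proof -
          have [measurable]: "(\<lambda>h. u (h, x)) \<in> borel_measurable H" using x by measurable
          show ?thesis unfolding H'_def
            by (subst integral_density) (use A' in \<open>auto simp: w \<phi>_def intro!: Bochner_Integration.integral_cong\<close>)
        qed
        finally show "(\<integral>h. indicator (A \<times> C) (h,x) * u (h,x) \<partial>H') = indicator C x * (\<integral>h. \<phi> h * u (h, x) \<partial>H)" .
      qed
      finally show ?thesis .
    qed
    have L: "(\<lambda>x. \<integral>h. \<phi> h * F (h, x) \<partial>H) \<in> Linf S" "(\<lambda>x. \<integral>h. \<phi> h * K (h, x) \<partial>H) \<in> Linf S"
      using bounded_par_Linf[OF F \<phi>] bounded_par_Linf[OF K \<phi>] by auto
    have "AE x in S. (\<integral>h. \<phi> h * F (h, x) \<partial>H) = (\<integral>h. \<phi> h * K (h, x) \<partial>H)"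
      using fF[unfolded extends_def, rule_format, OF \<phi>] fK[unfolded extends_def, rule_format, OF \<phi>] by eventually_elim simp
    then show "(\<integral>z. indicator (A \<times> C) z * F z \<partial>(H' \<Otimes>\<^sub>M S)) = (\<integral>z. indicator (A \<times> C) z * K z \<partial>(H' \<Otimes>\<^sub>M S))"
      unfolding tr[OF F] tr[OF K] using L
      by (intro integral_cong_AE) (auto simp: Linf_def elim!: AE_mp)
  qed
  then have "AE h in H'. AE x in S. F (h, x) = K (h, x)" by (rule H'S.AE_pair)
  then have "AE h in H. AE x in S. F (h, x) = K (h, x)"
    unfolding H'_def by (subst (asm) AE_density) (auto simp: w elim!: AE_mp)
  then show ?thesis by (intro HS.AE_pair_measure) auto
qed

text \<open>By Fubini, functions equal almost everywhere have slices equal almost everywhere, and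
  \<open>P\<close> respects this relation.\<close>

lemma extends_cong_AE:
  assumes f: "bounded_fun c f" and f': "bounded_fun d f'" and eq: "AE z in G \<Otimes>\<^sub>M H \<Otimes>\<^sub>M S. f z = f' z" and fF: "extends f F"
  shows "extends f' F"
  unfolding extends_def
proof (intro allI impI)
  fix \<phi> :: "'h \<Rightarrow> real" assume \<phi>: "integrable H \<phi>"
  have [measurable]: "f \<in> borel_measurable (G \<Otimes>\<^sub>M H \<Otimes>\<^sub>M S)" "f' \<in> borel_measurable (G \<Otimes>\<^sub>M H \<Otimes>\<^sub>M S)"
    using f f' by (auto simp: bounded_fun_def)
  note L = slice_Linf[OF f \<phi>] slice_Linf[OF f' \<phi>]
  have "AE a in G. AE z in H \<Otimes>\<^sub>M S. f (a, z) = f' (a, z)" using eq by (rule G_HS.AE_pair)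
  then have "AE a in G. AE x in S. slice \<phi> f (a, x) = slice \<phi> f' (a, x)"
    using AE_space
  proof eventually_elim
    case (elim a)
    then have "AE h in H. AE x in S. f (a, h, x) = f' (a, h, x)" by (intro HS.AE_pair)
    then have "AE x in S. AE h in H. f (a, h, x) = f' (a, h, x)"
      using elim(2) by (subst (asm) HS.AE_commute) auto
    then show ?case using AE_space
    proof eventually_elim
      case (elim x)
      have [measurable]: "\<phi> \<in> borel_measurable H" using \<phi> by auto
      show ?case unfolding slice_def prod.case
        by (rule integral_cong_AE) (use elim \<open>a \<in> space G\<close> in \<open>auto elim!: AE_mp\<close>)
    qed
  qed
  then have "AE z in G \<Otimes>\<^sub>M S. slice \<phi> f z = slice \<phi> f' z"
    using L by (intro GS.AE_pair_measure) (auto simp: Linf_def)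
  from P_cong[OF L this] fF[unfolded extends_def, rule_format, OF \<phi>]
  show "AE x in S. P (slice \<phi> f') x = (\<integral>h. \<phi> h * F (h, x) \<partial>H)" by eventually_elim simp
qed

text \<open>Allows evaluations constructed vector by vector to be replaced by those of a genuine
  functional.\<close>

lemma extends_cong_AE_par:
  assumes F: "bounded_par c F" and K: "bounded_par d K" and eq: "AE z in H \<Otimes>\<^sub>M S. F z = K z" and fF: "extends f F"
  shows "extends f K"
  unfolding extends_def
proof (intro allI impI)
  fix \<phi> :: "'h \<Rightarrow> real" assume \<phi>: "integrable H \<phi>"
  then have [measurable]: "\<phi> \<in> borel_measurable H" by auto
  have [measurable]: "F \<in> borel_measurable (H \<Otimes>\<^sub>M S)" "K \<in> borel_measurable (H \<Otimes>\<^sub>M S)"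
    using F K by (auto simp: bounded_par_def)
  have "AE h in H. AE x in S. F (h, x) = K (h, x)" using eq by (rule HS.AE_pair)
  then have "AE x in S. AE h in H. F (h, x) = K (h, x)" by (subst (asm) HS.AE_commute) auto
  then show "AE x in S. P (slice \<phi> f) x = (\<integral>h. \<phi> h * K (h, x) \<partial>H)"
    using AE_space fF[unfolded extends_def, rule_format, OF \<phi>]
  proof eventually_elim
    case (elim x)
    have "(\<integral>h. \<phi> h * F (h, x) \<partial>H) = (\<integral>h. \<phi> h * K (h, x) \<partial>H)"
      by (rule integral_cong_AE) (use elim in \<open>auto elim!: AE_mp\<close>)
    then show ?case using elim by simp
  qed
qed

text \<open>By uniqueness it is enough that some extension obeys the bound, and
  \<open>exists_extension\<close> supplies one.\<close>

lemma extends_AE_bound: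
  assumes f: "bounded_fun c f" and F: "bounded_par d F" and fF: "extends f F" and c: "0 \<le> c"
  shows "AE z in H \<Otimes>\<^sub>M S. \<bar>F z\<bar> \<le> c"
proof -
  obtain K where K: "bounded_par c K" "extends f K" using exists_extension[OF f c] .
  have "AE z in H \<Otimes>\<^sub>M S. z \<in> space (H \<Otimes>\<^sub>M S)" by simp
  then show ?thesis using extends_unique[OF F K(1) fF K(2)]
    by eventually_elim (use K(1) in \<open>auto simp: bounded_par_def\<close>)
qed

end

section \<open>Weak* measurable functions\<close>

lemma countable_dense_closure:
  obtains D :: "'a::second_countable_topology set" where "countable D" "closure D = UNIV"
proof -
  obtain D :: "'a set" where D: "countable D" "\<And>X. open X \<Longrightarrow> X \<noteq> {} \<Longrightarrow> \<exists>d\<in>D. d \<in> X"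
    using countable_dense_exists[where 'a='a] by auto
  have "x \<in> closure D" for x
    unfolding closure_iff_nhds_not_empty using D(2) by blast
  then show ?thesis using D(1) that by blast
qed

text \<open>The hypothesis expresses linearity and boundedness at once, so that \<open>D\<close> need not be a subspace.\<close>

lemma blinfun_extension_dense:
  fixes \<phi> :: "'v::real_normed_vector \<Rightarrow> real"
  assumes D: "closure D = UNIV" and R: "closure R = UNIV" and one: "1 \<in> R" "0 \<in> R" and C: "0 \<le> C"
    and le: "\<And>r s d d' d''. r \<in> R \<Longrightarrow> s \<in> R \<Longrightarrow> d \<in> D \<Longrightarrow> d' \<in> D \<Longrightarrow> d'' \<in> D \<Longrightarrow>
      \<bar>r * \<phi> d + s * \<phi> d' - \<phi> d''\<bar> \<le> C * norm (r *\<^sub>R d + s *\<^sub>R d' - d'')"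
  obtains \<xi> :: "'v \<Rightarrow>\<^sub>L real" where "norm \<xi> \<le> C" "\<And>d. d \<in> D \<Longrightarrow> blinfun_apply \<xi> d = \<phi> d"
proof -
  \<comment> \<open>The case r = 1, s = 0 of the hypothesis.\<close>
  have "C-lipschitz_on D \<phi>"
    using le[OF one] C by (intro lipschitz_onI) (auto simp: dist_norm)
  then obtain g where gL: "C-lipschitz_on UNIV g" and g: "\<And>d. d \<in> D \<Longrightarrow> g d = \<phi> d"
    using lipschitz_extend_closure[of C D \<phi>] D by auto
  have gc: "continuous_on UNIV g" using lipschitz_on_continuous_on[OF gL] .
  \<comment> \<open>The inequality is a closed condition in scalars and vectors together, and it
    holds on a dense product, hence everywhere.\<close>
  define T where "T = {p. \<bar>fst (fst p) * g (fst (snd p)) + snd (fst p) * g (fst (snd (snd p))) - g (snd (snd (snd p)))\<bar>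
     \<le> C * norm (fst (fst p) *\<^sub>R fst (snd p) + snd (fst p) *\<^sub>R fst (snd (snd p)) - snd (snd (snd p)))}"
  have "closed T" unfolding T_def
    by (intro closed_Collect_le continuous_intros continuous_on_compose2[OF gc]) auto
  moreover have "(R \<times> R) \<times> (D \<times> D \<times> D) \<subseteq> T" using le g by (auto simp: T_def)
  ultimately have "closure ((R \<times> R) \<times> (D \<times> D \<times> D)) \<subseteq> T" by (rule closure_minimal[rotated])
  then have T: "T = UNIV" by (auto simp: closure_Times D R)
  have ineq: "\<bar>r * g v + s * g v' - g v''\<bar> \<le> C * norm (r *\<^sub>R v + s *\<^sub>R v' - v'')" for r s v v' v''
  proof -
    have "((r, s), v, v', v'') \<in> T" by (simp add: T)
    then show ?thesis by (simp add: T_def)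
  qed
  \<comment> \<open>With v'' equal to the combination itself the right-hand side vanishes: the bound
    alone forces linearity.\<close>
  have lin: "r * g v + s * g v' = g (r *\<^sub>R v + s *\<^sub>R v')" for r s v v'
    using ineq[of r v s v' "r *\<^sub>R v + s *\<^sub>R v'"] by simp
  have bd: "\<bar>g v\<bar> \<le> norm v * C" for v using ineq[of 0 0 0 0 v] lin[of 0 0 0 0] by (simp add: mult.commute)
  have bl: "bounded_linear g"
    using lin[of 1 _ 1] lin[of _ _ 0] bd by (intro bounded_linear_intro[of g C]) (auto simp: algebra_simps)
  show ?thesis
  proof (rule that[of "Blinfun g"])
    show "norm (Blinfun g) \<le> C"
      using bd C by (intro norm_blinfun_bound) (auto simp: bounded_linear_Blinfun_apply[OF bl] mult.commute)
    show "blinfun_apply (Blinfun g) d = \<phi> d" if "d \<in> D" for d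
      using g[OF that] by (simp add: bounded_linear_Blinfun_apply[OF bl])
  qed
qed

lemma blinfun_eq_dense:
  fixes \<xi> \<zeta> :: "'v::real_normed_vector \<Rightarrow>\<^sub>L real"
  assumes D: "closure D = UNIV" and eq: "\<And>d. d \<in> D \<Longrightarrow> blinfun_apply \<xi> d = blinfun_apply \<zeta> d"
  shows "\<xi> = \<zeta>"
proof (rule blinfun_eqI)
  fix v
  have "closed {v. blinfun_apply \<xi> v = blinfun_apply \<zeta> v}"
    by (intro closed_Collect_eq continuous_intros)
  then have "closure D \<subseteq> {v. blinfun_apply \<xi> v = blinfun_apply \<zeta> v}"
    using eq by (intro closure_minimal) auto
  then show "blinfun_apply \<xi> v = blinfun_apply \<zeta> v" using D by auto
qed

text \<open>Representatives whose bound holds at every point, so that evaluation at a vector yields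
  a function as in \<open>bounded_fun\<close>.\<close>

definition weak_bounded :: "'t measure \<Rightarrow> real \<Rightarrow> ('t \<Rightarrow> ('v::real_normed_vector \<Rightarrow>\<^sub>L real)) \<Rightarrow> bool" where
  "weak_bounded M c f \<longleftrightarrow> (\<forall>v. (\<lambda>t. blinfun_apply (f t) v) \<in> borel_measurable M) \<and> (\<forall>t\<in>space M. norm (f t) \<le> c)"

lemma weak_bounded_Linf: "weak_bounded M c f \<Longrightarrow> f \<in> Linf_weak_star M"
  by (auto simp: weak_bounded_def Linf_weak_star_def)

text \<open>Each vector has its own null set; separability of the predual leaves only countably many
  vectors to consider.\<close>

lemma weak_AE_eqI:
  fixes f g :: "'t \<Rightarrow> ('v::{real_normed_vector, second_countable_topology} \<Rightarrow>\<^sub>L real)"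
  assumes "\<And>v. AE t in M. blinfun_apply (f t) v = blinfun_apply (g t) v"
  shows "AE t in M. f t = g t"
proof -
  obtain D :: "'v set" where D: "countable D" "closure D = UNIV" by (rule countable_dense_closure)
  have "AE t in M. \<forall>d\<in>D. blinfun_apply (f t) d = blinfun_apply (g t) d"
    using assms by (simp add: AE_ball_countable[OF D(1)])
  then show ?thesis by eventually_elim (rule blinfun_eq_dense[OF D(2)], auto)
qed

lemma blinfun_norm_le_dense:
  fixes \<xi> :: "'v::real_normed_vector \<Rightarrow>\<^sub>L real"
  assumes D: "closure D = UNIV" and c: "0 \<le> c" and le: "\<And>d. d \<in> D \<Longrightarrow> \<bar>blinfun_apply \<xi> d\<bar> \<le> c * norm d"
  shows "norm \<xi> \<le> c"
proof (rule norm_blinfun_bound[OF c])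
  fix v
  have "closed {v. \<bar>blinfun_apply \<xi> v\<bar> \<le> c * norm v}"
    by (intro closed_Collect_le continuous_intros)
  then have "closure D \<subseteq> {v. \<bar>blinfun_apply \<xi> v\<bar> \<le> c * norm v}"
    using le by (intro closure_minimal) auto
  then show "norm (blinfun_apply \<xi> v) \<le> c * norm v" using D by auto
qed

text \<open>Weak-star measurability speaks of evaluations only. Over a countable dense set of
  vectors, a bound on the norm becomes countably many conditions on evaluations, hence a measurable
  one.\<close>

lemma blinfun_norm_le_iff:
  fixes \<xi> :: "'v::real_normed_vector \<Rightarrow>\<^sub>L real"
  assumes D: "closure D = UNIV" and c: "0 \<le> c"
  shows "norm \<xi> \<le> c \<longleftrightarrow> (\<forall>d\<in>D. \<bar>blinfun_apply \<xi> d\<bar> \<le> c * norm d)"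
proof
  assume "norm \<xi> \<le> c"
  show "\<forall>d\<in>D. \<bar>blinfun_apply \<xi> d\<bar> \<le> c * norm d"
  proof
    fix d
    have "\<bar>blinfun_apply \<xi> d\<bar> \<le> norm \<xi> * norm d" using norm_blinfun[of \<xi> d] by simp
    also have "\<dots> \<le> c * norm d" using \<open>norm \<xi> \<le> c\<close> by (rule mult_right_mono) simp
    finally show "\<bar>blinfun_apply \<xi> d\<bar> \<le> c * norm d" .
  qed
qed (use blinfun_norm_le_dense[OF D c] in auto)

text \<open>Values of too large a norm occur on a null set, measurable by
  \<open>blinfun_norm_le_iff\<close>, and are replaced there by 0.\<close>

lemma Linf_weak_star_weak_bounded:
  fixes f :: "'t \<Rightarrow> ('v::{real_normed_vector, second_countable_topology} \<Rightarrow>\<^sub>L real)"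
  assumes "f \<in> Linf_weak_star M"
  obtains c f' where "0 \<le> c" "weak_bounded M c f'" "AE t in M. f t = f' t"
proof -
  obtain c0 where c0: "AE t in M. norm (f t) \<le> c0" using assms by (auto simp: Linf_weak_star_def)
  have m[measurable]: "(\<lambda>t. blinfun_apply (f t) v) \<in> borel_measurable M" for v using assms by (auto simp: Linf_weak_star_def)
  \<comment> \<open>Over a null measure the essential bound may be negative.\<close>
  define c where "c = max 0 c0"
  have c: "0 \<le> c" by (simp add: c_def)
  obtain D :: "'v set" where D: "countable D" "closure D = UNIV" by (rule countable_dense_closure)
  define f' where "f' t = (if norm (f t) \<le> c then f t else 0)" for t
  have [measurable]: "Measurable.pred M (\<lambda>t. norm (f t) \<le> c)"
    unfolding blinfun_norm_le_iff[OF D(2) c] using D(1) by measurable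
  have "weak_bounded M c f'" unfolding weak_bounded_def
  proof safe
    fix v
    have "(\<lambda>t. blinfun_apply (f' t) v) = (\<lambda>t. if norm (f t) \<le> c then blinfun_apply (f t) v else 0)"
      by (auto simp: f'_def)
    then show "(\<lambda>t. blinfun_apply (f' t) v) \<in> borel_measurable M" by simp
  qed (simp add: f'_def c)
  moreover have "AE t in M. f t = f' t" using c0 by eventually_elim (auto simp: f'_def c_def)
  ultimately show ?thesis using that c by blast
qed

lemma weak_bounded_scaleR: "weak_bounded M c f \<Longrightarrow> weak_bounded M (\<bar>r\<bar> * c) (\<lambda>t. r *\<^sub>R f t)"
  by (auto simp: weak_bounded_def blinfun.scaleR_left intro!: mult_left_mono borel_measurable_times)

lemma weak_bounded_add: "weak_bounded M c f \<Longrightarrow> weak_bounded M d g \<Longrightarrow> weak_bounded M (c + d) (\<lambda>t. f t + g t)"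
  by (auto simp: weak_bounded_def blinfun.add_left intro!: norm_triangle_le add_mono borel_measurable_add)

lemma weak_bounded_zero: "weak_bounded M 0 (\<lambda>t. 0)"
  by (auto simp: weak_bounded_def)

lemma weak_bounded_sum:
  "finite I \<Longrightarrow> (\<And>i. i \<in> I \<Longrightarrow> weak_bounded M (c i) (f i)) \<Longrightarrow> weak_bounded M (\<Sum>i\<in>I. c i) (\<lambda>t. \<Sum>i\<in>I. f i t)"
  by (induction I rule: finite_induct) (auto intro: weak_bounded_add weak_bounded_zero)

lemma weak_bounded_comp:
  assumes "weak_bounded M c f" "T \<in> N \<rightarrow>\<^sub>M M" shows "weak_bounded N c (\<lambda>t. f (T t))"
  using assms measurable_space[OF assms(2)] by (auto simp: weak_bounded_def intro: measurable_compose)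

section \<open>Extension of functions with values in the dual space\<close>

context parametrized_expectation
begin

definition weak_extends :: "('g \<times> 'h \<times> 's \<Rightarrow> ('v::real_normed_vector \<Rightarrow>\<^sub>L real)) \<Rightarrow> ('h \<times> 's \<Rightarrow> ('v \<Rightarrow>\<^sub>L real)) \<Rightarrow> bool" where
  "weak_extends f F \<longleftrightarrow> (\<forall>v. extends (\<lambda>z. blinfun_apply (f z) v) (\<lambda>z. blinfun_apply (F z) v))"

lemma weak_bounded_fun:
  assumes "weak_bounded (G \<Otimes>\<^sub>M H \<Otimes>\<^sub>M S) c f" shows "bounded_fun (c * norm v) (\<lambda>z. blinfun_apply (f z) v)"
  unfolding bounded_fun_def
proof (intro conjI ballI)
  fix z assume "z \<in> space (G \<Otimes>\<^sub>M H \<Otimes>\<^sub>M S)"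
  then have "norm (f z) \<le> c" using assms by (auto simp: weak_bounded_def)
  then have "norm (f z) * norm v \<le> c * norm v" by (rule mult_right_mono) simp
  then show "\<bar>blinfun_apply (f z) v\<bar> \<le> c * norm v" using norm_blinfun[of "f z" v] by simp
qed (use assms in \<open>auto simp: weak_bounded_def\<close>)

lemma weak_bounded_par:
  assumes "weak_bounded (H \<Otimes>\<^sub>M S) c F" shows "bounded_par (c * norm v) (\<lambda>z. blinfun_apply (F z) v)"
  unfolding bounded_par_def
proof (intro conjI ballI)
  fix z assume "z \<in> space (H \<Otimes>\<^sub>M S)"
  then have "norm (F z) \<le> c" using assms by (auto simp: weak_bounded_def)
  then have "norm (F z) * norm v \<le> c * norm v" by (rule mult_right_mono) simp
  then show "\<bar>blinfun_apply (F z) v\<bar> \<le> c * norm v" using norm_blinfun[of "F z" v] by simp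
qed (use assms in \<open>auto simp: weak_bounded_def\<close>)

lemma weak_extends_unique:
  fixes F K :: "'h \<times> 's \<Rightarrow> ('v::{real_normed_vector, second_countable_topology} \<Rightarrow>\<^sub>L real)"
  assumes F: "weak_bounded (H \<Otimes>\<^sub>M S) c F" and K: "weak_bounded (H \<Otimes>\<^sub>M S) d K"
    and "weak_extends f F" "weak_extends f K"
  shows "AE z in H \<Otimes>\<^sub>M S. F z = K z"
  by (rule weak_AE_eqI)
     (use assms in \<open>auto simp: weak_extends_def intro!: extends_unique[OF weak_bounded_par[OF F] weak_bounded_par[OF K]]\<close>)

lemma weak_extends_cong_AE:
  assumes f: "weak_bounded (G \<Otimes>\<^sub>M H \<Otimes>\<^sub>M S) c f" and f': "weak_bounded (G \<Otimes>\<^sub>M H \<Otimes>\<^sub>M S) d f'"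
    and eq: "AE z in G \<Otimes>\<^sub>M H \<Otimes>\<^sub>M S. f z = f' z" and fF: "weak_extends f F"
  shows "weak_extends f' F"
  unfolding weak_extends_def
proof
  fix v
  show "extends (\<lambda>z. blinfun_apply (f' z) v) (\<lambda>z. blinfun_apply (F z) v)"
    by (rule extends_cong_AE[OF weak_bounded_fun[OF f] weak_bounded_fun[OF f']])
       (use eq fF in \<open>auto simp: weak_extends_def elim!: AE_mp\<close>)
qed

text \<open>Extending the evaluations separately gives functions \<open>F v\<close> whose linear
  relations hold only up to null sets depending on the vectors. The relations are imposed on
  countable dense sets of vectors and scalars, where one null set suffices, and
  \<open>blinfun_extension_dense\<close> assembles a functional at each remaining point.\<close>

lemma exists_weak_extension:
  fixes f :: "'g \<times> 'h \<times> 's \<Rightarrow> ('v::{real_normed_vector, second_countable_topology} \<Rightarrow>\<^sub>L real)"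
  assumes f: "weak_bounded (G \<Otimes>\<^sub>M H \<Otimes>\<^sub>M S) c f" and c: "0 \<le> c"
  obtains F where "weak_bounded (H \<Otimes>\<^sub>M S) c F" "weak_extends f F"
proof -
  obtain D :: "'v set" where D: "countable D" "closure D = UNIV" by (rule countable_dense_closure)
  obtain R0 :: "real set" where R0: "countable R0" "closure R0 = UNIV" by (rule countable_dense_closure)
  \<comment> \<open>\<open>blinfun_extension_dense\<close> requires 0 and 1 among the
    scalars.\<close>
  define R where "R = insert 0 (insert 1 R0)"
  have R: "countable R" "closure R = UNIV" "1 \<in> R" "0 \<in> R"
    using R0 closure_mono[of R0 R] by (auto simp: R_def)
  note bf = weak_bounded_fun[OF f]
  have "\<forall>v. \<exists>F. bounded_par (c * norm v) F \<and> extends (\<lambda>z. blinfun_apply (f z) v) F"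
  proof
    fix v :: 'v
    have "0 \<le> c * norm v" using c by simp
    then obtain F where "bounded_par (c * norm v) F" "extends (\<lambda>z. blinfun_apply (f z) v) F"
      by (rule exists_extension[OF bf])
    then show "\<exists>F. bounded_par (c * norm v) F \<and> extends (\<lambda>z. blinfun_apply (f z) v) F" by blast
  qed
  then obtain F where F: "\<And>v. bounded_par (c * norm v) (F v)" and fF: "\<And>v. extends (\<lambda>z. blinfun_apply (f z) v) (F v)"
    by metis
  have Fm[measurable]: "F v \<in> borel_measurable (H \<Otimes>\<^sub>M S)" for v using F by (auto simp: bounded_par_def)
  define good where "good z \<longleftrightarrow> (\<forall>r\<in>R. \<forall>s\<in>R. \<forall>d\<in>D. \<forall>d'\<in>D. \<forall>d''\<in>D.
     \<bar>r * F d z + s * F d' z - F d'' z\<bar> \<le> c * norm (r *\<^sub>R d + s *\<^sub>R d' - d''))" for z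
  have good_meas[measurable]: "Measurable.pred (H \<Otimes>\<^sub>M S) good"
    unfolding good_def using D(1) R(1) by measurable
  \<comment> \<open>The combination of the \<open>F\<close> extends the evaluation of
    \<open>f\<close> at the vector r d + s d' - d'', which is bounded by c times the norm of that
    vector.\<close>
  have "AE z in H \<Otimes>\<^sub>M S. \<bar>r * F d z + s * F d' z - F d'' z\<bar> \<le> c * norm (r *\<^sub>R d + s *\<^sub>R d' - d'')" for r s d d' d''
  proof -
    have 1: "extends (\<lambda>z. r * blinfun_apply (f z) d + s * blinfun_apply (f z) d') (\<lambda>z. r * F d z + s * F d' z)"
      by (rule extends_lincomb[OF bf bf F F fF fF])
    have 2: "extends (\<lambda>z. 1 * (r * blinfun_apply (f z) d + s * blinfun_apply (f z) d') + (-1) * blinfun_apply (f z) d'')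
        (\<lambda>z. 1 * (r * F d z + s * F d' z) + (-1) * F d'' z)"
      by (rule extends_lincomb[OF bounded_fun_lincomb[OF bf bf] bf bounded_par_lincomb[OF F F] F 1 fF])
    have "AE z in H \<Otimes>\<^sub>M S. \<bar>1 * (r * F d z + s * F d' z) + (-1) * F d'' z\<bar> \<le> c * norm (r *\<^sub>R d + s *\<^sub>R d' - d'')"
    proof (rule extends_AE_bound[OF _ bounded_par_lincomb[OF bounded_par_lincomb[OF F F] F] 2])
      have "bounded_fun (c * norm (r *\<^sub>R d + s *\<^sub>R d' - d'')) (\<lambda>z. blinfun_apply (f z) (r *\<^sub>R d + s *\<^sub>R d' - d''))" by (rule bf)
      then show "bounded_fun (c * norm (r *\<^sub>R d + s *\<^sub>R d' - d''))
         (\<lambda>z. 1 * (r * blinfun_apply (f z) d + s * blinfun_apply (f z) d') + (-1) * blinfun_apply (f z) d'')"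
        by (simp add: blinfun.add_right blinfun.diff_right blinfun.scaleR_right)
    qed (use c in auto)
    then show ?thesis by simp
  qed
  then have good_AE: "AE z in H \<Otimes>\<^sub>M S. good z"
    unfolding good_def by (simp add: AE_ball_countable[OF D(1)] AE_ball_countable[OF R(1)])
  have "\<exists>\<xi> :: 'v \<Rightarrow>\<^sub>L real. norm \<xi> \<le> c \<and> (\<forall>d\<in>D. blinfun_apply \<xi> d = F d z)" if gz: "good z" for z
  proof -
    have "\<bar>r * F d z + s * F d' z - F d'' z\<bar> \<le> c * norm (r *\<^sub>R d + s *\<^sub>R d' - d'')"
      if "r \<in> R" "s \<in> R" "d \<in> D" "d' \<in> D" "d'' \<in> D" for r s d d' d''
      using gz that unfolding good_def by auto
    from blinfun_extension_dense[OF D(2) R(2-4) c, of "\<lambda>d. F d z", OF this]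
    obtain \<xi> :: "'v \<Rightarrow>\<^sub>L real" where "norm \<xi> \<le> c" "\<And>d. d \<in> D \<Longrightarrow> blinfun_apply \<xi> d = F d z"
      by auto
    then show ?thesis by auto
  qed
  then obtain \<xi> :: "'h \<times> 's \<Rightarrow> 'v \<Rightarrow>\<^sub>L real" where \<xi>: "\<And>z. good z \<Longrightarrow> norm (\<xi> z) \<le> c"
    "\<And>z d. good z \<Longrightarrow> d \<in> D \<Longrightarrow> blinfun_apply (\<xi> z) d = F d z" by metis
  \<comment> \<open>The value 0 off the measurable set of good points keeps \<open>K\<close> bounded
    and measurable.\<close>
  define K where "K z = (if good z then \<xi> z else 0)" for z
  have KD: "blinfun_apply (K z) d = (if good z then F d z else 0)" if "d \<in> D" for d z
    using \<xi>(2)[OF _ that] by (simp add: K_def)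
  have seq: "\<exists>d. (\<forall>n. d n \<in> D) \<and> d \<longlonglongrightarrow> v" for v
    using D(2) closure_sequential[of v D] by auto
  have K: "weak_bounded (H \<Otimes>\<^sub>M S) c K" unfolding weak_bounded_def
  proof (intro conjI allI ballI)
    fix v
    obtain d where d: "\<And>n. d n \<in> D" "d \<longlonglongrightarrow> v" using seq by blast
    show "(\<lambda>z. blinfun_apply (K z) v) \<in> borel_measurable (H \<Otimes>\<^sub>M S)"
    proof (rule borel_measurable_LIMSEQ_real)
      show "(\<lambda>n. blinfun_apply (K z) (d n)) \<longlonglongrightarrow> blinfun_apply (K z) v" for z
        using d(2) by (intro tendsto_intros)
      show "(\<lambda>z. blinfun_apply (K z) (d n)) \<in> borel_measurable (H \<Otimes>\<^sub>M S)" for n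
        by (simp add: KD[OF d(1)])
    qed
  qed (auto simp: K_def \<xi> c)
  note bK = weak_bounded_par[OF K]
  have ext_D: "extends (\<lambda>z. blinfun_apply (f z) d) (\<lambda>z. blinfun_apply (K z) d)" if d: "d \<in> D" for d
    by (rule extends_cong_AE_par[OF F bK _ fF]) (use good_AE in \<open>eventually_elim, simp add: KD[OF d]\<close>)
  have "weak_extends f K" unfolding weak_extends_def extends_def
  proof (intro allI impI)
    fix v and \<phi> :: "'h \<Rightarrow> real" assume \<phi>: "integrable H \<phi>"
    obtain d where d: "\<And>n. d n \<in> D" "d \<longlonglongrightarrow> v" using seq by blast
    \<comment> \<open>This error occurs twice, once under \<open>P\<close> and once under the
      integral.\<close>
    define e where "e n = c * norm (v - d n) * (\<integral>h. \<bar>\<phi> h\<bar> \<partial>H)" for n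
    have "(\<lambda>n. norm (v - d n)) \<longlonglongrightarrow> norm (v - v)" using d(2) by (intro tendsto_intros)
    then have "(\<lambda>n. norm (v - d n)) \<longlonglongrightarrow> 0" by simp
    from tendsto_mult_left[OF this, of "2 * c * (\<integral>h. \<bar>\<phi> h\<bar> \<partial>H)"]
    have e: "(\<lambda>n. 2 * e n) \<longlonglongrightarrow> 0" by (simp add: e_def mult_ac)
    have "AE x in S. \<forall>n. \<bar>P (slice \<phi> (\<lambda>z. blinfun_apply (f z) v)) x - P (slice \<phi> (\<lambda>z. blinfun_apply (f z) (d n))) x\<bar> \<le> e n"
      unfolding AE_all_countable e_def
    proof (intro allI P_slice_diff_fun[OF bf bf \<phi>])
      fix n z assume "z \<in> space (G \<Otimes>\<^sub>M H \<Otimes>\<^sub>M S)"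
      then show "\<bar>blinfun_apply (f z) v - blinfun_apply (f z) (d n)\<bar> \<le> c * norm (v - d n)"
        using bf[of "v - d n"] unfolding bounded_fun_def by (auto simp: blinfun.diff_right)
    qed
    moreover have "AE x in S. \<forall>n. P (slice \<phi> (\<lambda>z. blinfun_apply (f z) (d n))) x = (\<integral>h. \<phi> h * blinfun_apply (K (h, x)) (d n) \<partial>H)"
      unfolding AE_all_countable using ext_D[OF d(1)] \<phi> unfolding extends_def by blast
    moreover note AE_space[of S]
    ultimately show "AE x in S. P (slice \<phi> (\<lambda>z. blinfun_apply (f z) v)) x = (\<integral>h. \<phi> h * blinfun_apply (K (h, x)) v \<partial>H)"
    proof eventually_elim
      case (elim x)
      have "\<bar>P (slice \<phi> (\<lambda>z. blinfun_apply (f z) v)) x - (\<integral>h. \<phi> h * blinfun_apply (K (h, x)) v \<partial>H)\<bar> \<le> 2 * e n" for n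
      proof -
        have "\<bar>(\<integral>h. \<phi> h * blinfun_apply (K (h, x)) v \<partial>H) - (\<integral>h. \<phi> h * blinfun_apply (K (h, x)) (d n) \<partial>H)\<bar> \<le> e n"
          using bounded_par_integrable(2)[OF bK \<phi> elim(3), of "v - d n"] bounded_par_integrable(1)[OF bK \<phi> elim(3), of v]
            bounded_par_integrable(1)[OF bK \<phi> elim(3), of "d n"]
          by (simp add: e_def blinfun.diff_right right_diff_distrib)
        then show ?thesis using elim(1)[rule_format, of n] elim(2)[rule_format, of n] by linarith
      qed
      then have "\<bar>P (slice \<phi> (\<lambda>z. blinfun_apply (f z) v)) x - (\<integral>h. \<phi> h * blinfun_apply (K (h, x)) v \<partial>H)\<bar> \<le> 0"
        by (intro LIMSEQ_le_const[OF e]) auto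
      then show ?case by simp
    qed
  qed
  then show ?thesis using K that by blast
qed

lemma weak_extends_scaleR:
  assumes f: "weak_bounded (G \<Otimes>\<^sub>M H \<Otimes>\<^sub>M S) c f" and F: "weak_bounded (H \<Otimes>\<^sub>M S) d F" and fF: "weak_extends f F"
  shows "weak_extends (\<lambda>z. r *\<^sub>R f z) (\<lambda>z. r *\<^sub>R F z)"
  unfolding weak_extends_def
proof
  fix v
  have "extends (\<lambda>z. r * blinfun_apply (f z) v + 0 * blinfun_apply (f z) v) (\<lambda>z. r * blinfun_apply (F z) v + 0 * blinfun_apply (F z) v)"
    using fF unfolding weak_extends_def
    by (intro extends_lincomb[OF weak_bounded_fun[OF f] weak_bounded_fun[OF f] weak_bounded_par[OF F] weak_bounded_par[OF F]]) auto
  then show "extends (\<lambda>z. blinfun_apply (r *\<^sub>R f z) v) (\<lambda>z. blinfun_apply (r *\<^sub>R F z) v)"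
    by (simp add: blinfun.scaleR_left)
qed

lemma weak_extends_add:
  assumes f: "weak_bounded (G \<Otimes>\<^sub>M H \<Otimes>\<^sub>M S) c f" and F: "weak_bounded (H \<Otimes>\<^sub>M S) d F" and fF: "weak_extends f F"
    and g: "weak_bounded (G \<Otimes>\<^sub>M H \<Otimes>\<^sub>M S) c' g" and K: "weak_bounded (H \<Otimes>\<^sub>M S) d' K" and gK: "weak_extends g K"
  shows "weak_extends (\<lambda>z. f z + g z) (\<lambda>z. F z + K z)"
  unfolding weak_extends_def
proof
  fix v
  have "extends (\<lambda>z. 1 * blinfun_apply (f z) v + 1 * blinfun_apply (g z) v) (\<lambda>z. 1 * blinfun_apply (F z) v + 1 * blinfun_apply (K z) v)"
    using fF gK unfolding weak_extends_def
    by (intro extends_lincomb[OF weak_bounded_fun[OF f] weak_bounded_fun[OF g] weak_bounded_par[OF F] weak_bounded_par[OF K]]) auto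
  then show "extends (\<lambda>z. blinfun_apply (f z + g z) v) (\<lambda>z. blinfun_apply (F z + K z) v)"
    by (simp add: blinfun.add_left)
qed

lemma weak_extends_snd:
  assumes F: "weak_bounded (H \<Otimes>\<^sub>M S) d F" shows "weak_extends (\<lambda>(a, z). F z) F"
  unfolding weak_extends_def
proof
  fix v
  show "extends (\<lambda>z. blinfun_apply (case z of (a, z) \<Rightarrow> F z) v) (\<lambda>z. blinfun_apply (F z) v)"
    using extends_snd[OF weak_bounded_par[OF F, of v]] by (simp add: case_prod_unfold)
qed

end

lemma (in parametrized_expectation) weak_extends_sum:
  assumes "finite I" "\<And>i. i \<in> I \<Longrightarrow> weak_bounded (G \<Otimes>\<^sub>M H \<Otimes>\<^sub>M S) (c i) (f i)"
    "\<And>i. i \<in> I \<Longrightarrow> weak_bounded (H \<Otimes>\<^sub>M S) (d i) (F i)" "\<And>i. i \<in> I \<Longrightarrow> weak_extends (f i) (F i)"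
  shows "weak_extends (\<lambda>z. \<Sum>i\<in>I. f i z) (\<lambda>z. \<Sum>i\<in>I. F i z)"
  using assms
proof (induction I rule: finite_induct)
  case empty
  then show ?case using weak_extends_snd[OF weak_bounded_zero] by (simp add: case_prod_unfold)
next
  case (insert i I)
  have "weak_extends (\<lambda>z. f i z + (\<Sum>i\<in>I. f i z)) (\<lambda>z. F i z + (\<Sum>i\<in>I. F i z))"
    using insert by (intro weak_extends_add[OF _ _ _ weak_bounded_sum[of I _ c] weak_bounded_sum[of I _ d]]) auto
  then show ?case using insert by simp
qed

section \<open>Powers of an amenable group action\<close>

text \<open>As \<open>Q\<close> need not be measurable, its exceptional set is enclosed in a null
  set, and only null sets are pulled back.\<close>

lemma nonsingular_AE:
  assumes T: "T \<in> M \<rightarrow>\<^sub>M N" and null: "\<And>X. X \<in> null_sets N \<Longrightarrow> AE x in M. T x \<notin> X" and Q: "AE y in N. Q y"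
  shows "AE x in M. Q (T x)"
proof -
  obtain X where X: "X \<in> null_sets N" "{y \<in> space N. \<not> Q y} \<subseteq> X"
    using Q by (auto elim!: AE_E simp: null_sets_def)
  show ?thesis using null[OF X(1)] AE_space
    by eventually_elim (use X(2) measurable_space[OF T] in auto)
qed

section \<open>Translating, omitting and inserting coordinates of a tuple\<close>

definition translate :: "nat \<Rightarrow> 'g::plus \<Rightarrow> (nat \<Rightarrow> 'g) \<Rightarrow> nat \<Rightarrow> 'g" where
  "translate n g h = (\<lambda>i\<in>{..<n}. g + h i)"

text \<open>Here \<open>n\<close> is the length of the result, so tuples of length n + 1 are
  shortened; \<open>insert_at n i\<close> conversely lengthens tuples of length \<open>n\<close>.
  The restriction keeps tuples extensional, as points of a finite product are.\<close>

definition omit :: "nat \<Rightarrow> nat \<Rightarrow> (nat \<Rightarrow> 'a) \<Rightarrow> nat \<Rightarrow> 'a" where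
  "omit n i h = (\<lambda>j\<in>{..<n}. if j < i then h j else h (Suc j))"

definition insert_at :: "nat \<Rightarrow> nat \<Rightarrow> (nat \<Rightarrow> 'a) \<Rightarrow> 'a \<Rightarrow> nat \<Rightarrow> 'a" where
  "insert_at n i h b = (\<lambda>j\<in>{..<Suc n}. if j < i then h j else if j = i then b else h (j - 1))"

lemma omit_insert_at: "h \<in> extensional {..<n} \<Longrightarrow> i \<le> n \<Longrightarrow> omit n i (insert_at n i h b) = h"
  by (auto simp: omit_def insert_at_def fun_eq_iff extensional_def)

text \<open>The last coordinate survives the omission of any earlier one. The homotopy identity
  rests on this, with \<open>b\<close> as the variable to be averaged.\<close>

lemma omit_insert_last: "i \<le> n \<Longrightarrow> omit (Suc n) i (insert_at (Suc n) (Suc n) h b) = insert_at n n (omit n i h) b"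
  by (auto simp: omit_def insert_at_def fun_eq_iff)

lemma translate_insert_at:
  "translate (Suc n) g (insert_at n i h b) = insert_at n i (translate n g h) (g + b)" if "i \<le> n"
  using that by (auto simp: translate_def insert_at_def fun_eq_iff)

lemma translate_minus: "h \<in> extensional {..<n} \<Longrightarrow> translate n (- g) (translate n g h) = h"
  for g :: "'g::group_add"
  by (auto simp: translate_def fun_eq_iff extensional_def add.assoc[symmetric])

lemma measurable_omit: "i \<le> n \<Longrightarrow> omit n i \<in> Pi\<^sub>M {..<Suc n} (\<lambda>_. M) \<rightarrow>\<^sub>M Pi\<^sub>M {..<n} (\<lambda>_. M)"
  unfolding omit_def by (intro measurable_restrict) auto

lemma measurable_insert_at:
  "i \<le> n \<Longrightarrow> (\<lambda>(h, b). insert_at n i h b) \<in> Pi\<^sub>M {..<n} (\<lambda>_. M) \<Otimes>\<^sub>M M \<rightarrow>\<^sub>M Pi\<^sub>M {..<Suc n} (\<lambda>_. M)"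
  unfolding insert_at_def case_prod_unfold
proof (intro measurable_restrict)
  fix j assume "i \<le> n" "j \<in> {..<Suc n}"
  then show "(\<lambda>p. if j < i then fst p j else if j = i then snd p else fst p (j - 1)) \<in> Pi\<^sub>M {..<n} (\<lambda>_. M) \<Otimes>\<^sub>M M \<rightarrow>\<^sub>M M"
    by (cases "j < i"; cases "j = i") (auto intro!: measurable_compose[OF measurable_fst measurable_component_singleton])
qed

text \<open>The preimage of a box is a box with the \<open>i\<close>-th side split off, and boxes
  determine a product of \<sigma>-finite measures. This gives Fubini in any single
  coordinate.\<close>

lemma distr_insert_at:
  assumes M: "sigma_finite_measure M" and i: "i \<le> n"
  shows "distr (Pi\<^sub>M {..<n} (\<lambda>_. M) \<Otimes>\<^sub>M M) (Pi\<^sub>M {..<Suc n} (\<lambda>_. M)) (\<lambda>(h, b). insert_at n i h b) = Pi\<^sub>M {..<Suc n} (\<lambda>_. M)"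
proof -
  interpret M: sigma_finite_measure M by fact
  interpret product_sigma_finite "\<lambda>_::nat. M" by unfold_locales
  note m = measurable_insert_at[OF i, of M]
  show ?thesis
  proof (rule PiM_eqI)
    fix A :: "nat \<Rightarrow> 'a set" assume A: "\<And>j. j \<in> {..<Suc n} \<Longrightarrow> A j \<in> sets M"
    define A' where "A' j = (if j < i then A j else A (Suc j))" for j
    have A': "A' j \<in> sets M" if "j < n" for j using A that by (auto simp: A'_def)
    have sub: "A j \<subseteq> space M" if "j < Suc n" for j using sets.sets_into_space[OF A] that by auto
    have "(\<lambda>(h, b). insert_at n i h b) -` Pi\<^sub>E {..<Suc n} A \<inter> space (Pi\<^sub>M {..<n} (\<lambda>_. M) \<Otimes>\<^sub>M M) = Pi\<^sub>E {..<n} A' \<times> A i"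
    proof (intro equalityI subsetI)
      fix p assume p: "p \<in> (\<lambda>(h, b). insert_at n i h b) -` Pi\<^sub>E {..<Suc n} A \<inter> space (Pi\<^sub>M {..<n} (\<lambda>_. M) \<Otimes>\<^sub>M M)"
      obtain h b where [simp]: "p = (h, b)" by (cases p)
      from p have h: "insert_at n i h b \<in> Pi\<^sub>E {..<Suc n} A" and sp: "h \<in> extensional {..<n}"
        by (auto simp: space_pair_measure space_PiM PiE_iff)
      have "b \<in> A i" using PiE_mem[OF h, of i] i by (auto simp: insert_at_def)
      moreover have "h j \<in> A' j" if j: "j \<in> {..<n}" for j
        using PiE_mem[OF h, of "if j < i then j else Suc j"] j i
        by (auto simp: insert_at_def A'_def split: if_splits)
      ultimately show "p \<in> Pi\<^sub>E {..<n} A' \<times> A i" using sp by (auto simp: PiE_iff)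
    next
      fix p assume p: "p \<in> Pi\<^sub>E {..<n} A' \<times> A i"
      obtain h b where [simp]: "p = (h, b)" by (cases p)
      from p have h: "h \<in> Pi\<^sub>E {..<n} A'" and b: "b \<in> A i" by auto
      have "insert_at n i h b j \<in> A j" if j: "j \<in> {..<Suc n}" for j
        using PiE_mem[OF h, of "if j < i then j else j - 1"] j i b
        by (cases j) (auto simp: insert_at_def A'_def split: if_splits)
      moreover have "h j \<in> space M" if j: "j \<in> {..<n}" for j
        using PiE_mem[OF h j] A'[of j] j sets.sets_into_space by blast
      ultimately show "p \<in> (\<lambda>(h, b). insert_at n i h b) -` Pi\<^sub>E {..<Suc n} A \<inter> space (Pi\<^sub>M {..<n} (\<lambda>_. M) \<Otimes>\<^sub>M M)"
        using h b sub[of i] i by (auto simp: space_pair_measure space_PiM PiE_iff insert_at_def)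
    qed
    moreover have "Pi\<^sub>E {..<Suc n} A \<in> sets (Pi\<^sub>M {..<Suc n} (\<lambda>_. M))"
      using A by (intro sets_PiM_I_finite) auto
    ultimately have "emeasure (distr (Pi\<^sub>M {..<n} (\<lambda>_. M) \<Otimes>\<^sub>M M) (Pi\<^sub>M {..<Suc n} (\<lambda>_. M)) (\<lambda>(h, b). insert_at n i h b)) (Pi\<^sub>E {..<Suc n} A)
       = emeasure (Pi\<^sub>M {..<n} (\<lambda>_. M) \<Otimes>\<^sub>M M) (Pi\<^sub>E {..<n} A' \<times> A i)"
      by (simp add: emeasure_distr[OF m])
    also have "\<dots> = (\<Prod>j<n. emeasure M (A' j)) * emeasure M (A i)"
    proof -
      have "emeasure (Pi\<^sub>M {..<n} (\<lambda>_. M)) (Pi\<^sub>E {..<n} A') = (\<Prod>j<n. emeasure M (A' j))"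
        using A' by (intro emeasure_PiM) auto
      moreover have "Pi\<^sub>E {..<n} A' \<in> sets (Pi\<^sub>M {..<n} (\<lambda>_. M))"
        using A' by (intro sets_PiM_I_finite) auto
      ultimately show ?thesis using A i by (subst M.emeasure_pair_measure_Times) auto
    qed
    also have "(\<Prod>j<n. emeasure M (A' j)) = (\<Prod>j\<in>{..<Suc n} - {i}. emeasure M (A j))"
      by (rule prod.reindex_bij_witness[where i="\<lambda>j. if j < i then j else j - 1" and j="\<lambda>j. if j < i then j else Suc j"])
         (use i in \<open>auto simp: A'_def\<close>)
    also have "\<dots> * emeasure M (A i) = (\<Prod>j<Suc n. emeasure M (A j))"
      using i by (subst (2) prod.remove[of _ i]) (auto simp: mult.commute)
    finally show "emeasure (distr (Pi\<^sub>M {..<n} (\<lambda>_. M) \<Otimes>\<^sub>M M) (Pi\<^sub>M {..<Suc n} (\<lambda>_. M)) (\<lambda>(h, b). insert_at n i h b)) (Pi\<^sub>E {..<Suc n} A)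
       = (\<Prod>j<Suc n. emeasure M (A j))" .
  qed auto
qed

section \<open>Amenable actions and invariant measure on powers of the group\<close>

locale amenable_action = conditional_expectation G S P
  for G :: "'g::{topological_group_add, t2_space, second_countable_topology} measure" and S :: "'s measure" and P +
  fixes act :: "'g \<Rightarrow> 's \<Rightarrow> 's"
  assumes sets_G: "sets G = sets borel"
    and G_invariant: "distr G borel (\<lambda>h. g + h) = G"
    and act_measurable: "(\<lambda>(g, x). act g x) \<in> borel \<Otimes>\<^sub>M S \<rightarrow>\<^sub>M S"
    and act_zero: "x \<in> space S \<Longrightarrow> act 0 x = x"
    and act_add: "x \<in> space S \<Longrightarrow> act (g + h) x = act g (act h x)"
    and act_null: "null_sets (distr S S (act g)) = null_sets S"
    and P_equivariant: "f \<in> Linf (G \<Otimes>\<^sub>M S) \<Longrightarrow>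
        AE x in S. P (\<lambda>(h, y). f (- g + h, act (- g) y)) x = P f (act (- g) x)"
begin

lemma space_G[simp]: "space G = UNIV"
  using sets_eq_imp_space_eq[OF sets_G] by simp

declare sets_G[measurable_cong]

lemma uminus_measurable[measurable]: "(uminus :: 'g \<Rightarrow> 'g) \<in> borel \<rightarrow>\<^sub>M borel"
  by (intro borel_measurable_continuous_onI continuous_intros)

lemma act_measurable'[measurable (raw)]:
  "f \<in> M \<rightarrow>\<^sub>M borel \<Longrightarrow> g \<in> M \<rightarrow>\<^sub>M S \<Longrightarrow> (\<lambda>x. act (f x) (g x)) \<in> M \<rightarrow>\<^sub>M S"
  using measurable_compose[OF measurable_Pair act_measurable, of f M g] by simp

lemma act_space: "x \<in> space S \<Longrightarrow> act g x \<in> space S"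
  using measurable_space[OF act_measurable, of "(g, x)"] by (auto simp: space_pair_measure)

lemma act_AE: assumes "AE x in S. Q x" shows "AE x in S. Q (act g x)"
proof (rule nonsingular_AE[OF _ _ assms])
  show m: "act g \<in> S \<rightarrow>\<^sub>M S" by measurable
  fix X assume X: "X \<in> null_sets S"
  then have "X \<in> null_sets (distr S S (act g))" by (simp add: act_null)
  then have "AE x in distr S S (act g). x \<notin> X" by (rule AE_not_in)
  then show "AE x in S. act g x \<notin> X" by (rule AE_distrD[OF m])
qed

abbreviation GP :: "nat \<Rightarrow> (nat \<Rightarrow> 'g) measure" where "GP n \<equiv> Pi\<^sub>M {..<n} (\<lambda>_. G)"

sublocale GP: product_sigma_finite "\<lambda>_::nat. G" by unfold_locales

lemma sigma_finite_GP: "sigma_finite_measure (GP n)" by (rule GP.sigma_finite) simp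

sublocale Q: parametrized_expectation G S P "GP n" for n
  by (intro parametrized_expectation.intro conditional_expectation_axioms sigma_finite_GP)

lemma measurable_translate: "(\<lambda>(g, h). translate n g h) \<in> G \<Otimes>\<^sub>M GP n \<rightarrow>\<^sub>M GP n"
  unfolding translate_def case_prod_unfold
proof (rule measurable_restrict)
  fix i assume [measurable]: "i \<in> {..<n}"
  have "(\<lambda>p. fst p + snd p i) \<in> G \<Otimes>\<^sub>M GP n \<rightarrow>\<^sub>M borel" by measurable
  then show "(\<lambda>p. fst p + snd p i) \<in> G \<Otimes>\<^sub>M GP n \<rightarrow>\<^sub>M G"
    by (simp add: measurable_cong_sets[OF refl sets_G])
qed

lemma measurable_translate'[measurable (raw)]:
  "f \<in> M \<rightarrow>\<^sub>M borel \<Longrightarrow> k \<in> M \<rightarrow>\<^sub>M GP n \<Longrightarrow> (\<lambda>x. translate n (f x) (k x)) \<in> M \<rightarrow>\<^sub>M GP n"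
  using measurable_compose[OF measurable_Pair measurable_translate, of f M k] by (simp add: measurable_cong_sets[OF refl sets_G])

lemma distr_translate: "distr (GP n) (GP n) (translate n g) = GP n"
proof (rule GP.PiM_eqI)
  fix A :: "nat \<Rightarrow> 'g set" assume A: "\<And>j. j \<in> {..<n} \<Longrightarrow> A j \<in> sets G"
  have m: "translate n g \<in> GP n \<rightarrow>\<^sub>M GP n" by measurable
  have m1: "(\<lambda>h. g + h) \<in> G \<rightarrow>\<^sub>M borel" by measurable
  have "translate n g -` Pi\<^sub>E {..<n} A \<inter> space (GP n) = Pi\<^sub>E {..<n} (\<lambda>j. (\<lambda>h. g + h) -` A j)"
    by (auto simp: translate_def space_PiM PiE_iff)
  then have "emeasure (distr (GP n) (GP n) (translate n g)) (Pi\<^sub>E {..<n} A) = emeasure (GP n) (Pi\<^sub>E {..<n} (\<lambda>j. (\<lambda>h. g + h) -` A j))"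
    using A by (subst emeasure_distr[OF m]) (auto intro!: sets_PiM_I_finite)
  also have "\<dots> = (\<Prod>j<n. emeasure G ((\<lambda>h. g + h) -` A j))"
    using A measurable_sets[OF m1] sets_G by (subst GP.emeasure_PiM) auto
  also have "\<dots> = (\<Prod>j<n. emeasure G (A j))"
  proof (rule prod.cong[OF refl])
    fix j assume "j \<in> {..<n}"
    then have "A j \<in> sets borel" using A sets_G by auto
    from emeasure_distr[OF m1 this] show "emeasure G ((\<lambda>h. g + h) -` A j) = emeasure G (A j)"
      by (simp add: G_invariant)
  qed
  finally show "emeasure (distr (GP n) (GP n) (translate n g)) (Pi\<^sub>E {..<n} A) = (\<Prod>j<n. emeasure G (A j))" .
qed auto

end

section \<open>Compatibility of the extension with translation and omission\<close>

context amenable_action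
begin

text \<open>Left invariance of the measure on G^n shifts the translation of the parameter onto the
  weight. What remains is a translated slice of \<open>f\<close>, to which equivariance of
  \<open>P\<close> applies.\<close>

lemma extends_translate:
  assumes f: "Q.bounded_fun n c f" and F: "Q.bounded_par n d F" and ext: "Q.extends n f F"
  shows "Q.extends n (\<lambda>(a, h, x). f (- g + a, translate n (- g) h, act (- g) x))
    (\<lambda>(h, x). F (translate n (- g) h, act (- g) x))"
  unfolding Q.extends_def
proof (intro allI impI)
  fix \<phi> :: "(nat \<Rightarrow> 'g) \<Rightarrow> real" assume \<phi>: "integrable (GP n) \<phi>"
  have [measurable]: "\<phi> \<in> borel_measurable (GP n)" using \<phi> by auto
  have [measurable]: "f \<in> borel_measurable (G \<Otimes>\<^sub>M GP n \<Otimes>\<^sub>M S)" "F \<in> borel_measurable (GP n \<Otimes>\<^sub>M S)"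
    using f F by (auto simp: Q.bounded_fun_def Q.bounded_par_def)
  have t: "translate n g \<in> GP n \<rightarrow>\<^sub>M GP n" by measurable
  define \<psi> where "\<psi> h = \<phi> (translate n g h)" for h
  have \<psi>: "integrable (GP n) \<psi>"
    unfolding \<psi>_def by (subst integrable_distr_eq[OF t, symmetric]) (use \<phi> in \<open>auto simp: distr_translate\<close>)
  have tr: "(\<integral>h. \<phi> h * u (translate n (- g) h) \<partial>GP n) = (\<integral>h. \<psi> h * u h \<partial>GP n)" if [measurable]: "u \<in> borel_measurable (GP n)" for u
  proof -
    have "(\<integral>h. \<phi> h * u (translate n (- g) h) \<partial>GP n) = (\<integral>h. \<phi> h * u (translate n (- g) h) \<partial>distr (GP n) (GP n) (translate n g))"
      by (simp add: distr_translate)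
    also have "\<dots> = (\<integral>h. \<phi> (translate n g h) * u (translate n (- g) (translate n g h)) \<partial>GP n)"
      by (rule integral_distr[OF t]) measurable
    also have "\<dots> = (\<integral>h. \<psi> h * u h \<partial>GP n)"
      by (intro Bochner_Integration.integral_cong) (auto simp: \<psi>_def translate_minus space_PiM PiE_iff)
    finally show ?thesis .
  qed
  let ?f = "\<lambda>(a, h, x). f (- g + a, translate n (- g) h, act (- g) x)"
  have s: "Q.slice n \<phi> ?f = (\<lambda>(a, x). \<integral>h. \<phi> h * f (- g + a, translate n (- g) h, act (- g) x) \<partial>GP n)"
    by (simp add: Q.slice_def)
  have bf: "Q.bounded_fun n c ?f"
    unfolding Q.bounded_fun_def
  proof
    show "?f \<in> borel_measurable (G \<Otimes>\<^sub>M GP n \<Otimes>\<^sub>M S)" by measurable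
    show "\<forall>z\<in>space (G \<Otimes>\<^sub>M GP n \<Otimes>\<^sub>M S). \<bar>?f z\<bar> \<le> c"
      using f by (auto simp: Q.bounded_fun_def space_pair_measure act_space space_PiM translate_def)
  qed
  have "Q.slice n \<phi> ?f z = (\<lambda>(h, y). Q.slice n \<psi> f (- g + h, act (- g) y)) z" if z: "z \<in> space (G \<Otimes>\<^sub>M S)" for z
  proof -
    obtain a x where [simp]: "z = (a, x)" "x \<in> space S" using z by (auto simp: space_pair_measure)
    have "(\<lambda>h. f (- g + a, h, act (- g) x)) \<in> borel_measurable (GP n)"
      using act_space[OF \<open>x \<in> space S\<close>, of "- g"] by measurable
    from tr[OF this] show ?thesis by (simp add: Q.slice_def)
  qed
  then have "AE x in S. P (Q.slice n \<phi> ?f) x = P (\<lambda>(h, y). Q.slice n \<psi> f (- g + h, act (- g) y)) x"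
    by (rule P_eqI[OF Q.slice_Linf[OF bf \<phi>]])
  moreover note P_equivariant[OF Q.slice_Linf[OF f \<psi>], of g]
  moreover note act_AE[OF ext[unfolded Q.extends_def, rule_format, OF \<psi>], of "- g"]
  moreover note AE_space[of S]
  ultimately show "AE x in S. P (Q.slice n \<phi> ?f) x = (\<integral>h. \<phi> h * (case (h, x) of (h, x) \<Rightarrow> F (translate n (- g) h, act (- g) x)) \<partial>GP n)"
  proof eventually_elim
    case (elim x)
    have "(\<lambda>h. F (h, act (- g) x)) \<in> borel_measurable (GP n)"
      using act_space[OF elim(4), of "- g"] by measurable
    from tr[OF this] elim show ?case by simp
  qed
qed

text \<open>The function does not see the omitted coordinate, which may therefore be integrated out
  of the weight first.\<close>

lemma extends_omit:
  assumes f: "Q.bounded_fun n c f" and F: "Q.bounded_par n d F" and ext: "Q.extends n f F" and i: "i \<le> n"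
  shows "Q.extends (Suc n) (\<lambda>(a, h, x). f (a, omit n i h, x)) (\<lambda>(h, x). F (omit n i h, x))"
  unfolding Q.extends_def
proof (intro allI impI)
  fix \<phi> :: "(nat \<Rightarrow> 'g) \<Rightarrow> real" assume \<phi>: "integrable (GP (Suc n)) \<phi>"
  have [measurable]: "\<phi> \<in> borel_measurable (GP (Suc n))" using \<phi> by auto
  have [measurable]: "f \<in> borel_measurable (G \<Otimes>\<^sub>M GP n \<Otimes>\<^sub>M S)" "F \<in> borel_measurable (GP n \<Otimes>\<^sub>M S)"
    using f F by (auto simp: Q.bounded_fun_def Q.bounded_par_def)
  note [measurable] = measurable_omit[OF i, of G]
  interpret I: pair_sigma_finite "GP n" G
    by (intro pair_sigma_finite.intro sigma_finite_GP G.sigma_finite_measure_axioms)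
  note t = measurable_insert_at[OF i, of G]
  note dt = distr_insert_at[OF G.sigma_finite_measure_axioms i]
  \<comment> \<open>The marginal of \<phi> along coordinate \<open>i\<close>.\<close>
  define \<psi> where "\<psi> h = (\<integral>b. \<phi> (insert_at n i h b) \<partial>G)" for h
  have i1: "integrable (GP n \<Otimes>\<^sub>M G) (\<lambda>p. \<phi> (case p of (h, b) \<Rightarrow> insert_at n i h b))"
    by (subst integrable_distr_eq[OF t, symmetric]) (use \<phi> in \<open>auto simp: dt\<close>)
  have \<psi>: "integrable (GP n) \<psi>"
    using I.integrable_fst[of "\<lambda>h b. \<phi> (insert_at n i h b)"] i1 unfolding \<psi>_def by (simp add: case_prod_unfold)
  have tr: "(\<integral>h. \<phi> h * u (omit n i h) \<partial>GP (Suc n)) = (\<integral>h. \<psi> h * u h \<partial>GP n)"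
    if m[measurable]: "u \<in> borel_measurable (GP n)" and b: "\<And>h. h \<in> space (GP n) \<Longrightarrow> \<bar>u h\<bar> \<le> e" for u e
  proof -
    have "(\<integral>h. \<phi> h * u (omit n i h) \<partial>GP (Suc n)) =
       (\<integral>h. \<phi> h * u (omit n i h) \<partial>distr (GP n \<Otimes>\<^sub>M G) (GP (Suc n)) (\<lambda>(h, b). insert_at n i h b))"
      by (simp add: dt)
    also have "\<dots> = (\<integral>p. \<phi> (case p of (h, b) \<Rightarrow> insert_at n i h b) * u (omit n i (case p of (h, b) \<Rightarrow> insert_at n i h b)) \<partial>(GP n \<Otimes>\<^sub>M G))"
      by (rule integral_distr[OF t]) measurable
    also have "\<dots> = (\<integral>(h, b). \<phi> (insert_at n i h b) * u h \<partial>(GP n \<Otimes>\<^sub>M G))"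
    proof (rule Bochner_Integration.integral_cong[OF refl])
      fix p assume "p \<in> space (GP n \<Otimes>\<^sub>M G)"
      then have "fst p \<in> extensional {..<n}" by (simp add: space_pair_measure space_PiM PiE_def mem_Times_iff)
      then have "omit n i (insert_at n i (fst p) (snd p)) = fst p" by (rule omit_insert_at[OF _ i])
      then show "\<phi> (case p of (h, b) \<Rightarrow> insert_at n i h b) * u (omit n i (case p of (h, b) \<Rightarrow> insert_at n i h b)) =
         (case p of (h, b) \<Rightarrow> \<phi> (insert_at n i h b) * u h)"
        by (simp add: case_prod_unfold)
    qed
    also have "\<dots> = (\<integral>h. (\<integral>b. \<phi> (insert_at n i h b) * u h \<partial>G) \<partial>GP n)"
    proof -
      have "integrable (GP n \<Otimes>\<^sub>M G) (\<lambda>p. \<phi> (case p of (h, b) \<Rightarrow> insert_at n i h b) * u (fst p))"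
        by (rule integrable_mult_bounded(1)[OF i1, of _ e]) (use b in \<open>auto simp: space_pair_measure\<close>)
      then have "integrable (GP n \<Otimes>\<^sub>M G) (\<lambda>(h, b). \<phi> (insert_at n i h b) * u h)"
        by (simp add: case_prod_unfold)
      then show ?thesis by (rule I.integral_fst[symmetric])
    qed
    also have "\<dots> = (\<integral>h. \<psi> h * u h \<partial>GP n)" by (simp add: \<psi>_def)
    finally show ?thesis .
  qed
  let ?f = "\<lambda>(a, h, x). f (a, omit n i h, x)"
  have bf: "Q.bounded_fun (Suc n) c ?f"
    unfolding Q.bounded_fun_def
  proof
    show "?f \<in> borel_measurable (G \<Otimes>\<^sub>M GP (Suc n) \<Otimes>\<^sub>M S)" by measurable
    show "\<forall>z\<in>space (G \<Otimes>\<^sub>M GP (Suc n) \<Otimes>\<^sub>M S). \<bar>?f z\<bar> \<le> c"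
      using f measurable_space[OF measurable_omit[OF i, of G]] by (auto simp: Q.bounded_fun_def space_pair_measure)
  qed
  have "Q.slice (Suc n) \<phi> ?f z = Q.slice n \<psi> f z" if z: "z \<in> space (G \<Otimes>\<^sub>M S)" for z
  proof -
    obtain a x where [simp]: "z = (a, x)" and x: "x \<in> space S" using z by (auto simp: space_pair_measure)
    have "(\<lambda>h. f (a, h, x)) \<in> borel_measurable (GP n)" using x by measurable
    moreover have "\<bar>f (a, h, x)\<bar> \<le> c" if "h \<in> space (GP n)" for h
      using f that x by (auto simp: Q.bounded_fun_def space_pair_measure)
    ultimately show ?thesis using tr[of "\<lambda>h. f (a, h, x)" c] by (simp add: Q.slice_def)
  qed
  then have "AE x in S. P (Q.slice (Suc n) \<phi> ?f) x = P (Q.slice n \<psi> f) x"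
    by (rule P_eqI[OF Q.slice_Linf[OF bf \<phi>]])
  moreover note ext[unfolded Q.extends_def, rule_format, OF \<psi>]
  moreover note AE_space[of S]
  ultimately show "AE x in S. P (Q.slice (Suc n) \<phi> ?f) x = (\<integral>h. \<phi> h * (case (h, x) of (h, x) \<Rightarrow> F (omit n i h, x)) \<partial>GP (Suc n))"
  proof eventually_elim
    case (elim x)
    have "(\<lambda>h. F (h, x)) \<in> borel_measurable (GP n)" using elim(3) by measurable
    moreover have "\<bar>F (h, x)\<bar> \<le> d" if "h \<in> space (GP n)" for h
      using F that elim(3) by (auto simp: Q.bounded_par_def space_pair_measure)
    ultimately show ?case using tr[of "\<lambda>h. F (h, x)" d] elim by simp
  qed
qed

text \<open>Omission need not preserve measure, as Haar measure may be infinite, but by Fubini the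
  preimage of a null set is null.\<close>

lemma AE_omit:
  assumes i: "i \<le> n" and Q: "AE z in GP n \<Otimes>\<^sub>M S. R z"
  shows "AE z in GP (Suc n) \<Otimes>\<^sub>M S. R (omit n i (fst z), snd z)"
proof (rule nonsingular_AE[OF _ _ Q])
  note [measurable] = measurable_omit[OF i, of G]
  show "(\<lambda>z. (omit n i (fst z), snd z)) \<in> GP (Suc n) \<Otimes>\<^sub>M S \<rightarrow>\<^sub>M GP n \<Otimes>\<^sub>M S" by measurable
  fix X assume X: "X \<in> null_sets (GP n \<Otimes>\<^sub>M S)"
  have [measurable]: "X \<in> sets (GP n \<Otimes>\<^sub>M S)" using X by auto
  interpret I: pair_sigma_finite "GP n" G
    by (intro pair_sigma_finite.intro sigma_finite_GP G.sigma_finite_measure_axioms)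
  have "AE z in GP n \<Otimes>\<^sub>M S. z \<notin> X" using X by (rule AE_not_in)
  then have 1: "AE h in GP n. AE x in S. (h, x) \<notin> X" by (rule Q.HS.AE_pair)
  have "AE h in GP (Suc n). AE x in S. (omit n i h, x) \<notin> X"
  proof (rule nonsingular_AE[OF _ _ 1])
    show "omit n i \<in> GP (Suc n) \<rightarrow>\<^sub>M GP n" by measurable
    fix Y assume Y: "Y \<in> null_sets (GP n)"
    have "AE p in GP n \<Otimes>\<^sub>M G. fst p \<notin> Y" using Y by (intro I.AE_pair_fst AE_not_in)
    then have "AE p in GP n \<Otimes>\<^sub>M G. omit n i (case p of (h, b) \<Rightarrow> insert_at n i h b) \<notin> Y"
      using AE_space
    proof eventually_elim
      case (elim p)
      then have "fst p \<in> extensional {..<n}" by (simp add: space_pair_measure space_PiM PiE_def mem_Times_iff)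
      then have "omit n i (insert_at n i (fst p) (snd p)) = fst p" by (rule omit_insert_at[OF _ i])
      then show ?case using elim by (simp add: case_prod_unfold)
    qed
    then have "AE h in distr (GP n \<Otimes>\<^sub>M G) (GP (Suc n)) (\<lambda>(h, b). insert_at n i h b). omit n i h \<notin> Y"
      using Y by (subst AE_distr_iff[OF measurable_insert_at[OF i]]) (auto simp: case_prod_unfold)
    then show "AE h in GP (Suc n). omit n i h \<notin> Y" by (simp only: distr_insert_at[OF G.sigma_finite_measure_axioms i])
  qed
  then show "AE z in GP (Suc n) \<Otimes>\<^sub>M S. (omit n i (fst z), snd z) \<notin> X"
    by (intro Q.HS.AE_pair_measure) auto
qed

text \<open>The inserted variable is moved in front of the others, the order in which the extension
  takes its arguments.\<close>

lemma AE_insert_at: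
  assumes i: "i \<le> n" and Q: "AE z in GP (Suc n) \<Otimes>\<^sub>M S. R z"
  shows "AE (a, h, x) in G \<Otimes>\<^sub>M GP n \<Otimes>\<^sub>M S. R (insert_at n i h a, x)"
proof -
  have m[measurable]: "(\<lambda>p. insert_at n i (fst p) (snd p)) \<in> GP n \<Otimes>\<^sub>M G \<rightarrow>\<^sub>M GP (Suc n)"
    using measurable_insert_at[OF i, of G] by (simp add: case_prod_unfold)
  have m'[measurable (raw)]: "f \<in> M \<rightarrow>\<^sub>M GP n \<Longrightarrow> k \<in> M \<rightarrow>\<^sub>M G \<Longrightarrow> (\<lambda>x. insert_at n i (f x) (k x)) \<in> M \<rightarrow>\<^sub>M GP (Suc n)" for M :: "'z measure" and f k
    using measurable_compose[OF measurable_Pair m, of f M k] by simp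
  let ?T = "\<lambda>(a, h, x). (insert_at n i h a, x)"
  have "AE z in G \<Otimes>\<^sub>M GP n \<Otimes>\<^sub>M S. R (?T z)"
  proof (rule nonsingular_AE[OF _ _ Q])
    show "?T \<in> G \<Otimes>\<^sub>M GP n \<Otimes>\<^sub>M S \<rightarrow>\<^sub>M GP (Suc n) \<Otimes>\<^sub>M S" by measurable
    fix X assume X: "X \<in> null_sets (GP (Suc n) \<Otimes>\<^sub>M S)"
    have [measurable]: "X \<in> sets (GP (Suc n) \<Otimes>\<^sub>M S)" using X by auto
    interpret I: pair_sigma_finite "GP n" G
      by (intro pair_sigma_finite.intro sigma_finite_GP G.sigma_finite_measure_axioms)
    have "AE z in GP (Suc n) \<Otimes>\<^sub>M S. z \<notin> X" using X by (rule AE_not_in)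
    then have "AE h in GP (Suc n). AE x in S. (h, x) \<notin> X" by (rule Q.HS.AE_pair)
    then have "AE h in distr (GP n \<Otimes>\<^sub>M G) (GP (Suc n)) (\<lambda>(h, b). insert_at n i h b). AE x in S. (h, x) \<notin> X"
      by (simp only: distr_insert_at[OF G.sigma_finite_measure_axioms i])
    from AE_distrD[OF measurable_insert_at[OF i] this]
    have 1: "AE p in GP n \<Otimes>\<^sub>M G. AE x in S. (insert_at n i (fst p) (snd p), x) \<notin> X"
      by (simp add: case_prod_unfold)
    from I.AE_pair[OF 1] have "AE h in GP n. AE a in G. AE x in S. (insert_at n i h a, x) \<notin> X"
      by simp
    then have "AE a in G. AE h in GP n. AE x in S. (insert_at n i h a, x) \<notin> X"
    proof (subst (asm) I.AE_commute)
      \<comment> \<open>Exchanging the quantifiers needs a measurable set. Expressing the inner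
        statement by the measure of a section of \<open>X\<close> provides it.\<close>
      have "{p \<in> space (GP n \<Otimes>\<^sub>M G). AE x in S. (insert_at n i (fst p) (snd p), x) \<notin> X} =
          {p \<in> space (GP n \<Otimes>\<^sub>M G). emeasure S {x \<in> space S. (insert_at n i (fst p) (snd p), x) \<in> X} = 0}"
        by (intro Collect_cong conj_cong refl, subst AE_iff_measurable[OF _ refl]) auto
      also have "\<dots> \<in> sets (GP n \<Otimes>\<^sub>M G)" by measurable
      finally show "{p \<in> space (GP n \<Otimes>\<^sub>M G). AE x in S. (insert_at n i (fst p) (snd p), x) \<notin> X} \<in> sets (GP n \<Otimes>\<^sub>M G)" .
    qed
    then have "AE a in G. AE z in GP n \<Otimes>\<^sub>M S. (insert_at n i (fst z) a, snd z) \<notin> X"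
    proof eventually_elim
      case (elim a)
      have [measurable]: "a \<in> space G" by simp
      show ?case using elim by (intro Q.HS.AE_pair_measure) auto
    qed
    then show "AE z in G \<Otimes>\<^sub>M GP n \<Otimes>\<^sub>M S. ?T z \<notin> X"
      by (intro Q.G_HS.AE_pair_measure) (auto simp: case_prod_unfold)
  qed
  then show ?thesis by (simp add: case_prod_unfold)
qed

end

section \<open>The contracting homotopy\<close>

lemma weak_bounded_compose:
  fixes r :: "'v::real_normed_vector \<Rightarrow>\<^sub>L 'v"
  assumes "weak_bounded M c f" and r: "\<And>v. norm (blinfun_apply r v) = norm v"
  shows "weak_bounded M c (\<lambda>t. f t o\<^sub>L r)"
  unfolding weak_bounded_def
proof (intro conjI ballI allI)
  show "(\<lambda>t. blinfun_apply (f t o\<^sub>L r) v) \<in> borel_measurable M" for v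
    using assms by (auto simp: weak_bounded_def)
  fix t assume "t \<in> space M"
  then have c: "norm (f t) \<le> c" using assms by (auto simp: weak_bounded_def)
  show "norm (f t o\<^sub>L r) \<le> c"
  proof (rule norm_blinfun_bound)
    show "0 \<le> c" using c norm_ge_zero order_trans by blast
    fix v
    have "norm (blinfun_apply (f t) (blinfun_apply r v)) \<le> norm (f t) * norm (blinfun_apply r v)" by (rule norm_blinfun)
    also have "\<dots> \<le> c * norm v" using c by (auto simp: r intro!: mult_right_mono)
    finally show "norm (blinfun_apply (f t o\<^sub>L r) v) \<le> c * norm v" by simp
  qed
qed

context amenable_action
begin

lemma weak_extends_translate:
  fixes r :: "'v::real_normed_vector \<Rightarrow>\<^sub>L 'v"
  assumes f: "weak_bounded (G \<Otimes>\<^sub>M GP n \<Otimes>\<^sub>M S) c f" and F: "weak_bounded (GP n \<Otimes>\<^sub>M S) d F" and ext: "Q.weak_extends n f F"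
  shows "Q.weak_extends n (\<lambda>(a, h, x). f (- g + a, translate n (- g) h, act (- g) x) o\<^sub>L r)
    (\<lambda>(h, x). F (translate n (- g) h, act (- g) x) o\<^sub>L r)"
  unfolding Q.weak_extends_def
proof
  fix v
  have "Q.extends n (\<lambda>z. blinfun_apply (f z) (blinfun_apply r v)) (\<lambda>z. blinfun_apply (F z) (blinfun_apply r v))"
    using ext by (simp add: Q.weak_extends_def)
  from extends_translate[OF Q.weak_bounded_fun[OF f] Q.weak_bounded_par[OF F] this, of g]
  show "Q.extends n (\<lambda>z. blinfun_apply (case z of (a, h, x) \<Rightarrow> f (- g + a, translate n (- g) h, act (- g) x) o\<^sub>L r) v)
     (\<lambda>z. blinfun_apply (case z of (h, x) \<Rightarrow> F (translate n (- g) h, act (- g) x) o\<^sub>L r) v)"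
    by (simp add: case_prod_unfold)
qed

lemma weak_extends_omit:
  assumes f: "weak_bounded (G \<Otimes>\<^sub>M GP n \<Otimes>\<^sub>M S) c f" and F: "weak_bounded (GP n \<Otimes>\<^sub>M S) d F" and ext: "Q.weak_extends n f F"
    and i: "i \<le> n"
  shows "Q.weak_extends (Suc n) (\<lambda>(a, h, x). f (a, omit n i h, x)) (\<lambda>(h, x). F (omit n i h, x))"
  unfolding Q.weak_extends_def
proof
  fix v
  have "Q.extends n (\<lambda>z. blinfun_apply (f z) v) (\<lambda>z. blinfun_apply (F z) v)"
    using ext by (simp add: Q.weak_extends_def)
  from extends_omit[OF Q.weak_bounded_fun[OF f] Q.weak_bounded_par[OF F] this i]
  show "Q.extends (Suc n) (\<lambda>z. blinfun_apply (case z of (a, h, x) \<Rightarrow> f (a, omit n i h, x)) v)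
     (\<lambda>z. blinfun_apply (case z of (h, x) \<Rightarrow> F (omit n i h, x)) v)"
    by (simp add: case_prod_unfold)
qed

lemma measurable_insert_last: "(\<lambda>(a, h, x). (insert_at n n h a, x)) \<in> G \<Otimes>\<^sub>M GP n \<Otimes>\<^sub>M S \<rightarrow>\<^sub>M GP (Suc n) \<Otimes>\<^sub>M S"
proof -
  have "(\<lambda>z. case (fst (snd z), fst z) of (h, b) \<Rightarrow> insert_at n n h b) \<in> G \<Otimes>\<^sub>M GP n \<Otimes>\<^sub>M S \<rightarrow>\<^sub>M GP (Suc n)"
    by (rule measurable_compose[OF _ measurable_insert_at[OF order_refl]]) measurable
  then have "(\<lambda>z. (insert_at n n (fst (snd z)) (fst z), snd (snd z))) \<in> G \<Otimes>\<^sub>M GP n \<Otimes>\<^sub>M S \<rightarrow>\<^sub>M GP (Suc n) \<Otimes>\<^sub>M S"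
    by (intro measurable_Pair) (auto simp: case_prod_unfold)
  then show ?thesis by (simp add: case_prod_unfold)
qed

text \<open>The homotopy averages the last coordinate. All other coordinates are mere parameters for the
  averaging, which therefore commutes with the omission of any of them.\<close>

theorem cocycle_is_coboundary:
  fixes U :: "(nat \<Rightarrow> 'g) \<times> 's \<Rightarrow> ('v::{real_normed_vector, second_countable_topology} \<Rightarrow>\<^sub>L real)"
  assumes U: "weak_bounded (GP (Suc n) \<Otimes>\<^sub>M S) c U" and c: "0 \<le> c"
    and cocycle: "AE z in GP (Suc (Suc n)) \<Otimes>\<^sub>M S. (\<Sum>i\<le>Suc n. (-1) ^ i *\<^sub>R U (omit (Suc n) i (fst z), snd z)) = 0"
  obtains W where "weak_bounded (GP n \<Otimes>\<^sub>M S) c W"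
    "AE z in GP (Suc n) \<Otimes>\<^sub>M S. (\<Sum>i\<le>n. (-1) ^ i *\<^sub>R W (omit n i (fst z), snd z)) = U z"
    "\<And>g r. (\<And>v. norm (blinfun_apply r v) = norm v) \<Longrightarrow>
       AE z in GP (Suc n) \<Otimes>\<^sub>M S. U (translate (Suc n) (- g) (fst z), act (- g) (snd z)) o\<^sub>L r = U z \<Longrightarrow>
       AE z in GP n \<Otimes>\<^sub>M S. W (translate n (- g) (fst z), act (- g) (snd z)) o\<^sub>L r = W z"
proof -
  \<comment> \<open>The last coordinate becomes the variable to be averaged; the first n coordinates
    are the parameter.\<close>
  define f where "f = (\<lambda>(a, h, x). U (insert_at n n h a, x))"
  have f: "weak_bounded (G \<Otimes>\<^sub>M GP n \<Otimes>\<^sub>M S) c f"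
    using weak_bounded_comp[OF U measurable_insert_last] by (simp add: f_def case_prod_unfold)
  obtain F where F: "weak_bounded (GP n \<Otimes>\<^sub>M S) c F" and ext: "Q.weak_extends n f F"
    using Q.exists_weak_extension[OF f c] .
  \<comment> \<open>The sign compensates the factor (-1)^n that the cocycle identity produces
    below.\<close>
  define W where "W z = (-1) ^ n *\<^sub>R F z" for z
  have m1: "(\<lambda>(a, h, x). (a, omit n i h, x)) \<in> G \<Otimes>\<^sub>M GP (Suc n) \<Otimes>\<^sub>M S \<rightarrow>\<^sub>M G \<Otimes>\<^sub>M GP n \<Otimes>\<^sub>M S"
    and m2: "(\<lambda>(h, x). (omit n i h, x)) \<in> GP (Suc n) \<Otimes>\<^sub>M S \<rightarrow>\<^sub>M GP n \<Otimes>\<^sub>M S" if "i \<le> n" for i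
    using measurable_omit[OF that, of G] by auto
  have m3: "snd \<in> G \<Otimes>\<^sub>M GP (Suc n) \<Otimes>\<^sub>M S \<rightarrow>\<^sub>M GP (Suc n) \<Otimes>\<^sub>M S" by measurable
  define fi where "fi i = (\<lambda>(a, h, x). f (a, omit n i h, x))" for i
  define Fi where "Fi i = (\<lambda>(h, x). F (omit n i h, x))" for i
  have fi: "weak_bounded (G \<Otimes>\<^sub>M GP (Suc n) \<Otimes>\<^sub>M S) c (fi i)" if "i \<le> n" for i
    using weak_bounded_comp[OF f m1[OF that]] by (simp add: fi_def case_prod_unfold)
  have Fi: "weak_bounded (GP (Suc n) \<Otimes>\<^sub>M S) c (Fi i)" if "i \<le> n" for i
    using weak_bounded_comp[OF F m2[OF that]] by (simp add: Fi_def case_prod_unfold)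
  have exti: "Q.weak_extends (Suc n) (fi i) (Fi i)" if "i \<le> n" for i
    unfolding fi_def Fi_def by (rule weak_extends_omit[OF f F ext that])
  define s where "s z = (\<Sum>i\<le>n. (-1) ^ i *\<^sub>R fi i z)" for z
  define t where "t z = (\<Sum>i\<le>n. (-1) ^ i *\<^sub>R Fi i z)" for z
  have sfi: "weak_bounded (G \<Otimes>\<^sub>M GP (Suc n) \<Otimes>\<^sub>M S) c (\<lambda>z. (-1) ^ i *\<^sub>R fi i z)" if "i \<le> n" for i
    using weak_bounded_scaleR[OF fi[OF that], of "(-1) ^ i"] by simp
  have sFi: "weak_bounded (GP (Suc n) \<Otimes>\<^sub>M S) c (\<lambda>z. (-1) ^ i *\<^sub>R Fi i z)" if "i \<le> n" for i
    using weak_bounded_scaleR[OF Fi[OF that], of "(-1) ^ i"] by simp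
  have s: "weak_bounded (G \<Otimes>\<^sub>M GP (Suc n) \<Otimes>\<^sub>M S) (\<Sum>i\<le>n. c) s"
    unfolding s_def by (intro weak_bounded_sum sfi) auto
  have t: "weak_bounded (GP (Suc n) \<Otimes>\<^sub>M S) (\<Sum>i\<le>n. c) t"
    unfolding t_def by (intro weak_bounded_sum sFi) auto
  have st: "Q.weak_extends (Suc n) s t"
    unfolding s_def t_def
    by (rule Q.weak_extends_sum[of _ _ "\<lambda>_. c" _ "\<lambda>_. c"])
       (auto intro!: sfi sFi Q.weak_extends_scaleR[OF fi Fi exti])
  define U' where "U' z = (-1) ^ n *\<^sub>R U z" for z
  have U': "weak_bounded (GP (Suc n) \<Otimes>\<^sub>M S) (\<bar>(-1) ^ n\<bar> * c) U'"
    unfolding U'_def by (rule weak_bounded_scaleR[OF U])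
  \<comment> \<open>In the cocycle identity for (h, a) the terms i \<le> n keep \<open>a\<close> and
    form \<open>s\<close>. The term i = n + 1 omits \<open>a\<close> and equals (-1)^(n+1) U. Hence
    \<open>s\<close> is (-1)^n U, which does not involve \<open>a\<close>.\<close>
  have "AE (a, h, x) in G \<Otimes>\<^sub>M GP (Suc n) \<Otimes>\<^sub>M S.
      (\<Sum>i\<le>Suc n. (-1) ^ i *\<^sub>R U (omit (Suc n) i (insert_at (Suc n) (Suc n) h a), x)) = 0"
    using AE_insert_at[OF order_refl cocycle] by simp
  then have "AE z in G \<Otimes>\<^sub>M GP (Suc n) \<Otimes>\<^sub>M S. s z = (\<lambda>(a, z). U' z) z"
    using AE_space
  proof eventually_elim
    case (elim z)
    obtain a h x where z: "z = (a, h, x)" by (cases z)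
    have h: "h \<in> extensional {..<Suc n}" using elim(2) by (simp add: z space_pair_measure space_PiM PiE_def)
    have "(\<Sum>i\<le>n. (-1) ^ i *\<^sub>R U (omit (Suc n) i (insert_at (Suc n) (Suc n) h a), x)) = s z"
      unfolding s_def by (rule sum.cong) (auto simp: fi_def f_def z omit_insert_last)
    then show ?case using elim(1) by (simp add: z omit_insert_at[OF h order_refl] U'_def)
  qed
  from Q.weak_extends_cong_AE[OF s _ this st] weak_bounded_comp[OF U' m3]
  have "Q.weak_extends (Suc n) (\<lambda>(a, z). U' z) t" by (simp add: case_prod_unfold)
  \<comment> \<open>Averaging \<open>s\<close> term by term gives \<open>t\<close>, while averaging
    a function independent of \<open>a\<close> changes nothing.\<close>
  from Q.weak_extends_unique[OF t U' this Q.weak_extends_snd[OF U']]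
  have cob: "AE z in GP (Suc n) \<Otimes>\<^sub>M S. t z = U' z" .
  show ?thesis
  proof (rule that)
    show W: "weak_bounded (GP n \<Otimes>\<^sub>M S) c W"
      using weak_bounded_scaleR[OF F, of "(-1) ^ n"] by (simp add: W_def[abs_def])
    show "AE z in GP (Suc n) \<Otimes>\<^sub>M S. (\<Sum>i\<le>n. (-1) ^ i *\<^sub>R W (omit n i (fst z), snd z)) = U z"
      using cob
    proof eventually_elim
      case (elim z)
      have "(\<Sum>i\<le>n. (-1) ^ i *\<^sub>R W (omit n i (fst z), snd z)) = (-1) ^ n *\<^sub>R t z"
        by (simp add: W_def t_def Fi_def scaleR_sum_right case_prod_unfold mult.commute)
      also have "\<dots> = U z" by (simp add: elim U'_def flip: power_add mult_2)
      finally show ?case .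
    qed
    fix g and r :: "'v \<Rightarrow>\<^sub>L 'v" assume r: "\<And>v. norm (blinfun_apply r v) = norm v"
      and inv: "AE z in GP (Suc n) \<Otimes>\<^sub>M S. U (translate (Suc n) (- g) (fst z), act (- g) (snd z)) o\<^sub>L r = U z"
    \<comment> \<open>For this one g, the transformed \<open>F'\<close> extends the transformed
      \<open>f'\<close>. As \<open>f'\<close> is almost everywhere \<open>f\<close>, uniqueness
      makes \<open>F'\<close> almost everywhere \<open>F\<close>.\<close>
    define f' where "f' = (\<lambda>(a, h, x). f (- g + a, translate n (- g) h, act (- g) x) o\<^sub>L r)"
    define F' where "F' = (\<lambda>(h, x). F (translate n (- g) h, act (- g) x) o\<^sub>L r)"
    have ext': "Q.weak_extends n f' F'"
      unfolding f'_def F'_def by (rule weak_extends_translate[OF f F ext])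
    have t1: "(\<lambda>(a, h, x). (- g + a, translate n (- g) h, act (- g) x)) \<in> G \<Otimes>\<^sub>M GP n \<Otimes>\<^sub>M S \<rightarrow>\<^sub>M G \<Otimes>\<^sub>M GP n \<Otimes>\<^sub>M S"
    proof -
      have "(\<lambda>z. - g + fst z) \<in> G \<Otimes>\<^sub>M GP n \<Otimes>\<^sub>M S \<rightarrow>\<^sub>M borel" by measurable
      then have "(\<lambda>z. - g + fst z) \<in> G \<Otimes>\<^sub>M GP n \<Otimes>\<^sub>M S \<rightarrow>\<^sub>M G" by (simp add: measurable_cong_sets[OF refl sets_G])
      moreover have "(\<lambda>z. (translate n (- g) (fst (snd z)), act (- g) (snd (snd z)))) \<in> G \<Otimes>\<^sub>M GP n \<Otimes>\<^sub>M S \<rightarrow>\<^sub>M GP n \<Otimes>\<^sub>M S"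
        by measurable
      ultimately show ?thesis unfolding case_prod_unfold by (rule measurable_Pair)
    qed
    have t2: "(\<lambda>(h, x). (translate n (- g) h, act (- g) x)) \<in> GP n \<Otimes>\<^sub>M S \<rightarrow>\<^sub>M GP n \<Otimes>\<^sub>M S" by measurable
    have f': "weak_bounded (G \<Otimes>\<^sub>M GP n \<Otimes>\<^sub>M S) c f'"
      using weak_bounded_compose[OF weak_bounded_comp[OF f t1] r] by (simp add: f'_def case_prod_unfold)
    have F': "weak_bounded (GP n \<Otimes>\<^sub>M S) c F'"
      using weak_bounded_compose[OF weak_bounded_comp[OF F t2] r] by (simp add: F'_def case_prod_unfold)
    have "AE z in G \<Otimes>\<^sub>M GP n \<Otimes>\<^sub>M S. f' z = f z"
      using AE_insert_at[OF order_refl inv]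
      by eventually_elim (simp add: f'_def f_def case_prod_unfold translate_insert_at)
    from Q.weak_extends_cong_AE[OF f' f this ext'] have "Q.weak_extends n f F'" .
    from Q.weak_extends_unique[OF F' F this ext]
    show "AE z in GP n \<Otimes>\<^sub>M S. W (translate n (- g) (fst z), act (- g) (snd z)) o\<^sub>L r = W z"
    proof eventually_elim
      case (elim z)
      have "W (translate n (- g) (fst z), act (- g) (snd z)) o\<^sub>L r = (-1) ^ n *\<^sub>R F' z"
        by (intro blinfun_eqI) (simp add: W_def F'_def case_prod_unfold blinfun.scaleR_left)
      then show ?case by (simp add: elim W_def)
    qed
  qed
qed

end

section \<open>The measure class of the fibre powers\<close>

text \<open>Closing a countable basis under finite intersections, the empty one included, keeps it
  countable. Equality of two finite measures then depends on countably many sets, so it can be shown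
  for almost every x at once.\<close>

lemma countable_Int_stable_generator:
  obtains B :: "'a::second_countable_topology set set"
  where "countable B" "Int_stable B" "UNIV \<in> B" "sets borel = sigma_sets UNIV B"
proof -
  obtain B0 :: "'a set set" where B0: "countable B0" "topological_basis B0" using ex_countable_basis by auto
  define B where "B = Inter ` {b. finite b \<and> b \<subseteq> B0}"
  have "countable B" unfolding B_def by (intro countable_image countable_Collect_finite_subset B0)
  moreover have "Int_stable B"
  proof (rule Int_stableI)
    fix a b assume "a \<in> B" "b \<in> B"
    then obtain a' b' where "a = \<Inter>a'" "finite a'" "a' \<subseteq> B0" "b = \<Inter>b'" "finite b'" "b' \<subseteq> B0"
      by (auto simp: B_def)
    then show "a \<inter> b \<in> B" unfolding B_def by (intro image_eqI[of _ _ "a' \<union> b'"]) auto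
  qed
  moreover have "UNIV \<in> B" unfolding B_def by (intro image_eqI[of _ _ "{}"]) auto
  moreover have "sets borel = sigma_sets UNIV B"
  proof -
    have 1: "sets borel = sigma_sets UNIV B0"
      by (subst borel_eq_countable_basis[OF B0], subst sets_measure_of) auto
    have "B0 \<subseteq> B"
    proof
      fix b assume "b \<in> B0" then show "b \<in> B" unfolding B_def by (intro image_eqI[of _ _ "{b}"]) auto
    qed
    moreover have "B \<subseteq> sets borel"
    proof
      fix X assume "X \<in> B"
      then obtain b where "X = \<Inter>b" "finite b" "b \<subseteq> B0" by (auto simp: B_def)
      then have "open X" using topological_basis_open[OF B0(2)] by (auto intro!: open_Inter)
      then show "X \<in> sets borel" by simp
    qed
    then have "sigma_sets UNIV B \<subseteq> sets borel"
      using sets.sigma_sets_subset[of B borel] by simp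
    ultimately show ?thesis using 1 sigma_sets_mono'[of B0 B UNIV] by auto
  qed
  ultimately show ?thesis using that by blast
qed

text \<open>Local compactness covers the group by open sets inside compact ones, which have finite
  measure; by second countability countably many suffice.\<close>

lemma left_haar_measure_sigma_finite:
  fixes m :: "'g::{topological_group_add, t2_space, second_countable_topology} measure"
  assumes m: "left_haar_measure m" and lc: "locally_compact_space (euclidean :: 'g topology)"
  shows "sigma_finite_measure m"
proof -
  have sets: "sets m = sets borel" and fin: "compact K \<Longrightarrow> emeasure m K < \<infinity>" for K using m by (auto simp: left_haar_measure_def)
  define \<F> where "\<F> = {U :: 'g set. open U \<and> emeasure m U < \<infinity>}"
  have "x \<in> \<Union>\<F>" for x
  proof -
    have "\<exists>U K. openin euclidean U \<and> compactin euclidean K \<and> x \<in> U \<and> U \<subseteq> K"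
      using lc unfolding locally_compact_space_def by (rule bspec) simp
    then obtain U K where "open U" "compact K" "x \<in> U" "U \<subseteq> K" by auto
    moreover have "emeasure m U \<le> emeasure m K"
      using calculation sets by (intro emeasure_mono) (auto simp: compact_imp_closed)
    ultimately show ?thesis using fin[of K] by (auto simp: \<F>_def intro: le_less_trans)
  qed
  moreover obtain \<F>' where "\<F>' \<subseteq> \<F>" "countable \<F>'" "\<Union>\<F>' = \<Union>\<F>"
    using Lindelof[of \<F>] by (auto simp: \<F>_def)
  ultimately show ?thesis
    using sets sets_eq_imp_space_eq[OF sets] unfolding sigma_finite_measure_def
    by (intro exI[of _ \<F>']) (auto simp: \<F>_def less_top subset_eq)
qed

lemma AE_cong_null_sets:
  assumes "null_sets M = null_sets N" "sets M = sets N"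
  shows "(AE x in M. Q x) \<longleftrightarrow> (AE x in N. Q x)"
  unfolding eventually_ae_filter assms(1) sets_eq_imp_space_eq[OF assms(2)] ..

lemma null_sets_iff_AE: "X \<in> sets M \<Longrightarrow> X \<in> null_sets M \<longleftrightarrow> (AE x in M. x \<notin> X)"
  using AE_iff_null_sets by blast

text \<open>By Fubini, being null in a product is decided on sections, hence by the null sets of the
  second factor.\<close>

lemma null_sets_pair_cong:
  assumes A: "sigma_finite_measure A" and M: "sigma_finite_measure M" and N: "sigma_finite_measure N"
    and s: "sets M = sets N" and n: "null_sets M = null_sets N"
  shows "null_sets (A \<Otimes>\<^sub>M M) = null_sets (A \<Otimes>\<^sub>M N)"
proof -
  interpret AM: pair_sigma_finite A M using A M by (rule pair_sigma_finite.intro)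
  interpret AN: pair_sigma_finite A N using A N by (rule pair_sigma_finite.intro)
  have s2: "sets (A \<Otimes>\<^sub>M M) = sets (A \<Otimes>\<^sub>M N)" by (intro sets_pair_measure_cong s refl)
  have "X \<in> null_sets (A \<Otimes>\<^sub>M M) \<longleftrightarrow> X \<in> null_sets (A \<Otimes>\<^sub>M N)" if X: "X \<in> sets (A \<Otimes>\<^sub>M M)" for X
  proof -
    have X': "X \<in> sets (A \<Otimes>\<^sub>M N)" using X s2 by simp
    have "(AE z in A \<Otimes>\<^sub>M M. z \<notin> X) \<longleftrightarrow> (AE a in A. AE x in M. (a, x) \<notin> X)"
      using AM.AE_pair_iff[of "\<lambda>a x. (a, x) \<notin> X"] X by simp
    also have "\<dots> \<longleftrightarrow> (AE a in A. AE x in N. (a, x) \<notin> X)" unfolding AE_cong_null_sets[OF n s] ..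
    also have "\<dots> \<longleftrightarrow> (AE z in A \<Otimes>\<^sub>M N. z \<notin> X)"
      using AN.AE_pair_iff[of "\<lambda>a x. (a, x) \<notin> X"] X' by simp
    finally show ?thesis using X X' by (simp add: null_sets_iff_AE)
  qed
  then show ?thesis using s2 by (auto simp: null_sets_def)
qed

section \<open>Shear coordinates on the semidirect groupoid\<close>

locale semidirect_setting =
  fixes haar :: "'g::{topological_group_add, t2_space, second_countable_topology} measure"
    and \<mu> :: "'s measure" and act :: "'g \<Rightarrow> 's \<Rightarrow> 's" and \<nu> :: "('g \<times> 's) measure" and \<kappa> :: "'s \<Rightarrow> ('g \<times> 's) measure"
  assumes locally_compact: "locally_compact_space (euclidean :: 'g topology)"
    and haar: "left_haar_measure haar"
    and G_space: "G_space \<mu> act"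
    and symmetric: "symmetric_probability (semidirect_groupoid haar \<mu> act) \<nu>"
    and disintegration: "target_disintegration (semidirect_groupoid haar \<mu> act) \<nu> \<kappa>"
begin

abbreviation \<G> where "\<G> \<equiv> semidirect_groupoid haar \<mu> act"

lemma groupoid_simps[simp]:
  "arrows \<G> = haar \<Otimes>\<^sub>M \<mu>" "units \<G> = \<mu>" "src \<G> p = snd p" "tgt \<G> p = act (fst p) (snd p)"
  "gmult \<G> p q = (fst p + fst q, snd q)" "ginv \<G> p = (- fst p, act (fst p) (snd p))"
  by (simp_all add: semidirect_groupoid_def case_prod_unfold)

sublocale haar: sigma_finite_measure haar
  using left_haar_measure_sigma_finite[OF haar locally_compact] .

sublocale \<mu>: sigma_finite_measure \<mu> using G_space by (auto simp: G_space_def)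

sublocale haar_\<mu>: pair_sigma_finite haar \<mu> ..

sublocale \<nu>: prob_space \<nu> using symmetric by (auto simp: symmetric_probability_def)

lemma sets_haar[measurable_cong]: "sets haar = sets borel" using haar by (auto simp: left_haar_measure_def)

lemma space_haar[simp]: "space haar = UNIV" using sets_eq_imp_space_eq[OF sets_haar] by simp

lemma haar_UNIV: "emeasure haar UNIV > 0" using haar unfolding left_haar_measure_def by blast

lemma sets_\<nu>[measurable_cong]: "sets \<nu> = sets (haar \<Otimes>\<^sub>M \<mu>)" and null_sets_\<nu>: "null_sets \<nu> = null_sets (haar \<Otimes>\<^sub>M \<mu>)"
  using symmetric by (auto simp: symmetric_probability_def)

lemma act_measurable: "(\<lambda>(g, x). act g x) \<in> borel \<Otimes>\<^sub>M \<mu> \<rightarrow>\<^sub>M \<mu>"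
  using G_space by (auto simp: G_space_def)

lemma act_measurable'[measurable (raw)]:
  "f \<in> M \<rightarrow>\<^sub>M borel \<Longrightarrow> g \<in> M \<rightarrow>\<^sub>M \<mu> \<Longrightarrow> (\<lambda>x. act (f x) (g x)) \<in> M \<rightarrow>\<^sub>M \<mu>"
  using measurable_compose[OF measurable_Pair act_measurable, of f M g] by simp

lemma uminus_measurable[measurable]: "(uminus :: 'g \<Rightarrow> 'g) \<in> borel \<rightarrow>\<^sub>M borel"
  by (intro borel_measurable_continuous_onI continuous_intros)

lemma act_zero: "x \<in> space \<mu> \<Longrightarrow> act 0 x = x"
  and act_add: "x \<in> space \<mu> \<Longrightarrow> act (g + h) x = act g (act h x)"
  and act_null: "null_sets (distr \<mu> \<mu> (act g)) = null_sets \<mu>"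
  using G_space by (auto simp: G_space_def)

lemma act_space: "x \<in> space \<mu> \<Longrightarrow> act g x \<in> space \<mu>"
  using measurable_space[OF act_measurable, of "(g, x)"] by (auto simp: space_pair_measure)

lemma act_minus: "x \<in> space \<mu> \<Longrightarrow> act g (act (- g) x) = x" "x \<in> space \<mu> \<Longrightarrow> act (- g) (act g x) = x"
  using act_add[of x g "- g"] act_add[of x "- g" g] by (auto simp: act_zero)

text \<open>The measure \<mu>' of measurable bounded cohomology. It is a probability measure and, by
  \<open>null_sets_\<sigma>\<close>, equivalent to \<mu>, whose place it takes as base
  measure.\<close>

abbreviation \<sigma> where "\<sigma> \<equiv> target_measure \<G> \<nu>"

text \<open>A shear of G \<times> S that turns the target map into the second projection.\<close>

definition T :: "'g \<times> 's \<Rightarrow> 'g \<times> 's" where "T = (\<lambda>(a, y). (a, act a y))"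

lemma T_measurable[measurable]: "T \<in> haar \<Otimes>\<^sub>M \<mu> \<rightarrow>\<^sub>M haar \<Otimes>\<^sub>M \<mu>"
  unfolding T_def by measurable

lemma sets_\<sigma>[measurable_cong]: "sets \<sigma> = sets \<mu>" by (simp add: target_measure_def)

lemma space_\<sigma>[simp]: "space \<sigma> = space \<mu>" by (simp add: target_measure_def)

lemma tgt_measurable[measurable]: "(\<lambda>p. act (fst p) (snd p)) \<in> haar \<Otimes>\<^sub>M \<mu> \<rightarrow>\<^sub>M \<mu>"
  by measurable

lemma \<sigma>_def: "\<sigma> = distr \<nu> \<mu> (\<lambda>p. act (fst p) (snd p))"
  by (simp add: target_measure_def semidirect_groupoid_def case_prod_unfold)

sublocale \<sigma>: prob_space \<sigma>
  unfolding \<sigma>_def by (rule \<nu>.prob_space_distr) measurable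

sublocale haar_\<sigma>: pair_sigma_finite haar \<sigma> ..

text \<open>Each \<open>act a\<close> preserves the null sets of \<mu> in both directions, and
  Fubini passes this on to the shear.\<close>

lemma T_null: assumes X: "X \<in> sets (haar \<Otimes>\<^sub>M \<mu>)"
  shows "T -` X \<inter> space (haar \<Otimes>\<^sub>M \<mu>) \<in> null_sets (haar \<Otimes>\<^sub>M \<mu>) \<longleftrightarrow> X \<in> null_sets (haar \<Otimes>\<^sub>M \<mu>)"
proof -
  have [measurable]: "X \<in> sets (haar \<Otimes>\<^sub>M \<mu>)" by fact
  have m: "act a \<in> \<mu> \<rightarrow>\<^sub>M \<mu>" for a by measurable
  have "T -` X \<inter> space (haar \<Otimes>\<^sub>M \<mu>) \<in> null_sets (haar \<Otimes>\<^sub>M \<mu>) \<longleftrightarrow> (AE z in haar \<Otimes>\<^sub>M \<mu>. T z \<notin> X)"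
    by (subst null_sets_iff_AE) (auto intro!: AE_cong)
  also have "\<dots> \<longleftrightarrow> (AE a in haar. AE y in \<mu>. (a, act a y) \<notin> X)"
    using haar_\<mu>.AE_pair_iff[of "\<lambda>a y. T (a, y) \<notin> X"] by (simp add: T_def)
  also have "\<dots> \<longleftrightarrow> (AE a in haar. AE y in distr \<mu> \<mu> (act a). (a, y) \<notin> X)"
    by (intro AE_cong, subst AE_distr_iff[OF m]) auto
  also have "\<dots> \<longleftrightarrow> (AE a in haar. AE y in \<mu>. (a, y) \<notin> X)"
    by (subst AE_cong_null_sets[OF act_null]) auto
  also have "\<dots> \<longleftrightarrow> (AE z in haar \<Otimes>\<^sub>M \<mu>. z \<notin> X)"
    using haar_\<mu>.AE_pair_iff[of "\<lambda>a y. (a, y) \<notin> X"] by simp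
  also have "\<dots> \<longleftrightarrow> X \<in> null_sets (haar \<Otimes>\<^sub>M \<mu>)" using X by (rule null_sets_iff_AE[symmetric])
  finally show ?thesis .
qed

text \<open>The arrows with target in \<open>C\<close> form the preimage of G \<times> C under the
  shear, and Haar measure is not zero.\<close>

lemma null_sets_\<sigma>: "null_sets \<sigma> = null_sets \<mu>"
proof -
  have "C \<in> null_sets \<sigma> \<longleftrightarrow> C \<in> null_sets \<mu>" if C[measurable]: "C \<in> sets \<mu>" for C
  proof -
    have "C \<in> null_sets \<sigma> \<longleftrightarrow> (AE x in \<sigma>. x \<notin> C)" by (rule null_sets_iff_AE) (simp add: sets_\<sigma>)
    also have "\<dots> \<longleftrightarrow> (AE p in \<nu>. act (fst p) (snd p) \<notin> C)"
      unfolding \<sigma>_def by (subst AE_distr_iff) auto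
    also have "\<dots> \<longleftrightarrow> (AE p in haar \<Otimes>\<^sub>M \<mu>. act (fst p) (snd p) \<notin> C)"
      by (rule AE_cong_null_sets[OF null_sets_\<nu> sets_\<nu>])
    also have "\<dots> \<longleftrightarrow> (AE p in haar \<Otimes>\<^sub>M \<mu>. p \<notin> T -` (UNIV \<times> C) \<inter> space (haar \<Otimes>\<^sub>M \<mu>))"
      by (intro AE_cong) (auto simp: T_def)
    also have "\<dots> \<longleftrightarrow> UNIV \<times> C \<in> null_sets (haar \<Otimes>\<^sub>M \<mu>)"
    proof -
      have UC: "UNIV \<times> C \<in> sets (haar \<Otimes>\<^sub>M \<mu>)" using C sets.top[of haar] by (intro pair_measureI) auto
      have "T -` (UNIV \<times> C) \<inter> space (haar \<Otimes>\<^sub>M \<mu>) \<in> sets (haar \<Otimes>\<^sub>M \<mu>)"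
        by (rule measurable_sets[OF T_measurable UC])
      from null_sets_iff_AE[OF this] T_null[OF UC] show ?thesis by simp
    qed
    also have "\<dots> \<longleftrightarrow> emeasure haar UNIV * emeasure \<mu> C = 0"
      using C sets.top[of haar] by (simp add: null_sets_def \<mu>.emeasure_pair_measure_Times)
    also have "\<dots> \<longleftrightarrow> C \<in> null_sets \<mu>" using haar_UNIV C by (auto simp: null_sets_def)
    finally show ?thesis .
  qed
  then show ?thesis using sets_\<sigma> by (auto simp: null_sets_def)
qed

lemma AE_\<sigma>: "(AE x in \<sigma>. Q x) \<longleftrightarrow> (AE x in \<mu>. Q x)"
  by (rule AE_cong_null_sets[OF null_sets_\<sigma> sets_\<sigma>])

lemma sets_haar_\<sigma>: "sets (haar \<Otimes>\<^sub>M \<sigma>) = sets (haar \<Otimes>\<^sub>M \<mu>)"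
  by (intro sets_pair_measure_cong sets_\<sigma> refl)

lemma null_sets_haar_\<sigma>: "null_sets (haar \<Otimes>\<^sub>M \<sigma>) = null_sets (haar \<Otimes>\<^sub>M \<mu>)"
  by (rule null_sets_pair_cong[OF haar.sigma_finite_measure_axioms \<sigma>.sigma_finite_measure_axioms \<mu>.sigma_finite_measure_axioms sets_\<sigma> null_sets_\<sigma>])

lemma AE_haar_\<sigma>: "(AE x in haar \<Otimes>\<^sub>M \<sigma>. Q x) \<longleftrightarrow> (AE x in haar \<Otimes>\<^sub>M \<mu>. Q x)"
  by (rule AE_cong_null_sets[OF null_sets_haar_\<sigma> sets_haar_\<sigma>])

lemma Linf_\<sigma>: "Linf \<sigma> = Linf \<mu>" "Linf (haar \<Otimes>\<^sub>M \<sigma>) = Linf (haar \<Otimes>\<^sub>M \<mu>)"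
  unfolding Linf_def AE_haar_\<sigma> AE_\<sigma> measurable_cong_sets[OF sets_haar_\<sigma> refl] measurable_cong_sets[OF sets_\<sigma> refl] by auto

text \<open>The clauses of amenability refer to \<mu> only through its measurable sets and its null
  sets, so they hold for \<sigma> as well.\<close>

lemma amenable_action_\<sigma>:
  assumes P: "equivariant_conditional_expectation haar \<mu> act P"
  shows "amenable_action haar \<sigma> P act"
proof -
  note P' = P[unfolded equivariant_conditional_expectation_def, folded Linf_\<sigma> AE_\<sigma> AE_haar_\<sigma>]
  show ?thesis
  proof unfold_locales
    show "sets haar = sets borel" by (rule sets_haar)
    show "distr haar borel ((+) g) = haar" for g using haar by (auto simp: left_haar_measure_def)
    show "(\<lambda>(g, x). act g x) \<in> borel \<Otimes>\<^sub>M \<sigma> \<rightarrow>\<^sub>M \<sigma>"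
      using act_measurable by measurable
    show "null_sets (distr \<sigma> \<sigma> (act g)) = null_sets \<sigma>" for g
    proof -
      have m: "act g \<in> \<mu> \<rightarrow>\<^sub>M \<mu>" by measurable
      have "X \<in> null_sets (distr \<sigma> \<sigma> (act g)) \<longleftrightarrow> X \<in> null_sets (distr \<mu> \<mu> (act g))" if X: "X \<in> sets \<mu>" for X
      proof -
        have "act g -` X \<inter> space \<mu> \<in> sets \<mu>" by (rule measurable_sets[OF m X])
        moreover have "act g \<in> \<sigma> \<rightarrow>\<^sub>M \<sigma>" using m measurable_cong_sets[OF sets_\<sigma> sets_\<sigma>] by auto
        moreover have "act g -` X \<inter> space \<mu> \<in> null_sets \<sigma> \<longleftrightarrow> act g -` X \<inter> space \<mu> \<in> null_sets \<mu>"
          by (simp add: null_sets_\<sigma>)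
        ultimately show ?thesis using X m by (simp add: null_sets_def emeasure_distr sets_\<sigma>)
      qed
      then have "null_sets (distr \<sigma> \<sigma> (act g)) = null_sets (distr \<mu> \<mu> (act g))" using sets_\<sigma> by (auto simp: null_sets_def)
      then show ?thesis by (simp add: act_null null_sets_\<sigma>)
    qed
  qed (use P' act_zero act_add in auto)
qed

end

text \<open>An exceptional value in one coordinate confines the tuple to a box with a null
  side.\<close>

lemma AE_PiM_all:
  assumes M: "sigma_finite_measure M" and Q: "AE a in M. Q a"
  shows "AE g in Pi\<^sub>M {..<n::nat} (\<lambda>_. M). \<forall>i<n. Q (g i)"
proof -
  interpret M: sigma_finite_measure M by fact
  interpret product_sigma_finite "\<lambda>_::nat. M" by unfold_locales
  obtain N where N: "N \<in> null_sets M" "{a \<in> space M. \<not> Q a} \<subseteq> N" using Q unfolding eventually_ae_filter by auto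
  have "AE g in Pi\<^sub>M {..<n} (\<lambda>_. M). Q (g i)" if i: "i < n" for i
  proof (rule AE_I')
    let ?A = "Pi\<^sub>E {..<n} (\<lambda>j. if j = i then N else space M)"
    have "emeasure (Pi\<^sub>M {..<n} (\<lambda>_. M)) ?A = (\<Prod>j<n. emeasure M (if j = i then N else space M))"
      using N by (intro emeasure_PiM) auto
    also have "\<dots> = 0" using i N(1) by (intro prod_zero) (auto intro!: bexI[of _ i])
    finally show "?A \<in> null_sets (Pi\<^sub>M {..<n} (\<lambda>_. M))"
      using N by (auto intro!: null_setsI sets_PiM_I_finite)
    show "{g \<in> space (Pi\<^sub>M {..<n} (\<lambda>_. M)). \<not> Q (g i)} \<subseteq> ?A"
    proof
      fix g assume g: "g \<in> {g \<in> space (Pi\<^sub>M {..<n} (\<lambda>_. M)). \<not> Q (g i)}"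
      then have "g i \<in> space M" using i by (auto simp: space_PiM PiE_iff)
      then have "g i \<in> N" using g N(2) by auto
      then show "g \<in> ?A" using g by (auto simp: space_PiM PiE_iff)
    qed
  qed
  then show ?thesis by (simp add: AE_all_countable)
qed

section \<open>The disintegration along the target map compared with Haar measure\<close>

context semidirect_setting
begin

lemma \<kappa>_measurable: "\<kappa> \<in> \<sigma> \<rightarrow>\<^sub>M prob_algebra (haar \<Otimes>\<^sub>M \<mu>)"
  using disintegration by (simp add: target_disintegration_def measurable_cong_sets[OF sets_\<sigma> refl])

lemma \<kappa>_measurable_subprob[measurable]: "\<kappa> \<in> \<sigma> \<rightarrow>\<^sub>M subprob_algebra (haar \<Otimes>\<^sub>M \<mu>)"
  using \<kappa>_measurable by (rule measurable_prob_algebraD)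

lemma bind_\<kappa>: "Giry_Monad.bind \<sigma> \<kappa> = \<nu>"
  using disintegration by (simp add: target_disintegration_def)

lemma \<kappa>_fibre: "AE x in \<sigma>. AE p in \<kappa> x. act (fst p) (snd p) = x"
  using disintegration by (simp add: target_disintegration_def)

lemma
  assumes "x \<in> space \<mu>"
  shows sets_\<kappa>: "sets (\<kappa> x) = sets (haar \<Otimes>\<^sub>M \<mu>)" and prob_space_\<kappa>: "prob_space (\<kappa> x)"
    and space_\<kappa>: "space (\<kappa> x) = space (haar \<Otimes>\<^sub>M \<mu>)"
proof -
  have "\<kappa> x \<in> space (prob_algebra (haar \<Otimes>\<^sub>M \<mu>))" using measurable_space[OF \<kappa>_measurable, of x] assms by simp
  then show "sets (\<kappa> x) = sets (haar \<Otimes>\<^sub>M \<mu>)" "prob_space (\<kappa> x)" by (auto simp: space_prob_algebra)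
  then show "space (\<kappa> x) = space (haar \<Otimes>\<^sub>M \<mu>)" using sets_eq_imp_space_eq by blast
qed

text \<open>The class of \<nu> is that of Haar times \<mu>, which the shear preserves; so the image
  of \<nu> is equivalent to Haar times \<sigma>.\<close>

lemma T_null_\<nu>: assumes X: "X \<in> sets (haar \<Otimes>\<^sub>M \<mu>)"
  shows "X \<in> null_sets (distr \<nu> (haar \<Otimes>\<^sub>M \<sigma>) T) \<longleftrightarrow> X \<in> null_sets (haar \<Otimes>\<^sub>M \<sigma>)"
proof -
  have T: "T \<in> \<nu> \<rightarrow>\<^sub>M haar \<Otimes>\<^sub>M \<sigma>"
    using T_measurable measurable_cong_sets[OF sets_\<nu> sets_haar_\<sigma>] by auto
  have sp: "space \<nu> = space (haar \<Otimes>\<^sub>M \<mu>)" by (rule sets_eq_imp_space_eq[OF sets_\<nu>])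
  have "X \<in> null_sets (distr \<nu> (haar \<Otimes>\<^sub>M \<sigma>) T) \<longleftrightarrow> T -` X \<inter> space (haar \<Otimes>\<^sub>M \<mu>) \<in> null_sets \<nu>"
    using X measurable_sets[OF T_measurable X]
    by (simp add: null_sets_def emeasure_distr[OF T] sets_haar_\<sigma> sets_\<nu> sp)
  then show ?thesis using T_null[OF X] by (simp add: null_sets_\<nu> null_sets_haar_\<sigma>)
qed

text \<open>By uniqueness of disintegrations, almost every \<open>\<kappa> x\<close> is equivalent to Haar measure on the
  target fibre of \<open>x\<close>, parametrized by the first coordinate.\<close>

lemma \<kappa>_density:
  obtains r where "r \<in> borel_measurable (haar \<Otimes>\<^sub>M \<sigma>)"
    "AE x in \<sigma>. distr (\<kappa> x) haar fst = density haar (\<lambda>a. r (a, x))"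
    "AE x in \<sigma>. AE a in haar. 0 < r (a, x)"
proof -
  let ?L = "distr \<nu> (haar \<Otimes>\<^sub>M \<sigma>) T"
  have T: "T \<in> \<nu> \<rightarrow>\<^sub>M haar \<Otimes>\<^sub>M \<sigma>"
    using T_measurable measurable_cong_sets[OF sets_\<nu> sets_haar_\<sigma>] by auto
  have sp: "space \<nu> = space (haar \<Otimes>\<^sub>M \<mu>)" by (rule sets_eq_imp_space_eq[OF sets_\<nu>])
  have "absolutely_continuous (haar \<Otimes>\<^sub>M \<sigma>) ?L"
    unfolding absolutely_continuous_def using T_null_\<nu> sets_haar_\<sigma> by (auto dest: null_setsD2)
  from haar_\<sigma>.Radon_Nikodym[OF this]
  obtain r where r[measurable]: "r \<in> borel_measurable (haar \<Otimes>\<^sub>M \<sigma>)" and L: "density (haar \<Otimes>\<^sub>M \<sigma>) r = ?L" by auto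
  \<comment> \<open>The image measure gives no mass to the zeros of its density; being equivalent to
    the base measure, it makes them null there too.\<close>
  define Z where "Z = {z \<in> space (haar \<Otimes>\<^sub>M \<sigma>). r z = 0}"
  have Z[measurable]: "Z \<in> sets (haar \<Otimes>\<^sub>M \<sigma>)" by (simp add: Z_def)
  have "emeasure ?L Z = (\<integral>\<^sup>+z. r z * indicator Z z \<partial>(haar \<Otimes>\<^sub>M \<sigma>))"
    unfolding L[symmetric] by (rule emeasure_density) measurable
  also have "\<dots> = (\<integral>\<^sup>+z. 0 \<partial>(haar \<Otimes>\<^sub>M \<sigma>))" by (intro nn_integral_cong) (auto simp: Z_def indicator_def)
  finally have "Z \<in> null_sets ?L" using Z by (auto simp: null_sets_def)
  then have "Z \<in> null_sets (haar \<Otimes>\<^sub>M \<sigma>)" using T_null_\<nu>[of Z] Z sets_haar_\<sigma> by auto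
  then have "AE z in haar \<Otimes>\<^sub>M \<sigma>. 0 < r z" by (rule AE_I') (auto simp: Z_def zero_less_iff_neq_zero)
  then have "AE a in haar. AE x in \<sigma>. 0 < r (a, x)" by (rule haar_\<sigma>.AE_pair)
  then have pos: "AE x in \<sigma>. AE a in haar. 0 < r (a, x)" by (subst (asm) haar_\<sigma>.AE_commute) auto
  have eq: "AE x in \<sigma>. emeasure (\<kappa> x) (A \<times> space \<mu>) = (\<integral>\<^sup>+a. r (a, x) * indicator A a \<partial>haar)" if A: "A \<in> sets haar" for A
  proof -
    have [measurable]: "A \<in> sets haar" by fact
    have A\<mu>[measurable]: "A \<times> space \<mu> \<in> sets (haar \<Otimes>\<^sub>M \<mu>)" by measurable
    have m1: "(\<lambda>x. emeasure (\<kappa> x) (A \<times> space \<mu>)) \<in> borel_measurable \<sigma>"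
      by (rule measurable_compose[OF \<kappa>_measurable_subprob measurable_emeasure_subprob_algebra]) measurable
    have m2: "(\<lambda>x. \<integral>\<^sup>+a. r (a, x) * indicator A a \<partial>haar) \<in> borel_measurable \<sigma>" by measurable
    \<comment> \<open>Two functions of x are compared through their integrals over \<open>C\<close>.
      Both integrals equal the image measure of A \<times> C, once by disintegrating \<nu> and once
      by Fubini.\<close>
    have "density \<sigma> (\<lambda>x. emeasure (\<kappa> x) (A \<times> space \<mu>)) = density \<sigma> (\<lambda>x. \<integral>\<^sup>+a. r (a, x) * indicator A a \<partial>haar)"
    proof (rule measure_eqI)
      fix C assume "C \<in> sets (density \<sigma> (\<lambda>x. emeasure (\<kappa> x) (A \<times> space \<mu>)))"
      then have C[measurable]: "C \<in> sets \<sigma>" by simp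
      have C\<mu>: "C \<in> sets \<mu>" using C sets_\<sigma> by simp
      have AC: "A \<times> C \<in> sets (haar \<Otimes>\<^sub>M \<mu>)" using C\<mu> A by simp
      have AC\<sigma>: "A \<times> C \<in> sets (haar \<Otimes>\<^sub>M \<sigma>)" using C A by simp
      let ?TX = "T -` (A \<times> C) \<inter> space (haar \<Otimes>\<^sub>M \<mu>)"
      have TX: "?TX \<in> sets (haar \<Otimes>\<^sub>M \<mu>)" by (rule measurable_sets[OF T_measurable AC])
      have "emeasure (density \<sigma> (\<lambda>x. emeasure (\<kappa> x) (A \<times> space \<mu>))) C = (\<integral>\<^sup>+x. emeasure (\<kappa> x) (A \<times> space \<mu>) * indicator C x \<partial>\<sigma>)"
        by (rule emeasure_density[OF m1 C])
      also have "\<dots> = (\<integral>\<^sup>+x. emeasure (\<kappa> x) ?TX \<partial>\<sigma>)"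
      proof (rule nn_integral_cong_AE)
        \<comment> \<open>As \<kappa> x lives on arrows with target x, the condition that the target
          lie in \<open>C\<close> is just x \<in> C.\<close>
        show "AE x in \<sigma>. emeasure (\<kappa> x) (A \<times> space \<mu>) * indicator C x = emeasure (\<kappa> x) ?TX"
          using \<kappa>_fibre AE_space
        proof eventually_elim
          case (elim x)
          have x: "x \<in> space \<mu>" using elim by simp
          have sk: "sets (\<kappa> x) = sets (haar \<Otimes>\<^sub>M \<mu>)" "space (\<kappa> x) = space (haar \<Otimes>\<^sub>M \<mu>)" using sets_\<kappa>[OF x] space_\<kappa>[OF x] by auto
          show ?case
          proof (cases "x \<in> C")
            case True
            have "emeasure (\<kappa> x) (A \<times> space \<mu>) = emeasure (\<kappa> x) ?TX"
            proof (rule emeasure_eq_AE)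
              have "AE p in \<kappa> x. p \<in> space (\<kappa> x)" by simp
              with elim(1) show "AE p in \<kappa> x. p \<in> A \<times> space \<mu> \<longleftrightarrow> p \<in> ?TX"
                by eventually_elim (use True sk in \<open>auto simp: T_def space_pair_measure split: prod.splits\<close>)
            qed (use A\<mu> TX sk in auto)
            then show ?thesis using True by simp
          next
            case False
            have "emeasure (\<kappa> x) ?TX = emeasure (\<kappa> x) {}"
              by (rule emeasure_eq_AE) (use elim(1) TX sk False in \<open>auto simp: T_def elim!: AE_mp\<close>)
            then show ?thesis using False by simp
          qed
        qed
      qed
      also have "\<dots> = emeasure \<nu> ?TX"
        using emeasure_bind[OF \<sigma>.not_empty \<kappa>_measurable_subprob TX] by (simp only: bind_\<kappa>)
      also have "\<dots> = emeasure ?L (A \<times> C)"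
        using emeasure_distr[OF T AC\<sigma>] sp by simp
      also have "\<dots> = (\<integral>\<^sup>+z. r z * indicator (A \<times> C) z \<partial>(haar \<Otimes>\<^sub>M \<sigma>))"
        unfolding L[symmetric] by (rule emeasure_density[OF r AC\<sigma>])
      also have "\<dots> = (\<integral>\<^sup>+x. \<integral>\<^sup>+a. r (a, x) * indicator (A \<times> C) (a, x) \<partial>haar \<partial>\<sigma>)"
        using AC\<sigma> by (intro haar_\<sigma>.nn_integral_snd[symmetric]) measurable
      also have "\<dots> = (\<integral>\<^sup>+x. (\<integral>\<^sup>+a. r (a, x) * indicator A a \<partial>haar) * indicator C x \<partial>\<sigma>)"
        by (intro nn_integral_cong) (auto simp: indicator_def)
      also have "\<dots> = emeasure (density \<sigma> (\<lambda>x. \<integral>\<^sup>+a. r (a, x) * indicator A a \<partial>haar)) C"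
        by (rule emeasure_density[symmetric, OF m2 C])
      finally show "emeasure (density \<sigma> (\<lambda>x. emeasure (\<kappa> x) (A \<times> space \<mu>))) C =
        emeasure (density \<sigma> (\<lambda>x. \<integral>\<^sup>+a. r (a, x) * indicator A a \<partial>haar)) C" .
    qed simp
    then show ?thesis by (rule \<sigma>.density_unique[OF m1 m2])
  qed
  \<comment> \<open>So far each \<open>A\<close> has its own null set of x; a countable generator
    makes it common.\<close>
  obtain B :: "'g set set" where B: "countable B" "Int_stable B" "UNIV \<in> B" "sets borel = sigma_sets UNIV B"
    by (rule countable_Int_stable_generator)
  have BG: "A \<in> sets haar" if "A \<in> B" for A using that sets_haar B(4) by auto
  have "AE x in \<sigma>. \<forall>A\<in>B. emeasure (\<kappa> x) (A \<times> space \<mu>) = (\<integral>\<^sup>+a. r (a, x) * indicator A a \<partial>haar)"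
    unfolding AE_ball_countable[OF B(1)] using eq BG by blast
  then have dens: "AE x in \<sigma>. distr (\<kappa> x) haar fst = density haar (\<lambda>a. r (a, x))"
    using AE_space
  proof eventually_elim
    case (elim x)
    then have x: "x \<in> space \<mu>" and x': "x \<in> space \<sigma>" by auto
    have sk: "sets (\<kappa> x) = sets (haar \<Otimes>\<^sub>M \<mu>)" "space (\<kappa> x) = space (haar \<Otimes>\<^sub>M \<mu>)" using sets_\<kappa>[OF x] space_\<kappa>[OF x] by auto
    interpret \<kappa>x: prob_space "\<kappa> x" by (rule prob_space_\<kappa>[OF x])
    have f: "fst \<in> \<kappa> x \<rightarrow>\<^sub>M haar" using measurable_fst[of haar \<mu>] measurable_cong_sets[OF sk(1) refl] by auto
    have rx: "(\<lambda>a. r (a, x)) \<in> borel_measurable haar" using x' by measurable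
    show ?case
    proof (rule measure_eqI_generator_eq[OF B(2), where \<Omega>=UNIV and A="\<lambda>_. UNIV"])
      fix A assume A: "A \<in> B"
      have "fst -` A \<inter> space (\<kappa> x) = A \<times> space \<mu>" by (auto simp: sk space_pair_measure)
      then show "emeasure (distr (\<kappa> x) haar fst) A = emeasure (density haar (\<lambda>a. r (a, x))) A"
        using elim(1) A by (simp add: emeasure_distr[OF f BG[OF A]] emeasure_density[OF rx BG[OF A]])
    next
      show "emeasure (distr (\<kappa> x) haar fst) UNIV \<noteq> \<infinity>"
        using \<kappa>x.emeasure_finite by (simp add: emeasure_distr[OF f BG[OF B(3)]])
    qed (use B sets_haar in auto)
  qed
  show ?thesis by (rule that[OF r dens pos])
qed

text \<open>\<open>\<Phi> n (g, x)\<close> is the tuple of the arrows with target \<open>x\<close> and group components \<open>g\<close>.\<close>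

definition \<Phi> :: "nat \<Rightarrow> (nat \<Rightarrow> 'g) \<times> 's \<Rightarrow> nat \<Rightarrow> 'g \<times> 's" where
  "\<Phi> n z = (\<lambda>i\<in>{..<n}. (fst z i, act (- fst z i) (snd z)))"

text \<open>The inverse of \<open>\<Phi> n\<close>. The common target is read off the arrow with
  index 0, which exists only for n > 0.\<close>

definition \<Psi> :: "nat \<Rightarrow> (nat \<Rightarrow> 'g \<times> 's) \<Rightarrow> (nat \<Rightarrow> 'g) \<times> 's" where
  "\<Psi> n h = (\<lambda>i\<in>{..<n}. fst (h i), act (fst (h 0)) (snd (h 0)))"

abbreviation GP :: "nat \<Rightarrow> (nat \<Rightarrow> 'g) measure" where "GP n \<equiv> Pi\<^sub>M {..<n} (\<lambda>_. haar)"

abbreviation AP :: "nat \<Rightarrow> (nat \<Rightarrow> 'g \<times> 's) measure" where "AP n \<equiv> Pi\<^sub>M {..<n} (\<lambda>_. haar \<Otimes>\<^sub>M \<mu>)"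

sublocale GP: product_sigma_finite "\<lambda>_::nat. haar" by unfold_locales

lemma sigma_finite_GP: "sigma_finite_measure (GP n)" by (rule GP.sigma_finite) simp

lemma pair_sigma_finite_GP: "pair_sigma_finite (GP n) \<sigma>"
  by (intro pair_sigma_finite.intro sigma_finite_GP \<sigma>.sigma_finite_measure_axioms)

lemma measurable_\<Phi>[measurable]: "\<Phi> n \<in> GP n \<Otimes>\<^sub>M \<sigma> \<rightarrow>\<^sub>M AP n"
  unfolding \<Phi>_def by measurable

text \<open>An arrow with target x is determined by its group component. Hence the n-th power of
  \<kappa> x is the image under \<Phi> of Haar measure on G^n with density the product of the values
  of \<open>r\<close>, and this density is positive almost everywhere.\<close>

lemma PiM_\<kappa>_null:
  assumes x: "x \<in> space \<mu>" and r[measurable]: "(\<lambda>a. r (a, x)) \<in> borel_measurable haar"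
    and dens: "distr (\<kappa> x) haar fst = density haar (\<lambda>a. r (a, x) :: ennreal)"
    and pos: "AE a in haar. 0 < r (a, x)"
    and fibre: "AE p in \<kappa> x. act (fst p) (snd p) = x"
    and X: "X \<in> sets (AP n)"
  shows "emeasure (Pi\<^sub>M {..<n} (\<lambda>_. \<kappa> x)) X = 0 \<longleftrightarrow> (AE g in GP n. \<Phi> n (g, x) \<notin> X)"
proof -
  have sk: "sets (\<kappa> x) = sets (haar \<Otimes>\<^sub>M \<mu>)" "space (\<kappa> x) = space (haar \<Otimes>\<^sub>M \<mu>)" using sets_\<kappa>[OF x] space_\<kappa>[OF x] by auto
  interpret \<kappa>x: prob_space "\<kappa> x" by (rule prob_space_\<kappa>[OF x])
  interpret K: product_sigma_finite "\<lambda>_::nat. \<kappa> x" by unfold_locales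
  have f: "fst \<in> \<kappa> x \<rightarrow>\<^sub>M haar" using measurable_fst[of haar \<mu>] measurable_cong_sets[OF sk(1) refl] by auto
  have sP: "sets (Pi\<^sub>M {..<n} (\<lambda>_. \<kappa> x)) = sets (AP n)" by (intro sets_PiM_cong refl sk)
  have i: "(\<lambda>a. (a, act (- a) x)) \<in> haar \<rightarrow>\<^sub>M haar \<Otimes>\<^sub>M \<mu>" using x by measurable
  have \<Phi>x[measurable]: "(\<lambda>g. \<Phi> n (g, x)) \<in> GP n \<rightarrow>\<^sub>M AP n"
    using x by (intro measurable_compose[OF _ measurable_\<Phi>]) simp
  have R[measurable]: "(\<lambda>g. \<Prod>i<n. r (g i, x)) \<in> borel_measurable (GP n)"
  proof (rule borel_measurable_prod_ennreal)
    fix i assume i: "i \<in> {..<n}"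
    have "(\<lambda>g. g i) \<in> GP n \<rightarrow>\<^sub>M haar" using i by (rule measurable_component_singleton)
    then show "(\<lambda>g. r (g i, x)) \<in> borel_measurable (GP n)" by (rule measurable_compose[OF _ r])
  qed
  let ?D = "distr (density (GP n) (\<lambda>g. \<Prod>i<n. r (g i, x))) (AP n) (\<lambda>g. \<Phi> n (g, x))"
  have "?D = Pi\<^sub>M {..<n} (\<lambda>_. \<kappa> x)"
  proof (rule K.PiM_eqI)
    fix A :: "nat \<Rightarrow> ('g \<times> 's) set" assume "\<And>i. i \<in> {..<n} \<Longrightarrow> A i \<in> sets (\<kappa> x)"
    then have A: "A i \<in> sets (haar \<Otimes>\<^sub>M \<mu>)" if "i < n" for i using that sk by auto
    have PA: "Pi\<^sub>E {..<n} A \<in> sets (AP n)" using A by (intro sets_PiM_I_finite) auto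
    let ?Ai = "\<lambda>i. (\<lambda>a. (a, act (- a) x)) -` A i"
    have Ai: "?Ai i \<in> sets haar" if "i < n" for i using measurable_sets[OF i A[OF that]] by simp
    have "emeasure ?D (Pi\<^sub>E {..<n} A) = emeasure (density (GP n) (\<lambda>g. \<Prod>i<n. r (g i, x))) ((\<lambda>g. \<Phi> n (g, x)) -` Pi\<^sub>E {..<n} A \<inter> space (GP n))"
      using PA \<Phi>x by (subst emeasure_distr) auto
    also have "\<dots> = (\<integral>\<^sup>+g. (\<Prod>i<n. r (g i, x)) * indicator ((\<lambda>g. \<Phi> n (g, x)) -` Pi\<^sub>E {..<n} A \<inter> space (GP n)) g \<partial>GP n)"
      using measurable_sets[OF \<Phi>x PA] by (intro emeasure_density R)
    also have "\<dots> = (\<integral>\<^sup>+g. (\<Prod>i<n. r (g i, x) * indicator (?Ai i) (g i)) \<partial>GP n)"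
    proof (rule nn_integral_cong)
      fix g assume g: "g \<in> space (GP n)"
      have "indicator ((\<lambda>g. \<Phi> n (g, x)) -` Pi\<^sub>E {..<n} A \<inter> space (GP n)) g = (\<Prod>i<n. indicator (?Ai i) (g i) :: ennreal)"
      proof (cases "\<forall>i<n. g i \<in> ?Ai i")
        case True
        then have "g \<in> (\<lambda>g. \<Phi> n (g, x)) -` Pi\<^sub>E {..<n} A \<inter> space (GP n)" using g by (auto simp: \<Phi>_def)
        moreover have "(\<Prod>i<n. indicator (?Ai i) (g i) :: ennreal) = 1" using True by (intro prod.neutral) auto
        ultimately show ?thesis by simp
      next
        case False
        then obtain i where i: "i < n" "g i \<notin> ?Ai i" by auto
        then have "(\<Prod>i<n. indicator (?Ai i) (g i) :: ennreal) = 0" by (intro prod_zero) (auto intro!: bexI[of _ i])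
        moreover have "\<Phi> n (g, x) \<notin> Pi\<^sub>E {..<n} A"
        proof
          assume "\<Phi> n (g, x) \<in> Pi\<^sub>E {..<n} A"
          from PiE_mem[OF this, of i] i show False by (auto simp: \<Phi>_def)
        qed
        ultimately show ?thesis by simp
      qed
      then show "(\<Prod>i<n. r (g i, x)) * indicator ((\<lambda>g. \<Phi> n (g, x)) -` Pi\<^sub>E {..<n} A \<inter> space (GP n)) g =
         (\<Prod>i<n. r (g i, x) * indicator (?Ai i) (g i))"
        by (simp add: prod.distrib)
    qed
    also have "\<dots> = (\<Prod>i<n. \<integral>\<^sup>+a. r (a, x) * indicator (?Ai i) a \<partial>haar)"
      using Ai by (intro GP.product_nn_integral_prod) auto
    also have "\<dots> = (\<Prod>i<n. emeasure (\<kappa> x) (A i))"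
    proof (rule prod.cong[OF refl])
      fix i assume "i \<in> {..<n}"
      then have i: "i < n" by simp
      have "(\<integral>\<^sup>+a. r (a, x) * indicator (?Ai i) a \<partial>haar) = emeasure (density haar (\<lambda>a. r (a, x))) (?Ai i)"
        by (rule emeasure_density[symmetric, OF r Ai[OF i]])
      also have "\<dots> = emeasure (\<kappa> x) (fst -` ?Ai i \<inter> space (\<kappa> x))"
        unfolding dens[symmetric] by (rule emeasure_distr[OF f Ai[OF i]])
      \<comment> \<open>Almost every arrow p is the pair of a = fst p and the translate of x by the
        inverse of a, so its group component recovers it.\<close>
      also have "\<dots> = emeasure (\<kappa> x) (A i)"
      proof (rule emeasure_eq_AE)
        have "AE p in \<kappa> x. p \<in> space (\<kappa> x)" by simp
        with fibre show "AE p in \<kappa> x. p \<in> fst -` ?Ai i \<inter> space (\<kappa> x) \<longleftrightarrow> p \<in> A i"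
        proof eventually_elim
          case (elim p)
          then have "snd p \<in> space \<mu>" by (auto simp: sk space_pair_measure)
          then have "act (- fst p) x = snd p" using act_minus(2)[of "snd p" "fst p"] elim(1) by simp
          then show ?case using elim by simp
        qed
        show "fst -` ?Ai i \<inter> space (\<kappa> x) \<in> sets (\<kappa> x)" by (rule measurable_sets[OF f Ai[OF i]])
      qed (use A[OF i] sk in simp)
      finally show "(\<integral>\<^sup>+a. r (a, x) * indicator (?Ai i) a \<partial>haar) = emeasure (\<kappa> x) (A i)" .
    qed
    finally show "emeasure ?D (Pi\<^sub>E {..<n} A) = (\<Prod>i<n. emeasure (\<kappa> x) (A i))" .
  qed (use sP in auto)
  then have "emeasure (Pi\<^sub>M {..<n} (\<lambda>_. \<kappa> x)) X = emeasure ?D X" by simp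
  also have "\<dots> = emeasure (density (GP n) (\<lambda>g. \<Prod>i<n. r (g i, x))) ((\<lambda>g. \<Phi> n (g, x)) -` X \<inter> space (GP n))"
    using X \<Phi>x by (subst emeasure_distr) auto
  also have "\<dots> = (\<integral>\<^sup>+g. (\<Prod>i<n. r (g i, x)) * indicator ((\<lambda>g. \<Phi> n (g, x)) -` X \<inter> space (GP n)) g \<partial>GP n)"
    using measurable_sets[OF \<Phi>x X] by (intro emeasure_density R)
  finally have "emeasure (Pi\<^sub>M {..<n} (\<lambda>_. \<kappa> x)) X = 0 \<longleftrightarrow>
      (AE g in GP n. (\<Prod>i<n. r (g i, x)) * indicator ((\<lambda>g. \<Phi> n (g, x)) -` X \<inter> space (GP n)) g = 0)"
    using measurable_sets[OF \<Phi>x X] R by (simp add: nn_integral_0_iff_AE)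
  also have "\<dots> \<longleftrightarrow> (AE g in GP n. \<Phi> n (g, x) \<notin> X)"
  proof -
    have "AE g in GP n. (\<Prod>i<n. r (g i, x)) \<noteq> 0"
      using AE_PiM_all[OF haar.sigma_finite_measure_axioms pos, of n]
      by eventually_elim auto
    moreover have "AE g in GP n. g \<in> space (GP n)" by simp
    ultimately have "AE g in GP n. ((\<Prod>i<n. r (g i, x)) * indicator ((\<lambda>g. \<Phi> n (g, x)) -` X \<inter> space (GP n)) g = 0) = (\<Phi> n (g, x) \<notin> X)"
      by eventually_elim (auto simp: indicator_def)
    then show ?thesis by (rule eventually_subst)
  qed
  finally show ?thesis .
qed

end

section \<open>Separating the acting group element from a tuple\<close>

context amenable_action
begin

lemma AE_translate:
  assumes Q: "AE z in GP n \<Otimes>\<^sub>M S. R z"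
  shows "AE z in GP n \<Otimes>\<^sub>M S. R (translate n g (fst z), act g (snd z))"
proof (rule nonsingular_AE[OF _ _ Q])
  show "(\<lambda>z. (translate n g (fst z), act g (snd z))) \<in> GP n \<Otimes>\<^sub>M S \<rightarrow>\<^sub>M GP n \<Otimes>\<^sub>M S" by measurable
  fix X assume X: "X \<in> null_sets (GP n \<Otimes>\<^sub>M S)"
  have [measurable]: "X \<in> sets (GP n \<Otimes>\<^sub>M S)" using X by auto
  have t: "translate n g \<in> GP n \<rightarrow>\<^sub>M GP n" by measurable
  have "AE z in GP n \<Otimes>\<^sub>M S. z \<notin> X" using X by (rule AE_not_in)
  then have "AE h in GP n. AE x in S. (h, x) \<notin> X" by (rule Q.HS.AE_pair)
  then have "AE h in distr (GP n) (GP n) (translate n g). AE x in S. (h, x) \<notin> X" by (simp only: distr_translate)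
  from AE_distrD[OF t this] have "AE h in GP n. AE x in S. (translate n g h, act g x) \<notin> X"
    by eventually_elim (rule act_AE)
  then show "AE z in GP n \<Otimes>\<^sub>M S. (translate n g (fst z), act g (snd z)) \<notin> X"
    by (intro Q.HS.AE_pair_measure) auto
qed

text \<open>Coordinate 0 of a tuple of length n + 1 plays the acting group element and the others
  are the arguments, the shape in which \<open>groupoid_invariant\<close> is stated.\<close>

lemma AE_split_first:
  assumes Q: "AE z in G \<Otimes>\<^sub>M GP n \<Otimes>\<^sub>M S. R z"
  shows "AE z in GP (Suc n) \<Otimes>\<^sub>M S. R (fst z 0, omit n 0 (fst z), snd z)"
proof (rule nonsingular_AE[OF _ _ Q])
  note [measurable] = measurable_omit[of 0 n G]
  have [measurable]: "(\<lambda>h. h 0) \<in> GP (Suc n) \<rightarrow>\<^sub>M G" by (rule measurable_component_singleton) simp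
  show "(\<lambda>z. (fst z 0, omit n 0 (fst z), snd z)) \<in> GP (Suc n) \<Otimes>\<^sub>M S \<rightarrow>\<^sub>M G \<Otimes>\<^sub>M GP n \<Otimes>\<^sub>M S" by measurable
  fix X assume X: "X \<in> null_sets (G \<Otimes>\<^sub>M GP n \<Otimes>\<^sub>M S)"
  have [measurable]: "X \<in> sets (G \<Otimes>\<^sub>M GP n \<Otimes>\<^sub>M S)" using X by auto
  interpret I: pair_sigma_finite "GP n" G
    by (intro pair_sigma_finite.intro sigma_finite_GP G.sigma_finite_measure_axioms)
  interpret J: pair_sigma_finite G "GP n"
    by (intro pair_sigma_finite.intro sigma_finite_GP G.sigma_finite_measure_axioms)
  have m: "(\<lambda>(h, b). insert_at n 0 h b) \<in> GP n \<Otimes>\<^sub>M G \<rightarrow>\<^sub>M GP (Suc n)" by (rule measurable_insert_at) simp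
  have eq: "{p \<in> space (GP n \<Otimes>\<^sub>M G). AE x in S. (snd p, fst p, x) \<notin> X} =
      {p \<in> space (GP n \<Otimes>\<^sub>M G). emeasure S {x \<in> space S. (snd p, fst p, x) \<in> X} = 0}"
    by (intro Collect_cong conj_cong refl, subst AE_iff_measurable[OF _ refl]) auto
  have meas: "{p \<in> space (GP n \<Otimes>\<^sub>M G). AE x in S. (snd p, fst p, x) \<notin> X} \<in> sets (GP n \<Otimes>\<^sub>M G)"
    unfolding eq by measurable
  have "AE z in G \<Otimes>\<^sub>M GP n \<Otimes>\<^sub>M S. z \<notin> X" using X by (rule AE_not_in)
  then have "AE a in G. AE z in GP n \<Otimes>\<^sub>M S. (a, z) \<notin> X" by (rule Q.G_HS.AE_pair)
  then have "AE a in G. AE h in GP n. AE x in S. (a, h, x) \<notin> X"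
    by eventually_elim (rule Q.HS.AE_pair)
  then have "AE h in GP n. AE a in G. AE x in S. (a, h, x) \<notin> X"
    using I.AE_commute[OF meas] by simp
  then have 1: "AE p in GP n \<Otimes>\<^sub>M G. AE x in S. (snd p, fst p, x) \<notin> X"
    using I.AE_pair_iff[OF meas] by simp
  have "AE p in GP n \<Otimes>\<^sub>M G. AE x in S. ((case p of (h, b) \<Rightarrow> insert_at n 0 h b) 0, omit n 0 (case p of (h, b) \<Rightarrow> insert_at n 0 h b), x) \<notin> X"
    using 1 AE_space
  proof eventually_elim
    case (elim p)
    then have "fst p \<in> extensional {..<n}" by (simp add: space_pair_measure space_PiM PiE_def mem_Times_iff)
    then have "omit n 0 (insert_at n 0 (fst p) (snd p)) = fst p" by (rule omit_insert_at) simp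
    moreover have "insert_at n 0 (fst p) (snd p) 0 = snd p" by (simp add: insert_at_def)
    ultimately show ?case using elim by (simp add: case_prod_unfold)
  qed
  then have "AE h in distr (GP n \<Otimes>\<^sub>M G) (GP (Suc n)) (\<lambda>(h, b). insert_at n 0 h b). AE x in S. (h 0, omit n 0 h, x) \<notin> X"
  proof (subst AE_distr_iff[OF m])
    have "{h \<in> space (GP (Suc n)). AE x in S. (h 0, omit n 0 h, x) \<notin> X} =
      {h \<in> space (GP (Suc n)). emeasure S {x \<in> space S. (h 0, omit n 0 h, x) \<in> X} = 0}"
      by (intro Collect_cong conj_cong refl, subst AE_iff_measurable[OF _ refl]) auto
    also have "\<dots> \<in> sets (GP (Suc n))" by measurable
    finally show "{h \<in> space (GP (Suc n)). AE x in S. (h 0, omit n 0 h, x) \<notin> X} \<in> sets (GP (Suc n))" .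
  qed
  then have "AE h in GP (Suc n). AE x in S. (h 0, omit n 0 h, x) \<notin> X"
    by (simp only: distr_insert_at[OF G.sigma_finite_measure_axioms le0])
  then show "AE z in GP (Suc n) \<Otimes>\<^sub>M S. (fst z 0, omit n 0 (fst z), snd z) \<notin> X"
    by (intro Q.HS.AE_pair_measure) auto
qed

text \<open>The direction opposite to \<open>AE_split_first\<close>, with the quantifiers separated
  by Fubini: from groupoid invariance to invariance under almost every g.\<close>

lemma AE_first:
  assumes Q: "AE z in GP (Suc n) \<Otimes>\<^sub>M S. R (fst z 0) (omit n 0 (fst z), snd z)"
  shows "AE g in G. AE y in GP n \<Otimes>\<^sub>M S. R g y"
proof -
  have "AE (a, h, x) in G \<Otimes>\<^sub>M GP n \<Otimes>\<^sub>M S.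
     R (insert_at n 0 h a 0) (omit n 0 (insert_at n 0 h a), x)"
    using AE_insert_at[OF le0 Q] by simp
  then have "AE z in G \<Otimes>\<^sub>M GP n \<Otimes>\<^sub>M S. R (fst z) (snd z)"
    using AE_space
  proof eventually_elim
    case (elim z)
    obtain a h x where z: "z = (a, h, x)" by (cases z)
    have "h \<in> extensional {..<n}" using elim(2) by (simp add: z space_pair_measure space_PiM PiE_def)
    then have "omit n 0 (insert_at n 0 h a) = h" by (rule omit_insert_at) simp
    then show ?case using elim(1) by (simp add: z insert_at_def)
  qed
  then show ?thesis using Q.G_HS.AE_pair[of "\<lambda>z. R (fst z) (snd z)"] by simp
qed

end

section \<open>Null sets of the fibre powers\<close>

context semidirect_setting
begin

text \<open>A countable base of a Hausdorff topology separates points. Equality of two targets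
  thereby becomes a countable measurable condition.\<close>

lemma separating_sets:
  "\<exists>\<O>. countable \<O> \<and> \<O> \<subseteq> sets \<mu> \<and>
    (\<forall>x\<in>space \<mu>. \<forall>y\<in>space \<mu>. (\<forall>U\<in>\<O>. x \<in> U \<longleftrightarrow> y \<in> U) \<longrightarrow> x = y)"
proof -
  obtain T where T: "topspace T = space \<mu>" "completely_metrizable_space T" "second_countable T"
    "sets \<mu> = sigma_sets (space \<mu>) {U. openin T U}"
    using G_space unfolding G_space_def standard_borel_space_def by auto
  obtain \<B> where B0: "countable \<B> \<and> (\<forall>V\<in>\<B>. openin T V) \<and>
    (\<forall>U x. openin T U \<and> x \<in> U \<longrightarrow> (\<exists>V\<in>\<B>. x \<in> V \<and> V \<subseteq> U))"
    using T(3) unfolding second_countable_def by (rule exE)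
  then have B: "countable \<B>" "\<And>V. V \<in> \<B> \<Longrightarrow> openin T V" by simp_all
  have B3: "\<exists>V\<in>\<B>. x \<in> V \<and> V \<subseteq> U" if "openin T U" "x \<in> U" for U x using B0 that by simp
  have "Hausdorff_space T"
    using T(2) completely_metrizable_imp_metrizable_space metrizable_imp_Hausdorff_space by blast
  have "x = y" if x: "x \<in> space \<mu>" and y: "y \<in> space \<mu>" and sep: "\<forall>U\<in>\<B>. x \<in> U \<longleftrightarrow> y \<in> U" for x y
  proof (rule ccontr)
    assume "x \<noteq> y"
    then have "\<exists>U V. openin T U \<and> openin T V \<and> x \<in> U \<and> y \<in> V \<and> disjnt U V"
      using \<open>Hausdorff_space T\<close> x y T(1) unfolding Hausdorff_space_def by simp
    then obtain U V where "openin T U" "openin T V" "x \<in> U" "y \<in> V" "disjnt U V" by auto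
    from B3[OF this(1,3)] obtain W where "W \<in> \<B>" "x \<in> W" "W \<subseteq> U" by auto
    moreover from this have "y \<in> W" using sep by simp
    ultimately show False using \<open>disjnt U V\<close> \<open>y \<in> V\<close> by (auto simp: disjnt_def)
  qed
  moreover have "\<B> \<subseteq> sets \<mu>" using B(2) T(4) by auto
  ultimately show ?thesis using B(1) by (intro exI[of _ \<B>]) auto
qed

lemma space_AP: "space (AP n) = {..<n} \<rightarrow>\<^sub>E space (haar \<Otimes>\<^sub>M \<mu>)" by (simp add: space_PiM)

lemma fibre_power_eq: "fibre_power \<G> n = {h \<in> space (AP n). \<forall>i<n. \<forall>j<n. act (fst (h i)) (snd (h i)) = act (fst (h j)) (snd (h j))}"
  by (simp add: fibre_power_def space_AP)

lemma sets_fibre_power: "fibre_power \<G> n \<in> sets (AP n)"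
proof -
  obtain \<O> where O: "countable \<O>" "\<O> \<subseteq> sets \<mu>"
    "\<forall>x\<in>space \<mu>. \<forall>y\<in>space \<mu>. (\<forall>U\<in>\<O>. x \<in> U \<longleftrightarrow> y \<in> U) \<longrightarrow> x = y"
    using separating_sets by auto
  let ?t = "\<lambda>h i. act (fst (h i)) (snd (h i))"
  have c: "(\<lambda>h. h i) \<in> AP n \<rightarrow>\<^sub>M haar \<Otimes>\<^sub>M \<mu>" if "i < n" for i by (rule measurable_component_singleton) (use that in simp)
  have t: "(\<lambda>h. ?t h i) \<in> AP n \<rightarrow>\<^sub>M \<mu>" if "i < n" for i
    by (rule measurable_compose[OF c[OF that] tgt_measurable])
  have iff: "?t h i = ?t h j \<longleftrightarrow> (\<forall>U\<in>\<O>. ?t h i \<in> U \<longleftrightarrow> ?t h j \<in> U)"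
    if h: "h \<in> space (AP n)" and i: "i < n" and j: "j < n" for h i j
    using O(3)[rule_format, OF measurable_space[OF t[OF i] h] measurable_space[OF t[OF j] h]] by metis
  have "fibre_power \<G> n = {h \<in> space (AP n). \<forall>i\<in>{..<n}. \<forall>j\<in>{..<n}. \<forall>U\<in>\<O>. ?t h i \<in> U \<longleftrightarrow> ?t h j \<in> U}"
    unfolding fibre_power_eq using iff by (intro Collect_cong conj_cong refl) (simp add: Ball_def)
  also have "\<dots> \<in> sets (AP n)"
  proof (intro sets.sets_Collect_countable_All' O(1) countable_finite[OF finite_lessThan])
    fix i j U assume "i \<in> {..<n}" "j \<in> {..<n}" "U \<in> \<O>"
    then have [measurable]: "(\<lambda>h. ?t h i) \<in> AP n \<rightarrow>\<^sub>M \<mu>" "(\<lambda>h. ?t h j) \<in> AP n \<rightarrow>\<^sub>M \<mu>" "U \<in> sets \<mu>" using t O(2) by auto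
    show "{h \<in> space (AP n). ?t h i \<in> U \<longleftrightarrow> ?t h j \<in> U} \<in> sets (AP n)" by measurable
  qed
  finally show ?thesis .
qed

text \<open>Boxes generate the product \<sigma>-algebra, and on a box the value is a finite product
  of measurable functions of x.\<close>

lemma measurable_PiM_\<kappa>: "(\<lambda>x. Pi\<^sub>M {..<n} (\<lambda>_. \<kappa> x)) \<in> \<sigma> \<rightarrow>\<^sub>M prob_algebra (AP n)"
proof (rule measurable_prob_algebra_generated[OF sets_PiM Int_stable_prod_algebra prod_algebra_sets_into_space])
  fix x assume "x \<in> space \<sigma>"
  then have x: "x \<in> space \<mu>" by simp
  show "prob_space (Pi\<^sub>M {..<n} (\<lambda>_. \<kappa> x))" by (intro prob_space_PiM prob_space_\<kappa>[OF x])
  show "sets (Pi\<^sub>M {..<n} (\<lambda>_. \<kappa> x)) = sets (AP n)" by (intro sets_PiM_cong refl sets_\<kappa>[OF x])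
next
  fix A assume "A \<in> prod_algebra {..<n} (\<lambda>_. haar \<Otimes>\<^sub>M \<mu>)"
  then obtain X where A: "A = Pi\<^sub>E {..<n} X" and X: "\<And>i. i < n \<Longrightarrow> X i \<in> sets (haar \<Otimes>\<^sub>M \<mu>)"
    by (auto simp: prod_algebra_eq_finite)
  have "emeasure (Pi\<^sub>M {..<n} (\<lambda>_. \<kappa> x)) A = (\<Prod>i<n. emeasure (\<kappa> x) (X i))" if "x \<in> space \<sigma>" for x
  proof -
    have x: "x \<in> space \<mu>" using that by simp
    interpret \<kappa>x: prob_space "\<kappa> x" by (rule prob_space_\<kappa>[OF x])
    interpret K: product_sigma_finite "\<lambda>_::nat. \<kappa> x" by unfold_locales
    show ?thesis unfolding A using X sets_\<kappa>[OF x] by (intro K.emeasure_PiM) auto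
  qed
  moreover have "(\<lambda>x. \<Prod>i<n. emeasure (\<kappa> x) (X i)) \<in> borel_measurable \<sigma>"
  proof (rule borel_measurable_prod_ennreal)
    fix i assume "i \<in> {..<n}"
    then show "(\<lambda>x. emeasure (\<kappa> x) (X i)) \<in> borel_measurable \<sigma>"
      using X by (intro measurable_compose[OF \<kappa>_measurable_subprob measurable_emeasure_subprob_algebra]) auto
  qed
  ultimately show "(\<lambda>x. emeasure (Pi\<^sub>M {..<n} (\<lambda>_. \<kappa> x)) A) \<in> borel_measurable \<sigma>"
    by (subst measurable_cong) auto
qed

abbreviation FM :: "nat \<Rightarrow> (nat \<Rightarrow> 'g \<times> 's) measure" where "FM n \<equiv> fibre_measure \<G> \<nu> \<kappa> n"

text \<open>The measure before its restriction to the fibre power, living on the product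
  \<sigma>-algebra of all n-tuples of arrows.\<close>

definition BM :: "nat \<Rightarrow> (nat \<Rightarrow> 'g \<times> 's) measure" where "BM n = Giry_Monad.bind \<sigma> (\<lambda>x. Pi\<^sub>M {..<n} (\<lambda>_. \<kappa> x))"

lemma FM_eq: "FM n = restrict_space (BM n) (fibre_power \<G> n)"
  by (simp add: fibre_measure_def BM_def)

lemma sets_BM: "sets (BM n) = sets (AP n)"
  unfolding BM_def by (rule sets_bind) (use measurable_space[OF measurable_PiM_\<kappa>, of _ n] \<sigma>.not_empty in \<open>auto simp: space_prob_algebra\<close>)

lemma space_BM: "space (BM n) = space (AP n)" by (rule sets_eq_imp_space_eq[OF sets_BM])

lemma space_FM: "space (FM n) = fibre_power \<G> n"
  unfolding FM_eq space_restrict_space space_BM using sets.sets_into_space[OF sets_fibre_power] by blast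

text \<open>Over a single x this is \<open>PiM_\<kappa>_null\<close>; the fibres are put together by
  \<open>AE_bind\<close> and Fubini.\<close>

lemma BM_null: assumes X: "X \<in> sets (AP n)"
  shows "X \<in> null_sets (BM n) \<longleftrightarrow> (AE z in GP n \<Otimes>\<^sub>M \<sigma>. \<Phi> n z \<notin> X)"
proof -
  interpret pair_sigma_finite "GP n" \<sigma> by (rule pair_sigma_finite_GP)
  have [measurable]: "X \<in> sets (AP n)" by fact
  obtain r where r[measurable]: "r \<in> borel_measurable (haar \<Otimes>\<^sub>M \<sigma>)"
    and d: "AE x in \<sigma>. distr (\<kappa> x) haar fst = density haar (\<lambda>a. r (a, x))"
    and p: "AE x in \<sigma>. AE a in haar. 0 < r (a, x)"
    by (rule \<kappa>_density)
  have "X \<in> null_sets (BM n) \<longleftrightarrow> (AE h in BM n. h \<notin> X)"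
    by (rule null_sets_iff_AE) (simp add: sets_BM X)
  also have "\<dots> \<longleftrightarrow> (AE x in \<sigma>. AE h in Pi\<^sub>M {..<n} (\<lambda>_. \<kappa> x). h \<notin> X)"
    unfolding BM_def by (rule AE_bind[OF measurable_prob_algebraD[OF measurable_PiM_\<kappa>]]) measurable
  also have "\<dots> \<longleftrightarrow> (AE x in \<sigma>. AE g in GP n. \<Phi> n (g, x) \<notin> X)"
  proof (rule eventually_subst)
    show "AE x in \<sigma>. (AE h in Pi\<^sub>M {..<n} (\<lambda>_. \<kappa> x). h \<notin> X) = (AE g in GP n. \<Phi> n (g, x) \<notin> X)"
      using d p \<kappa>_fibre AE_space
    proof eventually_elim
      case (elim x)
      then have x: "x \<in> space \<mu>" and x': "x \<in> space \<sigma>" by auto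
      have "sets (Pi\<^sub>M {..<n} (\<lambda>_. \<kappa> x)) = sets (AP n)" by (intro sets_PiM_cong refl sets_\<kappa>[OF x])
      then have X': "X \<in> sets (Pi\<^sub>M {..<n} (\<lambda>_. \<kappa> x))" using X by simp
      have "(\<lambda>a. r (a, x)) \<in> borel_measurable haar" using x' by measurable
      from PiM_\<kappa>_null[OF x this elim(1-3) X] show ?case
        using null_sets_iff_AE[OF X'] X' by (simp add: null_sets_def)
    qed
  qed
  also have "\<dots> \<longleftrightarrow> (AE g in GP n. AE x in \<sigma>. \<Phi> n (g, x) \<notin> X)"
    by (rule AE_commute[symmetric]) simp
  also have "\<dots> \<longleftrightarrow> (AE z in GP n \<Otimes>\<^sub>M \<sigma>. \<Phi> n z \<notin> X)"
    using AE_pair_iff[of "\<lambda>g x. \<Phi> n (g, x) \<notin> X"] by simp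
  finally show ?thesis .
qed

lemma measurable_\<Phi>_FM: "\<Phi> n \<in> GP n \<Otimes>\<^sub>M \<sigma> \<rightarrow>\<^sub>M FM n"
  unfolding FM_eq
proof (rule measurable_restrict_space2)
  show "\<Phi> n \<in> GP n \<Otimes>\<^sub>M \<sigma> \<rightarrow>\<^sub>M BM n" by (simp add: measurable_cong_sets[OF refl sets_BM] measurable_\<Phi>)
  show "\<Phi> n \<in> space (GP n \<Otimes>\<^sub>M \<sigma>) \<rightarrow> fibre_power \<G> n"
    using measurable_space[OF measurable_\<Phi>] unfolding fibre_power_eq
    by (auto simp: \<Phi>_def act_minus space_pair_measure)
qed

lemma measurable_\<Psi>: assumes n: "0 < n" shows "\<Psi> n \<in> FM n \<rightarrow>\<^sub>M GP n \<Otimes>\<^sub>M \<sigma>"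
proof -
  have c: "(\<lambda>h. h i) \<in> AP n \<rightarrow>\<^sub>M haar \<Otimes>\<^sub>M \<mu>" if "i < n" for i by (rule measurable_component_singleton) (use that in simp)
  have 1: "(\<lambda>h. \<lambda>i\<in>{..<n}. fst (h i)) \<in> AP n \<rightarrow>\<^sub>M GP n"
    by (intro measurable_restrict measurable_compose[OF c measurable_fst]) simp
  have 2: "(\<lambda>h. act (fst (h 0)) (snd (h 0))) \<in> AP n \<rightarrow>\<^sub>M \<sigma>"
    using measurable_compose[OF c[OF n] tgt_measurable] measurable_cong_sets[OF refl sets_\<sigma>] by auto
  have "\<Psi> n \<in> AP n \<rightarrow>\<^sub>M GP n \<Otimes>\<^sub>M \<sigma>" unfolding \<Psi>_def[abs_def] by (intro measurable_Pair 1 2)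
  then have "\<Psi> n \<in> BM n \<rightarrow>\<^sub>M GP n \<Otimes>\<^sub>M \<sigma>" by (simp add: measurable_cong_sets[OF sets_BM refl])
  then show ?thesis unfolding FM_eq by (rule measurable_restrict_space1)
qed

lemma \<Psi>_\<Phi>: "0 < n \<Longrightarrow> z \<in> space (GP n \<Otimes>\<^sub>M \<sigma>) \<Longrightarrow> \<Psi> n (\<Phi> n z) = z"
  by (cases z) (auto simp: \<Psi>_def \<Phi>_def act_minus space_pair_measure space_PiM PiE_iff extensional_def fun_eq_iff)

lemma \<Phi>_\<Psi>: assumes n: "0 < n" and h: "h \<in> space (FM n)" shows "\<Phi> n (\<Psi> n h) = h"
proof
  fix i
  have h': "h \<in> space (AP n)" "\<And>i j. i < n \<Longrightarrow> j < n \<Longrightarrow> act (fst (h i)) (snd (h i)) = act (fst (h j)) (snd (h j))"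
    using h unfolding space_FM fibre_power_eq by blast+
  show "\<Phi> n (\<Psi> n h) i = h i"
  proof (cases "i < n")
    case True
    then have "snd (h i) \<in> space \<mu>" using h'(1) by (auto simp: space_PiM space_pair_measure PiE_iff mem_Times_iff)
    then show ?thesis using True h'(2)[OF n True] by (simp add: \<Phi>_def \<Psi>_def act_minus prod_eq_iff)
  next
    case False
    then show ?thesis using h'(1) by (auto simp: \<Phi>_def \<Psi>_def space_PiM PiE_iff extensional_def)
  qed
qed

lemma null_sets_FM: "X \<in> null_sets (FM n) \<longleftrightarrow> X \<subseteq> fibre_power \<G> n \<and> X \<in> null_sets (BM n)"
  unfolding FM_eq by (rule null_sets_restrict_space) (simp add: sets_BM sets_fibre_power)

text \<open>\<Phi> and \<Psi> are mutually inverse and both nonsingular, so they identify the two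
  measure classes. Almost everywhere statements about groupoid cochains move to G^n \<times> S
  through this equivalence.\<close>

lemma AE_FM_iff:
  assumes n: "0 < n"
  shows "(AE h in FM n. R h) \<longleftrightarrow> (AE z in GP n \<Otimes>\<^sub>M \<sigma>. R (\<Phi> n z))"
proof
  assume R: "AE h in FM n. R h"
  show "AE z in GP n \<Otimes>\<^sub>M \<sigma>. R (\<Phi> n z)"
  proof (rule nonsingular_AE[OF measurable_\<Phi>_FM _ R])
    fix X assume "X \<in> null_sets (FM n)"
    then have "X \<in> null_sets (BM n)" by (simp add: null_sets_FM)
    then show "AE z in GP n \<Otimes>\<^sub>M \<sigma>. \<Phi> n z \<notin> X" using BM_null[of X n] sets_BM by (auto dest: null_setsD2)
  qed
next
  assume R: "AE z in GP n \<Otimes>\<^sub>M \<sigma>. R (\<Phi> n z)"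
  have "AE h in FM n. R (\<Phi> n (\<Psi> n h))"
  proof (rule nonsingular_AE[OF measurable_\<Psi>[OF n] _ R])
    fix Y assume Y: "Y \<in> null_sets (GP n \<Otimes>\<^sub>M \<sigma>)"
    let ?X = "\<Psi> n -` Y \<inter> space (FM n)"
    have "?X \<in> sets (FM n)" using Y by (intro measurable_sets[OF measurable_\<Psi>[OF n]]) auto
    then have X: "?X \<in> sets (AP n)"
      unfolding FM_eq by (subst (asm) sets_restrict_space_iff) (auto simp: sets_BM sets_fibre_power)
    have "AE z in GP n \<Otimes>\<^sub>M \<sigma>. z \<notin> Y" using Y by (rule AE_not_in)
    then have "AE z in GP n \<Otimes>\<^sub>M \<sigma>. \<Phi> n z \<notin> ?X"
      using AE_space by eventually_elim (simp add: \<Psi>_\<Phi>[OF n])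
    then have "?X \<in> null_sets (FM n)" using BM_null[OF X] by (simp add: null_sets_FM space_FM)
    then have "AE h in FM n. h \<notin> ?X" by (rule AE_not_in)
    then show "AE h in FM n. \<Psi> n h \<notin> Y" using AE_space by eventually_elim auto
  qed
  then show "AE h in FM n. R h" using AE_space by eventually_elim (simp add: \<Phi>_\<Psi>[OF n])
qed

end

section \<open>Invariant cochains\<close>

text \<open>The vector moves with t, as \<open>\<rho> (- g)\<close> applied to d moves with g.
  Approximating \<open>v\<close> by simple functions leaves fixed vectors on measurable
  pieces.\<close>

lemma weak_apply_measurable:
  fixes f :: "'t \<Rightarrow> ('v::{real_normed_vector, second_countable_topology} \<Rightarrow>\<^sub>L real)"
  assumes f: "\<And>v. (\<lambda>t. blinfun_apply (f t) v) \<in> borel_measurable M" and v: "v \<in> borel_measurable M"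
  shows "(\<lambda>t. blinfun_apply (f t) (v t)) \<in> borel_measurable M"
proof -
  obtain s where s: "\<And>i. simple_function M (s i)" "\<And>t. t \<in> space M \<Longrightarrow> (\<lambda>i. s i t) \<longlonglongrightarrow> v t"
    using borel_measurable_implies_sequence_metric[OF v, of 0] by blast
  show ?thesis
  proof (rule borel_measurable_LIMSEQ_real)
    show "(\<lambda>i. blinfun_apply (f t) (s i t)) \<longlonglongrightarrow> blinfun_apply (f t) (v t)" if "t \<in> space M" for t
      using s(2)[OF that] by (intro tendsto_intros)
    fix i
    have fin: "finite (s i ` space M)" using s(1) by (auto simp: simple_function_def)
    have "(\<lambda>t. \<Sum>y\<in>s i ` space M. indicator (s i -` {y} \<inter> space M) t * blinfun_apply (f t) y) \<in> borel_measurable M"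
      using f s(1) by (intro borel_measurable_sum borel_measurable_times borel_measurable_indicator) (auto simp: simple_function_def)
    moreover have "(\<Sum>y\<in>s i ` space M. indicator (s i -` {y} \<inter> space M) t * blinfun_apply (f t) y) = blinfun_apply (f t) (s i t)"
      if t: "t \<in> space M" for t
    proof -
      have "(\<Sum>y\<in>s i ` space M. indicator (s i -` {y} \<inter> space M) t * blinfun_apply (f t) y)
        = (\<Sum>y\<in>s i ` space M. if y = s i t then blinfun_apply (f t) y else 0)"
        using t by (intro sum.cong) (auto simp: indicator_def)
      then show ?thesis using fin t by (simp add: sum.delta)
    qed
    ultimately show "(\<lambda>t. blinfun_apply (f t) (s i t)) \<in> borel_measurable M"
      by (subst measurable_cong[where g="\<lambda>t. \<Sum>y\<in>s i ` space M. indicator (s i -` {y} \<inter> space M) t * blinfun_apply (f t) y"]) auto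
  qed
qed

section \<open>Groupoid invariance in coordinates and exactness\<close>

locale amenable_setting = semidirect_setting haar \<mu> act \<nu> \<kappa>
  for haar :: "'g::{topological_group_add, t2_space, second_countable_topology} measure"
    and \<mu> :: "'s measure" and act and \<nu> and \<kappa> +
  fixes P and \<rho> :: "'g \<Rightarrow> 'v::{real_normed_vector, second_countable_topology} \<Rightarrow>\<^sub>L 'v"
  assumes P: "equivariant_conditional_expectation haar \<mu> act P"
    and \<rho>: "continuous_isometric_rep \<rho>"
begin

interpretation A: amenable_action haar \<sigma> P act by (rule amenable_action_\<sigma>[OF P])

abbreviation L :: "'g \<times> 's \<Rightarrow> ('v \<Rightarrow>\<^sub>L real) \<Rightarrow> ('v \<Rightarrow>\<^sub>L real)" where "L \<equiv> (\<lambda>(g, x). contragredient \<rho> g)"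

abbreviation invariant :: "nat \<Rightarrow> ((nat \<Rightarrow> 'g \<times> 's) \<Rightarrow> ('v \<Rightarrow>\<^sub>L real)) \<Rightarrow> bool" where
  "invariant \<equiv> groupoid_invariant \<G> \<nu> \<kappa> L"

lemma \<rho>_norm: "norm (blinfun_apply (\<rho> g) v) = norm v"
  using \<rho> by (auto simp: continuous_isometric_rep_def)

lemma \<rho>_measurable: "(\<lambda>g. blinfun_apply (\<rho> g) v) \<in> borel_measurable borel"
  using \<rho> by (auto simp: continuous_isometric_rep_def intro!: borel_measurable_continuous_onI)

lemma omit_\<Phi>: "i \<le> n \<Longrightarrow> omit n i (\<Phi> (Suc n) z) = \<Phi> n (omit n i (fst z), snd z)"
  by (auto simp: omit_def \<Phi>_def fun_eq_iff)

lemma AE_FM_omit: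
  assumes n: "0 < n" and i: "i \<le> n" and R: "AE h in FM n. R h" shows "AE h in FM (Suc n). R (omit n i h)"
proof -
  have "AE z in GP n \<Otimes>\<^sub>M \<sigma>. R (\<Phi> n z)" using R AE_FM_iff[OF n] by simp
  from A.AE_omit[OF i this] show ?thesis by (simp add: AE_FM_iff omit_\<Phi>[OF i])
qed

lemma measurable_omit_FM: assumes i: "i \<le> n" shows "omit n i \<in> FM (Suc n) \<rightarrow>\<^sub>M FM n"
  unfolding FM_eq
proof (rule measurable_restrict_space3)
  show "omit n i \<in> BM (Suc n) \<rightarrow>\<^sub>M BM n"
    using measurable_omit[OF i] by (simp add: measurable_cong_sets[OF sets_BM sets_BM])
  show "omit n i \<in> fibre_power \<G> (Suc n) \<rightarrow> fibre_power \<G> n"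
  proof
    fix h assume h: "h \<in> fibre_power \<G> (Suc n)"
    have "omit n i h \<in> {..<n} \<rightarrow>\<^sub>E space (arrows \<G>)"
      using h unfolding fibre_power_def omit_def by (intro PiE_I) auto
    moreover have "tgt \<G> (omit n i h j) = tgt \<G> (omit n i h l)" if "j < n" "l < n" for j l
      using h that unfolding fibre_power_def omit_def by auto
    ultimately show "omit n i h \<in> fibre_power \<G> n" unfolding fibre_power_def by blast
  qed
qed

lemma coboundary_omit: "homogeneous_coboundary k u h = (\<Sum>i\<le>Suc k. (-1) ^ i *\<^sub>R u (omit (Suc k) i h))"
  by (simp add: homogeneous_coboundary_def omit_def)

text \<open>The action of g on functions on G^n \<times> S with values in E: diagonal on the
  arguments, and composed with \<open>\<rho> (- g)\<close> because the action on E is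
  contragredient.\<close>

definition twist :: "nat \<Rightarrow> ((nat \<Rightarrow> 'g) \<times> 's \<Rightarrow> ('v \<Rightarrow>\<^sub>L real)) \<Rightarrow> 'g \<Rightarrow> (nat \<Rightarrow> 'g) \<times> 's \<Rightarrow> ('v \<Rightarrow>\<^sub>L real)" where
  "twist n U g y = U (translate n (- g) (fst y), act (- g) (snd y)) o\<^sub>L \<rho> (- g)"

text \<open>In the coordinates \<open>\<Phi>\<close>, left multiplication by an arrow with group component \<open>g\<close> is the diagonal
  action of \<open>g\<close>, so that groupoid invariance becomes invariance under almost every group element.\<close>

lemma invariant_iff_twist:
  assumes n: "0 < n"
  shows "invariant n u \<longleftrightarrow>
    (AE z in GP (Suc n) \<Otimes>\<^sub>M \<sigma>. twist n (u \<circ> \<Phi> n) (fst z 0) (omit n 0 (fst z), snd z) = u (\<Phi> n (omit n 0 (fst z), snd z)))"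
  unfolding groupoid_invariant_def AE_FM_iff[OF zero_less_Suc]
proof (rule AE_cong)
  fix z assume z: "z \<in> space (GP (Suc n) \<Otimes>\<^sub>M \<sigma>)"
  obtain h x where zx: "z = (h, x)" and x: "x \<in> space \<mu>" using z by (cases z) (auto simp: space_pair_measure)
  \<comment> \<open>Multiplying an arrow on the left by the inverse of arrow 0 keeps its source; in
    coordinates over the moved base point this is the following equality.\<close>
  have a: "act (- (- h 0 + h (Suc i))) (act (- h 0) x) = act (- h (Suc i)) x" for i
    by (simp add: act_add[OF x, symmetric] minus_add add.assoc)
  have 1: "(\<lambda>i\<in>{..<n}. gmult \<G> (ginv \<G> (\<Phi> (Suc n) z 0)) (\<Phi> (Suc n) z (Suc i))) =
      \<Phi> n (translate n (- h 0) (omit n 0 h), act (- h 0) x)"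
    by (auto simp: fun_eq_iff \<Phi>_def translate_def omit_def zx a simp del: minus_add_distrib minus_add)
  have 2: "(\<lambda>i\<in>{..<n}. \<Phi> (Suc n) z (Suc i)) = \<Phi> n (omit n 0 h, x)"
    by (auto simp: fun_eq_iff \<Phi>_def omit_def zx)
  have 3: "L (\<Phi> (Suc n) z 0) \<xi> = \<xi> o\<^sub>L \<rho> (- h 0)" for \<xi>
    by (simp add: \<Phi>_def zx contragredient_def)
  show "(L (\<Phi> (Suc n) z 0) (u (\<lambda>i\<in>{..<n}. gmult \<G> (ginv \<G> (\<Phi> (Suc n) z 0)) (\<Phi> (Suc n) z (Suc i)))) =
      u (\<lambda>i\<in>{..<n}. \<Phi> (Suc n) z (Suc i))) =
     (twist n (u \<circ> \<Phi> n) (fst z 0) (omit n 0 (fst z), snd z) = u (\<Phi> n (omit n 0 (fst z), snd z)))"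
    unfolding 1 2 3 by (simp add: twist_def zx)
qed

lemma invariantD:
  assumes n: "0 < n" and u: "invariant n u"
  shows "AE g in haar. AE y in GP n \<Otimes>\<^sub>M \<sigma>. twist n (u \<circ> \<Phi> n) g y = u (\<Phi> n y)"
  using A.AE_first[of "\<lambda>g y. twist n (u \<circ> \<Phi> n) g y = u (\<Phi> n y)" n] u
  unfolding invariant_iff_twist[OF n] by simp

text \<open>Returning from almost every g to almost every tuple needs a measurable set of equality.
  A countable dense set of vectors and \<open>weak_apply_measurable\<close> provide it.\<close>

lemma invariantI:
  assumes n: "0 < n" and W: "\<And>v. (\<lambda>y. blinfun_apply (W y) v) \<in> borel_measurable (GP n \<Otimes>\<^sub>M \<sigma>)"
    and inv: "AE g in haar. AE y in GP n \<Otimes>\<^sub>M \<sigma>. twist n W g y = W y"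
  shows "invariant n (W \<circ> \<Psi> n)"
proof -
  obtain D :: "'v set" where D: "countable D" "closure D = UNIV" by (rule countable_dense_closure)
  have [measurable]: "(\<lambda>p. blinfun_apply (twist n W (fst p) (snd p)) d) \<in> borel_measurable (haar \<Otimes>\<^sub>M GP n \<Otimes>\<^sub>M \<sigma>)" for d
  proof -
    have t: "(\<lambda>p. (translate n (- fst p) (fst (snd p)), act (- fst p) (snd (snd p)))) \<in> haar \<Otimes>\<^sub>M GP n \<Otimes>\<^sub>M \<sigma> \<rightarrow>\<^sub>M GP n \<Otimes>\<^sub>M \<sigma>"
      by measurable
    have r: "(\<lambda>p. blinfun_apply (\<rho> (- fst p)) d) \<in> borel_measurable (haar \<Otimes>\<^sub>M GP n \<Otimes>\<^sub>M \<sigma>)"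
      by (rule measurable_compose[OF _ \<rho>_measurable]) measurable
    show ?thesis
      using weak_apply_measurable[OF measurable_compose[OF t W] r] by (simp add: twist_def)
  qed
  have [measurable]: "(\<lambda>p. blinfun_apply (W (snd p)) d) \<in> borel_measurable (haar \<Otimes>\<^sub>M GP n \<Otimes>\<^sub>M \<sigma>)" for d
    by (rule measurable_compose[OF measurable_snd W])
  have eq: "\<xi> = \<zeta> \<longleftrightarrow> (\<forall>d\<in>D. blinfun_apply \<xi> d = blinfun_apply \<zeta> d)" for \<xi> \<zeta> :: "'v \<Rightarrow>\<^sub>L real"
    using blinfun_eq_dense[OF D(2)] by blast
  have "AE p in haar \<Otimes>\<^sub>M GP n \<Otimes>\<^sub>M \<sigma>. twist n W (fst p) (snd p) = W (snd p)"
  proof (rule A.Q.G_HS.AE_pair_measure)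
    show "{p \<in> space (haar \<Otimes>\<^sub>M GP n \<Otimes>\<^sub>M \<sigma>). twist n W (fst p) (snd p) = W (snd p)} \<in> sets (haar \<Otimes>\<^sub>M GP n \<Otimes>\<^sub>M \<sigma>)"
      unfolding eq by (intro sets.sets_Collect_countable_All' D(1)) measurable
  qed (use inv in simp)
  from A.AE_split_first[OF this]
  have "AE z in GP (Suc n) \<Otimes>\<^sub>M \<sigma>. twist n W (fst z 0) (omit n 0 (fst z), snd z) = W (omit n 0 (fst z), snd z)"
    by simp
  then have "AE z in GP (Suc n) \<Otimes>\<^sub>M \<sigma>. twist n ((W \<circ> \<Psi> n) \<circ> \<Phi> n) (fst z 0) (omit n 0 (fst z), snd z) = (W \<circ> \<Psi> n) (\<Phi> n (omit n 0 (fst z), snd z))"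
    using AE_space
  proof eventually_elim
    case (elim z)
    have 1: "(omit n 0 (fst z), snd z) \<in> space (GP n \<Otimes>\<^sub>M \<sigma>)"
      using elim(2) measurable_space[OF measurable_omit[of 0 n haar]] by (auto simp: space_pair_measure)
    then have 2: "(translate n (- fst z 0) (omit n 0 (fst z)), act (- fst z 0) (snd z)) \<in> space (GP n \<Otimes>\<^sub>M \<sigma>)"
      by (auto simp: space_pair_measure space_PiM translate_def act_space)
    show ?case using elim(1) by (simp add: twist_def \<Psi>_\<Phi>[OF n 1] \<Psi>_\<Phi>[OF n 2])
  qed
  then show ?thesis unfolding invariant_iff_twist[OF n] .
qed

text \<open>The cochain is carried to G^n \<times> S by \<Phi> and replaced there by a
  representative bounded everywhere; the primitive is carried back by \<Psi>.\<close>

theorem exactness: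
  fixes u :: "(nat \<Rightarrow> 'g \<times> 's) \<Rightarrow> ('v \<Rightarrow>\<^sub>L real)"
  assumes u: "u \<in> Linf_weak_star (FM (Suc (Suc j)))" and inv: "invariant (Suc (Suc j)) u"
    and cocycle: "AE h in FM (Suc (Suc (Suc j))). homogeneous_coboundary (Suc j) u h = 0"
  obtains w where "w \<in> Linf_weak_star (FM (Suc j))" "invariant (Suc j) w"
    "AE h in FM (Suc (Suc j)). homogeneous_coboundary j w h = u h"
proof -
  \<comment> \<open>The number of arguments of the primitive; being positive, it makes
    \<open>\<Psi> n\<close> the inverse of \<open>\<Phi> n\<close>.\<close>
  define n where "n = Suc j"
  have n: "0 < n" by (simp add: n_def)
  have u': "u \<in> Linf_weak_star (FM (Suc n))" and inv': "invariant (Suc n) u"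
    and cocycle': "AE h in FM (Suc (Suc n)). homogeneous_coboundary n u h = 0"
    using u inv cocycle by (simp_all only: n_def)
  have "u \<circ> \<Phi> (Suc n) \<in> Linf_weak_star (GP (Suc n) \<Otimes>\<^sub>M \<sigma>)"
  proof -
    obtain c where c: "AE h in FM (Suc n). norm (u h) \<le> c" using u' by (auto simp: Linf_weak_star_def)
    have "AE z in GP (Suc n) \<Otimes>\<^sub>M \<sigma>. norm (u (\<Phi> (Suc n) z)) \<le> c" using c by (simp add: AE_FM_iff)
    moreover have "(\<lambda>z. blinfun_apply (u (\<Phi> (Suc n) z)) v) \<in> borel_measurable (GP (Suc n) \<Otimes>\<^sub>M \<sigma>)" for v
      using u' by (intro measurable_compose[OF measurable_\<Phi>_FM]) (auto simp: Linf_weak_star_def)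
    ultimately show ?thesis by (auto simp: Linf_weak_star_def)
  qed
  then obtain c U where c: "0 \<le> c" and U: "weak_bounded (GP (Suc n) \<Otimes>\<^sub>M \<sigma>) c U"
    and uU: "AE z in GP (Suc n) \<Otimes>\<^sub>M \<sigma>. (u \<circ> \<Phi> (Suc n)) z = U z"
    by (rule Linf_weak_star_weak_bounded)
  have "AE z in GP (Suc (Suc n)) \<Otimes>\<^sub>M \<sigma>. homogeneous_coboundary n u (\<Phi> (Suc (Suc n)) z) = 0"
    using cocycle' by (simp add: AE_FM_iff)
  moreover have "AE z in GP (Suc (Suc n)) \<Otimes>\<^sub>M \<sigma>. \<forall>i\<in>{..Suc n}.
      u (\<Phi> (Suc n) (omit (Suc n) i (fst z), snd z)) = U (omit (Suc n) i (fst z), snd z)"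
    using A.AE_omit[OF _ uU] by (subst AE_ball_countable) auto
  ultimately have "AE z in GP (Suc (Suc n)) \<Otimes>\<^sub>M \<sigma>. (\<Sum>i\<le>Suc n. (-1) ^ i *\<^sub>R U (omit (Suc n) i (fst z), snd z)) = 0"
  proof eventually_elim
    case (elim z)
    have "(\<Sum>i\<le>Suc n. (-1) ^ i *\<^sub>R U (omit (Suc n) i (fst z), snd z)) = homogeneous_coboundary n u (\<Phi> (Suc (Suc n)) z)"
      unfolding coboundary_omit by (rule sum.cong) (use elim(2) in \<open>auto simp: omit_\<Phi>\<close>)
    then show ?case using elim(1) by simp
  qed
  from A.cocycle_is_coboundary[OF U c this]
  obtain W where W: "weak_bounded (GP n \<Otimes>\<^sub>M \<sigma>) c W"
    and cob: "AE z in GP (Suc n) \<Otimes>\<^sub>M \<sigma>. (\<Sum>i\<le>n. (-1) ^ i *\<^sub>R W (omit n i (fst z), snd z)) = U z"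
    and tw: "\<And>g r. (\<And>v. norm (blinfun_apply r v) = norm v) \<Longrightarrow>
       AE z in GP (Suc n) \<Otimes>\<^sub>M \<sigma>. U (translate (Suc n) (- g) (fst z), act (- g) (snd z)) o\<^sub>L r = U z \<Longrightarrow>
       AE z in GP n \<Otimes>\<^sub>M \<sigma>. W (translate n (- g) (fst z), act (- g) (snd z)) o\<^sub>L r = W z"
    by blast
  have Wm: "(\<lambda>y. blinfun_apply (W y) v) \<in> borel_measurable (GP n \<Otimes>\<^sub>M \<sigma>)" for v using W by (auto simp: weak_bounded_def)
  \<comment> \<open>Every g under which \<open>u\<close> is invariant works for \<open>W\<close> as
    well.\<close>
  have "AE g in haar. AE y in GP n \<Otimes>\<^sub>M \<sigma>. twist n W g y = W y"
    using invariantD[OF zero_less_Suc inv']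
  proof (rule AE_mp[OF _ AE_I2])
    fix g
    show "(AE y in GP (Suc n) \<Otimes>\<^sub>M \<sigma>. twist (Suc n) (u \<circ> \<Phi> (Suc n)) g y = u (\<Phi> (Suc n) y)) \<longrightarrow>
        (AE y in GP n \<Otimes>\<^sub>M \<sigma>. twist n W g y = W y)"
    proof
      assume *: "AE y in GP (Suc n) \<Otimes>\<^sub>M \<sigma>. twist (Suc n) (u \<circ> \<Phi> (Suc n)) g y = u (\<Phi> (Suc n) y)"
      \<comment> \<open>\<open>U\<close> agrees with \<open>u\<close> in coordinates only almost
        everywhere; as translation is nonsingular, so do their translates.\<close>
      have "AE z in GP (Suc n) \<Otimes>\<^sub>M \<sigma>. U (translate (Suc n) (- g) (fst z), act (- g) (snd z)) o\<^sub>L \<rho> (- g) = U z"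
        using * uU A.AE_translate[OF uU, of "- g"] by eventually_elim (simp add: twist_def)
      from tw[OF \<rho>_norm this] show "AE y in GP n \<Otimes>\<^sub>M \<sigma>. twist n W g y = W y" by (simp add: twist_def)
    qed
  qed
  from invariantI[OF n Wm this] have "invariant n (W \<circ> \<Psi> n)" .
  moreover have "W \<circ> \<Psi> n \<in> Linf_weak_star (FM n)"
    using weak_bounded_Linf[OF weak_bounded_comp[OF W measurable_\<Psi>[OF n]]] by (simp add: comp_def)
  moreover have "AE h in FM (Suc n). homogeneous_coboundary j (W \<circ> \<Psi> n) h = u h"
    unfolding AE_FM_iff[OF zero_less_Suc]
    using cob uU AE_space
  proof eventually_elim
    case (elim z)
    have "homogeneous_coboundary j (W \<circ> \<Psi> n) (\<Phi> (Suc n) z) = (\<Sum>i\<le>n. (-1) ^ i *\<^sub>R W (omit n i (fst z), snd z))"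
      unfolding coboundary_omit n_def[symmetric]
    proof (rule sum.cong[OF refl])
      fix i assume "i \<in> {..n}"
      then have i: "i \<le> n" by simp
      have "(omit n i (fst z), snd z) \<in> space (GP n \<Otimes>\<^sub>M \<sigma>)"
        using elim(3) measurable_space[OF measurable_omit[OF i, of haar]] by (auto simp: space_pair_measure)
      then show "(-1) ^ i *\<^sub>R (W \<circ> \<Psi> n) (omit n i (\<Phi> (Suc n) z)) = (-1) ^ i *\<^sub>R W (omit n i (fst z), snd z)"
        by (simp add: omit_\<Phi>[OF i] \<Psi>_\<Phi>[OF n])
    qed
    then show ?case using elim(1,2) by simp
  qed
  ultimately show ?thesis using that unfolding n_def by blast
qed

end

section \<open>Cohomology classes\<close>

text \<open>The coset of \<open>f\<close> modulo null functions, written without the group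
  structure.\<close>

definition Linf_class :: "'t measure \<Rightarrow> ('t \<Rightarrow> ('v::real_normed_vector \<Rightarrow>\<^sub>L real)) \<Rightarrow> ('t \<Rightarrow> ('v \<Rightarrow>\<^sub>L real)) set" where
  "Linf_class M f = {f' \<in> Linf_weak_star M. AE t in M. f' t = f t}"

lemma Linf_weak_star_zero: "(\<lambda>_. 0) \<in> Linf_weak_star M"
  by (auto simp: Linf_weak_star_def intro!: exI[of _ 0])

lemma Linf_weak_star_add:
  assumes f: "f \<in> Linf_weak_star M" and g: "g \<in> Linf_weak_star M"
  shows "(\<lambda>t. f t + g t) \<in> Linf_weak_star M"
proof -
  obtain c d where "AE t in M. norm (f t) \<le> c" "AE t in M. norm (g t) \<le> d"
    using f g by (auto simp: Linf_weak_star_def)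
  then have "AE t in M. norm (f t + g t) \<le> c + d" by eventually_elim (rule norm_triangle_mono)
  moreover have "(\<lambda>t. blinfun_apply (f t + g t) v) \<in> borel_measurable M" for v
    using f g by (auto simp: Linf_weak_star_def blinfun.add_left intro!: borel_measurable_add)
  ultimately show ?thesis by (auto simp: Linf_weak_star_def)
qed

lemma Linf_weak_star_scaleR:
  assumes f: "f \<in> Linf_weak_star M" shows "(\<lambda>t. r *\<^sub>R f t) \<in> Linf_weak_star M"
proof -
  obtain c where "AE t in M. norm (f t) \<le> c" using f by (auto simp: Linf_weak_star_def)
  then have "AE t in M. norm (r *\<^sub>R f t) \<le> \<bar>r\<bar> * c" by eventually_elim (simp add: mult_left_mono)
  moreover have "(\<lambda>t. blinfun_apply (r *\<^sub>R f t) v) \<in> borel_measurable M" for v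
    using f by (auto simp: Linf_weak_star_def blinfun.scaleR_left intro!: borel_measurable_times)
  ultimately show ?thesis by (auto simp: Linf_weak_star_def)
qed

lemma Linf_weak_star_uminus: "f \<in> Linf_weak_star M \<Longrightarrow> (\<lambda>t. - f t) \<in> Linf_weak_star M"
  using Linf_weak_star_scaleR[of f M "-1"] by simp

lemma Linf_weak_star_sum:
  "finite I \<Longrightarrow> (\<And>i. i \<in> I \<Longrightarrow> f i \<in> Linf_weak_star M) \<Longrightarrow> (\<lambda>t. \<Sum>i\<in>I. f i t) \<in> Linf_weak_star M"
  by (induction I rule: finite_induct) (auto intro: Linf_weak_star_add Linf_weak_star_zero)

lemma Linf_class_eqI: "AE t in M. f t = g t \<Longrightarrow> Linf_class M f = Linf_class M g"
  unfolding Linf_class_def by (intro Collect_cong conj_cong refl eventually_subst) (auto elim!: eventually_mono)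

lemma Linf_class_self: "f \<in> Linf_weak_star M \<Longrightarrow> f \<in> Linf_class M f"
  by (simp add: Linf_class_def)

lemma Linf_class_memD: "u \<in> Linf_class M f \<Longrightarrow> Linf_class M u = Linf_class M f \<and> u \<in> Linf_weak_star M"
  using Linf_class_eqI[of u f M] by (auto simp: Linf_class_def)

section \<open>The quotient group of classes\<close>

context
  fixes M :: "'t measure" and dummy :: "'v::real_normed_vector itself"
begin

text \<open>The group of representatives before the quotient. The parameter \<open>dummy\<close> of
  the context serves to fix the type of the predual.\<close>

private definition A where "A = \<lparr>carrier = Linf_weak_star M :: ('t \<Rightarrow> ('v \<Rightarrow>\<^sub>L real)) set,
  monoid.mult = (\<lambda>f f' t. f t + f' t), one = (\<lambda>_. 0)\<rparr>"

private definition N where "N = {f \<in> Linf_weak_star M. AE t in M. f t = (0 :: 'v \<Rightarrow>\<^sub>L real)}"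

private lemma D_eq: "Linf_weak_star_group M = A Mod N"
  by (simp add: Linf_weak_star_group_def A_def N_def)

private lemma comm_group_A: "comm_group A"
proof (rule comm_groupI)
  fix f assume f: "f \<in> carrier A"
  show "\<exists>g\<in>carrier A. g \<otimes>\<^bsub>A\<^esub> f = \<one>\<^bsub>A\<^esub>"
    using f Linf_weak_star_uminus[of f M] by (intro bexI[of _ "\<lambda>t. - f t"]) (auto simp: A_def)
qed (auto simp: A_def Linf_weak_star_add Linf_weak_star_zero add.assoc add.commute)

private lemma normal_N: "N \<lhd> A"
proof -
  interpret comm_group A by (rule comm_group_A)
  have "subgroup N A"
  proof (rule subgroupI)
    show "N \<subseteq> carrier A" by (auto simp: N_def A_def)
    show "N \<noteq> {}" using Linf_weak_star_zero by (auto simp: N_def)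
    fix f assume f: "f \<in> N"
    have "inv\<^bsub>A\<^esub> f = (\<lambda>t. - f t)"
      using f Linf_weak_star_uminus[of f M] by (intro inv_equality) (auto simp: A_def N_def)
    then show "inv\<^bsub>A\<^esub> f \<in> N" using f Linf_weak_star_uminus[of f M] by (auto simp: N_def)
    fix g assume g: "g \<in> N"
    have "AE t in M. f t = 0" "AE t in M. g t = 0" using f g by (auto simp: N_def)
    then have "AE t in M. f t + g t = 0" by eventually_elim simp
    then show "f \<otimes>\<^bsub>A\<^esub> g \<in> N" using f g Linf_weak_star_add by (auto simp: N_def A_def)
  qed
  then show ?thesis by (rule subgroup_imp_normal)
qed

private lemma coset_N: assumes f: "f \<in> Linf_weak_star M" shows "N #>\<^bsub>A\<^esub> f = Linf_class M f"
proof (intro equalityI subsetI)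
  fix g assume "g \<in> N #>\<^bsub>A\<^esub> f"
  then obtain h where h: "h \<in> N" "g = (\<lambda>t. h t + f t)" by (auto simp: r_coset_def A_def)
  then have "AE t in M. h t = 0" by (auto simp: N_def)
  then have "AE t in M. g t = f t" by eventually_elim (simp add: h)
  then show "g \<in> Linf_class M f" using h f Linf_weak_star_add by (auto simp: Linf_class_def N_def)
next
  fix g assume g: "g \<in> Linf_class M f"
  then have "AE t in M. g t = f t" by (auto simp: Linf_class_def)
  then have "AE t in M. g t + - f t = 0" by eventually_elim simp
  moreover have "(\<lambda>t. g t + - f t) \<in> Linf_weak_star M"
    using g f by (intro Linf_weak_star_add Linf_weak_star_uminus) (auto simp: Linf_class_def)
  ultimately have "(\<lambda>t. g t + - f t) \<in> N" by (simp add: N_def)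
  then show "g \<in> N #>\<^bsub>A\<^esub> f"
    unfolding r_coset_def by (auto simp: A_def intro!: bexI[of _ "\<lambda>t. g t + - f t"])
qed

lemma group_Linf_weak_star_group: "group (Linf_weak_star_group M :: ('t \<Rightarrow> ('v \<Rightarrow>\<^sub>L real)) set monoid)"
  unfolding D_eq by (rule normal.factorgroup_is_group[OF normal_N])

lemma carrier_Linf_weak_star_group: "carrier (Linf_weak_star_group M) = Linf_class M ` (Linf_weak_star M :: ('t \<Rightarrow> ('v \<Rightarrow>\<^sub>L real)) set)"
proof -
  have "carrier A = Linf_weak_star M" by (simp add: A_def)
  then show ?thesis unfolding D_eq carrier_FactGroup by (intro image_cong) (auto simp: coset_N)
qed

lemma one_Linf_weak_star_group: "\<one>\<^bsub>Linf_weak_star_group M\<^esub> = Linf_class M (\<lambda>_. 0 :: 'v \<Rightarrow>\<^sub>L real)"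
  unfolding D_eq by (simp add: N_def Linf_class_def)

lemma mult_Linf_weak_star_group:
  fixes f g :: "'t \<Rightarrow> ('v \<Rightarrow>\<^sub>L real)"
  assumes "f \<in> Linf_weak_star M" "g \<in> Linf_weak_star M"
  shows "Linf_class M f \<otimes>\<^bsub>Linf_weak_star_group M\<^esub> Linf_class M g = Linf_class M (\<lambda>t. f t + g t)"
proof -
  have "(N #>\<^bsub>A\<^esub> f) <#>\<^bsub>A\<^esub> (N #>\<^bsub>A\<^esub> g) = N #>\<^bsub>A\<^esub> (f \<otimes>\<^bsub>A\<^esub> g)"
    using assms by (intro normal.rcos_sum[OF normal_N]) (auto simp: A_def)
  moreover have "f \<otimes>\<^bsub>A\<^esub> g = (\<lambda>t. f t + g t)" by (simp add: A_def)
  ultimately have "Linf_class M f <#>\<^bsub>A\<^esub> Linf_class M g = N #>\<^bsub>A\<^esub> (\<lambda>t. f t + g t)"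
    by (simp only: coset_N[OF assms(1)] coset_N[OF assms(2)])
  then show ?thesis unfolding D_eq mult_FactGroup by (simp only: coset_N[OF Linf_weak_star_add[OF assms]])
qed

text \<open>Lets the subgroup property of the classes of cocycles be checked on
  representatives.\<close>

lemma subgroup_Linf_weak_star_group:
  fixes V :: "('t \<Rightarrow> ('v \<Rightarrow>\<^sub>L real)) set"
  assumes V: "V \<subseteq> Linf_weak_star M" "(\<lambda>_. 0) \<in> V" "\<And>f. f \<in> V \<Longrightarrow> (\<lambda>t. - f t) \<in> V"
    "\<And>f g. f \<in> V \<Longrightarrow> g \<in> V \<Longrightarrow> (\<lambda>t. f t + g t) \<in> V"
  shows "subgroup (Linf_class M ` V) (Linf_weak_star_group M)"
proof -
  interpret D: group "Linf_weak_star_group M :: ('t \<Rightarrow> ('v \<Rightarrow>\<^sub>L real)) set monoid" by (rule group_Linf_weak_star_group)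
  show ?thesis
  proof (rule D.subgroupI)
    show "Linf_class M ` V \<subseteq> carrier (Linf_weak_star_group M)" using V(1) by (auto simp: carrier_Linf_weak_star_group)
    show "Linf_class M ` V \<noteq> {}" using V(2) by auto
    fix c assume "c \<in> Linf_class M ` V"
    then obtain f where f: "f \<in> V" "c = Linf_class M f" by auto
    have f': "f \<in> Linf_weak_star M" "(\<lambda>t. - f t) \<in> Linf_weak_star M" using f(1) V by auto
    have "inv\<^bsub>Linf_weak_star_group M\<^esub> c = Linf_class M (\<lambda>t. - f t)"
      using f' f(2) by (intro D.inv_equality) (auto simp: mult_Linf_weak_star_group one_Linf_weak_star_group carrier_Linf_weak_star_group)
    then show "inv\<^bsub>Linf_weak_star_group M\<^esub> c \<in> Linf_class M ` V" using V(3)[OF f(1)] by auto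
    fix d assume "d \<in> Linf_class M ` V"
    then obtain g where g: "g \<in> V" "d = Linf_class M g" by auto
    then have "c \<otimes>\<^bsub>Linf_weak_star_group M\<^esub> d = Linf_class M (\<lambda>t. f t + g t)"
      using f V(1) by (auto intro!: mult_Linf_weak_star_group)
    then show "c \<otimes>\<^bsub>Linf_weak_star_group M\<^esub> d \<in> Linf_class M ` V" using V(4)[OF f(1) g(1)] by auto
  qed
qed

end

text \<open>The cohomology group takes this form once coboundaries and cocycles coincide.\<close>

lemma trivial_group_Mod_carrier:
  assumes "group K" shows "trivial_group (K Mod carrier K)"
proof -
  interpret group K by fact
  have "carrier K \<lhd> K" by (simp add: normal_inv_iff subgroup_self)
  then have "group (K Mod carrier K)" by (rule normal.factorgroup_is_group)
  moreover have "carrier (K Mod carrier K) = {carrier K}"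
    unfolding carrier_FactGroup using coset_join2[OF _ subgroup_self] one_closed by auto
  ultimately show ?thesis by (simp add: trivial_group_def)
qed

section \<open>The square of the coboundary\<close>

lemma omit_omit: "l < i \<Longrightarrow> i \<le> Suc n \<Longrightarrow> omit n l (omit (Suc n) i h) = omit n (i - 1) (omit (Suc n) l h)"
  by (auto simp: omit_def fun_eq_iff)

text \<open>The usual cancellation: by \<open>omit_omit\<close> the terms with l < i are matched
  with the remaining ones, with opposite signs.\<close>

lemma alternating_sum_omit_omit:
  fixes w :: "(nat \<Rightarrow> 'a) \<Rightarrow> 'b::real_vector"
  shows "(\<Sum>i\<le>Suc n. (-1) ^ i *\<^sub>R (\<Sum>l\<le>n. (-1) ^ l *\<^sub>R w (omit n l (omit (Suc n) i h)))) = 0"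
proof -
  define f where "f p = (case p of (i, l) \<Rightarrow> (-1) ^ (i + l) *\<^sub>R w (omit n l (omit (Suc n) i h)))" for p
  define P1 where "P1 = {p \<in> {..Suc n} \<times> {..n}. snd p < fst p}"
  define P2 where "P2 = {p \<in> {..Suc n} \<times> {..n}. \<not> snd p < fst p}"
  have "(\<Sum>i\<le>Suc n. (-1) ^ i *\<^sub>R (\<Sum>l\<le>n. (-1) ^ l *\<^sub>R w (omit n l (omit (Suc n) i h)))) = (\<Sum>p\<in>{..Suc n} \<times> {..n}. f p)"
    unfolding scaleR_sum_right sum.cartesian_product f_def by (intro sum.cong) (auto simp: power_add)
  also have "\<dots> = sum f (P1 \<union> P2)" by (rule sum.cong) (auto simp: P1_def P2_def)
  also have "\<dots> = sum f P1 + sum f P2"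
  proof (rule sum.union_disjoint)
    show "finite P1" "finite P2" unfolding P1_def P2_def by (rule finite_subset[of _ "{..Suc n} \<times> {..n}"]; auto)+
  qed (auto simp: P1_def P2_def)
  \<comment> \<open>(i, l) corresponds to (l, i - 1), whose index sum is smaller by one.\<close>
  also have "sum f P1 = sum (\<lambda>p. - f p) P2"
  proof (rule sum.reindex_bij_witness[where i="\<lambda>(a, b). (Suc b, a)" and j="\<lambda>(i, l). (l, i - 1)"])
    fix p assume "p \<in> P1"
    then obtain i l where p: "p = (i, l)" "l < i" "i \<le> Suc n" "l \<le> n" by (cases p) (auto simp: P1_def)
    then obtain i' where i': "i = Suc i'" by (cases i) auto
    have "omit n l (omit (Suc n) i h) = omit n (i - 1) (omit (Suc n) l h)" by (rule omit_omit) (use p in auto)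
    then show "- f (case p of (i, l) \<Rightarrow> (l, i - 1)) = f p" by (simp add: f_def p(1) i' add.commute)
  qed (auto simp: P1_def P2_def)
  finally show ?thesis by (simp add: sum_negf)
qed

section \<open>Cochains, cocycles and coboundaries as sets of classes\<close>

context amenable_setting
begin

lemma coboundary_add: "homogeneous_coboundary k (\<lambda>t. u t + v t) h = homogeneous_coboundary k u h + homogeneous_coboundary k v h"
  by (simp add: coboundary_omit scaleR_add_right sum.distrib)

lemma coboundary_uminus: "homogeneous_coboundary k (\<lambda>t. - u t) h = - homogeneous_coboundary k u h"
  by (simp add: coboundary_omit sum_negf)

lemma coboundary_zero: "homogeneous_coboundary k (\<lambda>t. 0) h = 0"
  by (simp add: coboundary_omit)

lemma coboundary_coboundary: "homogeneous_coboundary (Suc k) (homogeneous_coboundary k u) h = 0"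
  unfolding coboundary_omit by (rule alternating_sum_omit_omit)

text \<open>This makes the coboundary well defined on classes: each of the finitely many omissions
  pulls null sets back to null sets.\<close>

lemma coboundary_AE_cong:
  assumes "AE h in FM (Suc k). u h = v h"
  shows "AE h in FM (Suc (Suc k)). homogeneous_coboundary k u h = homogeneous_coboundary k v h"
proof -
  have "AE h in FM (Suc (Suc k)). \<forall>i\<in>{..Suc k}. u (omit (Suc k) i h) = v (omit (Suc k) i h)"
    using AE_FM_omit[OF zero_less_Suc _ assms] by (subst AE_ball_countable) auto
  then show ?thesis by eventually_elim (auto simp: coboundary_omit intro!: sum.cong)
qed

lemma coboundary_Linf:
  assumes u: "u \<in> Linf_weak_star (FM (Suc k))"
  shows "homogeneous_coboundary k u \<in> Linf_weak_star (FM (Suc (Suc k)))"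
proof -
  have "(\<lambda>h. u (omit (Suc k) i h)) \<in> Linf_weak_star (FM (Suc (Suc k)))" if i: "i \<le> Suc k" for i
  proof -
    obtain c where "AE h in FM (Suc k). norm (u h) \<le> c" using u by (auto simp: Linf_weak_star_def)
    from AE_FM_omit[OF zero_less_Suc i this] show ?thesis
      using u measurable_compose[OF measurable_omit_FM[OF i]] by (auto simp: Linf_weak_star_def)
  qed
  then have "(\<lambda>h. \<Sum>i\<le>Suc k. (-1) ^ i *\<^sub>R u (omit (Suc k) i h)) \<in> Linf_weak_star (FM (Suc (Suc k)))"
    by (intro Linf_weak_star_sum Linf_weak_star_scaleR) auto
  then show ?thesis by (simp add: coboundary_omit[abs_def])
qed

lemma L_add: "L p (\<xi> + \<zeta>) = L p \<xi> + L p \<zeta>"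
  by (cases p) (auto simp: contragredient_def intro!: blinfun_eqI simp: blinfun.add_left)

lemma L_scaleR: "L p (r *\<^sub>R \<xi>) = r *\<^sub>R L p \<xi>"
  by (cases p) (auto simp: contragredient_def intro!: blinfun_eqI simp: blinfun.scaleR_left)

lemma L_zero: "L p 0 = 0" using L_scaleR[of p 0 0] by simp

lemma L_uminus: "L p (- \<xi>) = - L p \<xi>" using L_scaleR[of p "-1" \<xi>] by simp

lemma L_sum: "finite I \<Longrightarrow> L p (\<Sum>i\<in>I. f i) = (\<Sum>i\<in>I. L p (f i))"
  by (induction I rule: finite_induct) (simp_all add: L_zero L_add del: split_paired_All)

lemma invariant_add:
  assumes "invariant n u" "invariant n v" shows "invariant n (\<lambda>t. u t + v t)"
  using assms unfolding groupoid_invariant_def L_add by eventually_elim (simp only:)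

lemma invariant_uminus:
  assumes "invariant n u" shows "invariant n (\<lambda>t. - u t)"
  using assms unfolding groupoid_invariant_def L_uminus by eventually_elim (simp only:)

lemma invariant_zero: "invariant n (\<lambda>t. 0)"
  unfolding groupoid_invariant_def L_zero by simp

text \<open>Index 0 of the tuple is the acting arrow, so omitting argument i means omitting entry i
  + 1 of the tuple, and the acting arrow stays.\<close>

lemma invariant_coboundary:
  assumes w: "invariant (Suc k) w"
  shows "invariant (Suc (Suc k)) (homogeneous_coboundary k w)"
proof -
  let ?Q = "\<lambda>h. L (h 0) (w (\<lambda>i\<in>{..<Suc k}. gmult \<G> (ginv \<G> (h 0)) (h (Suc i)))) = w (\<lambda>i\<in>{..<Suc k}. h (Suc i))"
  have w': "AE h in FM (Suc (Suc k)). ?Q h" using w unfolding groupoid_invariant_def .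
  have "AE h in FM (Suc (Suc (Suc k))). \<forall>i\<in>{..Suc k}. ?Q (omit (Suc (Suc k)) (Suc i) h)"
    using AE_FM_omit[OF zero_less_Suc _ w'] by (subst AE_ball_countable) auto
  then show ?thesis unfolding groupoid_invariant_def
  proof eventually_elim
    case (elim h)
    have 0: "omit (Suc (Suc k)) (Suc i) h 0 = h 0" for i by (simp add: omit_def)
    have 1: "(\<lambda>l\<in>{..<Suc k}. F (omit (Suc (Suc k)) (Suc i) h (Suc l))) = omit (Suc k) i (\<lambda>l\<in>{..<Suc (Suc k)}. F (h (Suc l)))"
      for i and F :: "_ \<Rightarrow> 'g \<times> 's"
      by (auto simp: omit_def fun_eq_iff)
    have Q: "L (h 0) (w (omit (Suc k) i (\<lambda>l\<in>{..<Suc (Suc k)}. gmult \<G> (ginv \<G> (h 0)) (h (Suc l))))) =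
        w (omit (Suc k) i (\<lambda>l\<in>{..<Suc (Suc k)}. h (Suc l)))" if "i \<le> Suc k" for i
    proof -
      have "?Q (omit (Suc (Suc k)) (Suc i) h)" using that by (intro bspec[OF elim]) simp
      then show ?thesis unfolding 0 1[of "gmult \<G> (ginv \<G> (h 0))" i] 1[of "\<lambda>p. p" i] .
    qed
    show ?case unfolding coboundary_omit L_sum[OF finite_atMost] L_scaleR
      by (rule sum.cong) (use Q in \<open>auto simp del: groupoid_simps\<close>)
  qed
qed

abbreviation cls :: "nat \<Rightarrow> ((nat \<Rightarrow> 'g \<times> 's) \<Rightarrow> ('v \<Rightarrow>\<^sub>L real)) \<Rightarrow> ((nat \<Rightarrow> 'g \<times> 's) \<Rightarrow> ('v \<Rightarrow>\<^sub>L real)) set" where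
  "cls k \<equiv> Linf_class (FM (Suc k))"

abbreviation cochains :: "nat \<Rightarrow> ((nat \<Rightarrow> 'g \<times> 's) \<Rightarrow> ('v \<Rightarrow>\<^sub>L real)) set" where
  "cochains k \<equiv> {u \<in> Linf_weak_star (FM (Suc k)). invariant (Suc k) u}"

text \<open>A class is a cochain as soon as one representative is invariant, and that representative
  may be used to name the class.\<close>

lemma mb_cochains_eq: "mb_cochains \<G> \<nu> \<kappa> L k = (Linf_weak_star_group (FM (Suc k)))\<lparr>carrier := cls k ` cochains k\<rparr>"
proof -
  have "{c \<in> cls k ` Linf_weak_star (FM (Suc k)). \<exists>u\<in>c. invariant (Suc k) u} = cls k ` cochains k"
  proof (intro equalityI subsetI)
    fix c assume "c \<in> {c \<in> cls k ` Linf_weak_star (FM (Suc k)). \<exists>u\<in>c. invariant (Suc k) u}"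
    then obtain f u where "c = cls k f" "u \<in> c" "invariant (Suc k) u" by auto
    then show "c \<in> cls k ` cochains k" using Linf_class_memD[of u "FM (Suc k)" f] by (intro image_eqI[of _ _ u]) auto
  qed (auto intro: Linf_class_self)
  then show ?thesis by (simp add: mb_cochains_def Let_def carrier_Linf_weak_star_group)
qed

text \<open>By \<open>coboundary_AE_cong\<close> the choice of representative inside the class does
  not matter.\<close>

lemma mb_coboundary_cls:
  assumes u: "u \<in> Linf_weak_star (FM (Suc k))"
  shows "mb_coboundary \<G> \<nu> \<kappa> k (cls k u) = cls (Suc k) (homogeneous_coboundary k u)"
proof (intro equalityI subsetI)
  fix f assume "f \<in> mb_coboundary \<G> \<nu> \<kappa> k (cls k u)"
  then obtain v where f: "f \<in> Linf_weak_star (FM (Suc (Suc k)))" and v: "AE h in FM (Suc k). v h = u h"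
    and e: "AE h in FM (Suc (Suc k)). f h = homogeneous_coboundary k v h"
    by (auto simp: mb_coboundary_def Let_def Linf_class_def)
  have "AE h in FM (Suc (Suc k)). f h = homogeneous_coboundary k u h"
    using e coboundary_AE_cong[OF v] by eventually_elim simp
  then show "f \<in> cls (Suc k) (homogeneous_coboundary k u)" using f by (simp add: Linf_class_def)
next
  fix f assume "f \<in> cls (Suc k) (homogeneous_coboundary k u)"
  then show "f \<in> mb_coboundary \<G> \<nu> \<kappa> k (cls k u)"
    using Linf_class_self[OF u] by (auto simp: mb_coboundary_def Let_def Linf_class_def)
qed

abbreviation cocycles :: "nat \<Rightarrow> ((nat \<Rightarrow> 'g \<times> 's) \<Rightarrow> ('v \<Rightarrow>\<^sub>L real)) set" where
  "cocycles k \<equiv> {u \<in> cochains k. AE h in FM (Suc (Suc k)). homogeneous_coboundary k u h = 0}"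

lemma mb_cocycles_eq: "mb_cocycles \<G> \<nu> \<kappa> L k = cls k ` cocycles k"
proof -
  have "mb_coboundary \<G> \<nu> \<kappa> k (cls k u) = \<one>\<^bsub>mb_cochains \<G> \<nu> \<kappa> L (Suc k)\<^esub> \<longleftrightarrow>
      (AE h in FM (Suc (Suc k)). homogeneous_coboundary k u h = 0)" if u: "u \<in> Linf_weak_star (FM (Suc k))" for u
  proof -
    have "cls (Suc k) (homogeneous_coboundary k u) = cls (Suc k) (\<lambda>_. 0) \<longleftrightarrow>
        (AE h in FM (Suc (Suc k)). homogeneous_coboundary k u h = 0)"
    proof
      assume "cls (Suc k) (homogeneous_coboundary k u) = cls (Suc k) (\<lambda>_. 0)"
      then have "homogeneous_coboundary k u \<in> cls (Suc k) (\<lambda>_. 0)"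
        using Linf_class_self[OF coboundary_Linf[OF u]] by simp
      then show "AE h in FM (Suc (Suc k)). homogeneous_coboundary k u h = 0" by (simp add: Linf_class_def)
    qed (rule Linf_class_eqI)
    then show ?thesis by (simp add: mb_coboundary_cls[OF u] mb_cochains_eq one_Linf_weak_star_group)
  qed
  then show ?thesis unfolding mb_cocycles_def by (auto simp: mb_cochains_eq)
qed

lemma mb_coboundaries_eq: "mb_coboundaries \<G> \<nu> \<kappa> L (Suc j) = cls (Suc j) ` homogeneous_coboundary j ` cochains j"
proof -
  have "mb_coboundary \<G> \<nu> \<kappa> j ` cls j ` cochains j = cls (Suc j) ` homogeneous_coboundary j ` cochains j"
    unfolding image_image by (rule image_cong) (auto simp: mb_coboundary_cls)
  then show ?thesis by (simp add: mb_coboundaries_def mb_cochains_eq)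
qed

text \<open>One inclusion is that the coboundary squares to zero and preserves invariance, the other
  is \<open>exactness\<close>.\<close>

lemma mb_coboundaries_eq_mb_cocycles: "mb_coboundaries \<G> \<nu> \<kappa> L (Suc j) = mb_cocycles \<G> \<nu> \<kappa> L (Suc j)"
  unfolding mb_coboundaries_eq mb_cocycles_eq
proof (intro equalityI subsetI)
  fix c assume "c \<in> cls (Suc j) ` homogeneous_coboundary j ` cochains j"
  then show "c \<in> cls (Suc j) ` cocycles (Suc j)"
    by (auto simp: coboundary_coboundary intro!: imageI coboundary_Linf invariant_coboundary)
next
  fix c assume "c \<in> cls (Suc j) ` cocycles (Suc j)"
  then obtain u where u: "u \<in> cocycles (Suc j)" "c = cls (Suc j) u" by auto
  then obtain w where w: "w \<in> Linf_weak_star (FM (Suc j))" "invariant (Suc j) w"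
    "AE h in FM (Suc (Suc j)). homogeneous_coboundary j w h = u h"
    using exactness[of u j] by auto
  then have "c = cls (Suc j) (homogeneous_coboundary j w)" using u Linf_class_eqI[OF w(3)] by simp
  then show "c \<in> cls (Suc j) ` homogeneous_coboundary j ` cochains j" using w by auto
qed

text \<open>Classes of cocycles form a subgroup; coinciding with the coboundaries, it leaves a
  trivial quotient.\<close>

theorem trivial_mb_cohomology: "trivial_group (mb_cohomology \<G> \<nu> \<kappa> L (Suc j))"
proof -
  let ?D = "Linf_weak_star_group (FM (Suc (Suc j)))" and ?Z = "mb_cocycles \<G> \<nu> \<kappa> L (Suc j)"
  have "subgroup ?Z ?D"
    unfolding mb_cocycles_eq
  proof (rule subgroup_Linf_weak_star_group)
    fix u v assume u: "u \<in> cocycles (Suc j)" and v: "v \<in> cocycles (Suc j)"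
    have "AE h in FM (Suc (Suc (Suc j))). homogeneous_coboundary (Suc j) u h = 0"
      "AE h in FM (Suc (Suc (Suc j))). homogeneous_coboundary (Suc j) v h = 0" using u v by auto
    then have "AE h in FM (Suc (Suc (Suc j))). homogeneous_coboundary (Suc j) (\<lambda>t. u t + v t) h = 0"
      by eventually_elim (simp add: coboundary_add)
    then show "(\<lambda>t. u t + v t) \<in> cocycles (Suc j)" using u v by (simp add: Linf_weak_star_add invariant_add)
  qed (auto simp: Linf_weak_star_zero invariant_zero coboundary_zero Linf_weak_star_uminus invariant_uminus coboundary_uminus)
  then have "group (?D\<lparr>carrier := ?Z\<rparr>)"
    by (rule group.subgroup_imp_group[OF group_Linf_weak_star_group])
  from trivial_group_Mod_carrier[OF this]
  show ?thesis by (simp add: mb_cohomology_def mb_cochains_eq mb_coboundaries_eq_mb_cocycles)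
qed

end

theorem proposition6p5:
  fixes haar :: "'g::{topological_group_add, t2_space, second_countable_topology} measure"
    and \<mu> :: "'s measure"
    and act :: "'g \<Rightarrow> 's \<Rightarrow> 's"
    and \<rho> :: "'g \<Rightarrow> 'v::{banach, second_countable_topology} \<Rightarrow>\<^sub>L 'v"
    and \<nu> :: "('g \<times> 's) measure"
    and \<kappa> :: "'s \<Rightarrow> ('g \<times> 's) measure"
    and k :: nat
  assumes "locally_compact_space (euclidean :: 'g topology)"
    and "left_haar_measure haar"
    and "continuous_isometric_rep \<rho>"
    and "amenable_G_space haar \<mu> act"
    and "symmetric_probability (semidirect_groupoid haar \<mu> act) \<nu>"
    and "target_disintegration (semidirect_groupoid haar \<mu> act) \<nu> \<kappa>"
    and "k \<ge> 1"
  shows "trivial_group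
    (mb_cohomology (semidirect_groupoid haar \<mu> act) \<nu> \<kappa> (\<lambda>(g, x). contragredient \<rho> g) k)"
proof -
  obtain P where "G_space \<mu> act" "equivariant_conditional_expectation haar \<mu> act P"
    using assms(4) unfolding amenable_G_space_def by auto
  then interpret amenable_setting haar \<mu> act \<nu> \<kappa> P \<rho>
    using assms by unfold_locales
  \<comment> \<open>A primitive has degree j, hence j + 1 = k \<ge> 1 arguments.\<close>
  obtain j where "k = Suc j" using assms(7) by (cases k) auto
  then show ?thesis using trivial_mb_cohomology[of j] by simp
qed

end
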